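(* Let $d>1$. The set of probabilities $\lambda$ on the affine group $H$ of $V=\mathbb R^d$ satisfying condition (c-e) is open for the topology $\mathcal W(H)$: if $\lambda$ satisfies (c-e) and $\lambda_n\to\lambda$ in $\mathcal W(H)$, then $\lambda_n$ satisfies (c-e) for all sufficiently large $n$.
   Context: $V=\mathbb R^d$ with Euclidean norm $|\cdot|$ (and the associated operator norm on matrices), $G=GL(V)$, and $H$ the affine group of $V$, whose elements $h=(g,b)$ act by $hx=gx+b$; write $g(h)=g$, $b(h)=b$. For $g\in G$ put $\gamma(g)=\max(|g|,|g^{-1}|)$. For a probability $\lambda$ on $H$, $\mu$ denotes its image on $G$ under $h\mapsto g(h)$; let $(A_n,B_n)_{n\ge1}$ be i.i.d. with law $\lambda$, $S_n=A_n\cdots A_1$, $k(s)=\lim_n(\mathbb E|S_n|^s)^{1/n}$, and $T$ the closed subsemigroup of $G$ generated by the support of $\mu$. $T$ satisfies condition i-p if (a) no finite family of proper nonzero subspaces of $V$ is invariant (as a family) under $T$, and (b) $T$ contains an element having a unique eigenvalue of maximal modulus, this eigenvalue being real and simple. Condition (c-e) on $\lambda$ means: $\int\log\gamma\,d\mu<\infty$ and (1) no point of $V$ is fixed by all elements of the support of $\lambda$; (2) there is $\alpha>0$ with $k(\alpha)=1$; (3) there is $\varepsilon>0$ with $\mathbb E(|A_1|^\alpha\gamma(A_1)^\varepsilon+|B_1|^{\alpha+\varepsilon})<\infty$; (4) ($d>1$) $T$ satisfies i-p. The topology $\mathcal W(H)$ on probabilities on $H$ (with finite moments of all orders) is defined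 by: $\lambda_n\to\lambda$ iff $\int\varphi\,d\lambda_n\to\int\varphi\,d\lambda$ for every continuous compactly supported $\varphi$ on $H$ and $\int(\gamma(g(h))^k+|b(h)|^k)\,d\lambda_n(h)\to\int(\gamma(g(h))^k+|b(h)|^k)\,d\lambda(h)$ for every $k\in\mathbb N$. *)

theory Defs
  imports "HOL-Probability.Probability" "HOL-Computational_Algebra.Polynomial"
begin

type_synonym 'n mat = "real^'n^'n"
type_synonym 'n aff = "('n mat) \<times> (real^'n)"   \<comment> \<open>h = (g, b), acting by h x = g x + b\<close>

definition opnorm :: "'n::finite mat \<Rightarrow> real" where
  "opnorm g = onorm (\<lambda>x. g *v x)"

definition gamma :: "'n::finite mat \<Rightarrow> real" where
  "gamma g = max (opnorm g) (opnorm (matrix_inv g))"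

definition Gset :: "'n::finite mat set" where
  "Gset = {g. invertible g}"

definition Hset :: "'n::finite aff set" where
  "Hset = Gset \<times> UNIV"

definition prob_H :: "'n::finite aff measure \<Rightarrow> bool" where
  "prob_H M \<longleftrightarrow> prob_space M \<and> sets M = sets borel \<and> emeasure M Hset = 1"

definition moments_H :: "'n::finite aff measure \<Rightarrow> bool" where
  "moments_H M \<longleftrightarrow> (\<forall>k::nat. integrable M (\<lambda>h. gamma (fst h) ^ k + norm (snd h) ^ k))"

definition Cc_H :: "('n::finite aff \<Rightarrow> real) \<Rightarrow> bool" where
  "Cc_H \<phi> \<longleftrightarrow> continuous_on UNIV \<phi> \<and>
     (\<exists>K. compact K \<and> K \<subseteq> Hset \<and> (\<forall>h. h \<notin> K \<longrightarrow> \<phi> h = 0))"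

definition W_conv :: "(nat \<Rightarrow> 'n::finite aff measure) \<Rightarrow> 'n aff measure \<Rightarrow> bool" where
  "W_conv Ms M \<longleftrightarrow>
     (\<forall>\<phi>. Cc_H \<phi> \<longrightarrow> (\<lambda>n. \<integral>h. \<phi> h \<partial>Ms n) \<longlonglongrightarrow> (\<integral>h. \<phi> h \<partial>M)) \<and>
     (\<forall>k::nat. (\<lambda>n. \<integral>h. gamma (fst h) ^ k + norm (snd h) ^ k \<partial>Ms n)
                 \<longlonglongrightarrow> (\<integral>h. gamma (fst h) ^ k + norm (snd h) ^ k \<partial>M))"

definition supp_H :: "'n::finite aff measure \<Rightarrow> 'n aff set" where
  "supp_H M = {h \<in> Hset. \<forall>U. open U \<and> h \<in> U \<longrightarrow> emeasure M U > 0}"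

definition supp_G :: "'n::finite aff measure \<Rightarrow> 'n mat set" where
  "supp_G M = {g \<in> Gset. \<forall>U. open U \<and> g \<in> U \<longrightarrow> emeasure (distr M borel fst) U > 0}"

definition semigrp_T :: "'n::finite aff measure \<Rightarrow> 'n mat set" where
  "semigrp_T M = \<Inter>{S. supp_G M \<subseteq> S \<and> S \<subseteq> Gset \<and> (\<forall>a\<in>S. \<forall>b\<in>S. a ** b \<in> S) \<and>
                       closedin (top_of_set Gset) S}"

definition cpoly :: "'n::finite mat \<Rightarrow> complex poly" where
  "cpoly g = det (\<chi> i j. (if i = j then [:0, 1:] else 0) - [: complex_of_real (g $ i $ j) :])"

definition proximal :: "'n::finite mat \<Rightarrow> bool" where
  "proximal g \<longleftrightarrow> (\<exists>r::real. poly (cpoly g) (complex_of_real r) = 0 \<and>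
       order (complex_of_real r) (cpoly g) = 1 \<and>
       (\<forall>z. poly (cpoly g) z = 0 \<and> z \<noteq> complex_of_real r \<longrightarrow> cmod z < \<bar>r\<bar>))"

definition cond_ip :: "'n::finite mat set \<Rightarrow> bool" where
  "cond_ip T \<longleftrightarrow>
     \<not> (\<exists>F::(real^'n) set set. finite F \<and> F \<noteq> {} \<and>
          (\<forall>W\<in>F. subspace W \<and> W \<noteq> {0} \<and> W \<noteq> UNIV) \<and>
          (\<forall>g\<in>T. \<forall>W\<in>F. (\<lambda>x. g *v x) ` W \<in> F)) \<and>
     (\<exists>g\<in>T. proximal g)"

text \<open>S_n = A_n \<cdots> A_1 on the sample sequence \<omega> (with \<omega> i = (A_{i+1}, B_{i+1})).\<close>
fun Sprod :: "nat \<Rightarrow> (nat \<Rightarrow> 'n::finite aff) \<Rightarrow> 'n mat" where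
  "Sprod 0 \<omega> = mat 1"
| "Sprod (Suc n) \<omega> = fst (\<omega> n) ** Sprod n \<omega>"

definition moment_S :: "'n::finite aff measure \<Rightarrow> real \<Rightarrow> nat \<Rightarrow> ennreal" where
  "moment_S M s n = (\<integral>\<^sup>+\<omega>. ennreal (opnorm (Sprod n \<omega>) powr s) \<partial>(PiM {..<n} (\<lambda>_. M)))"

text \<open>k(s) = 1, i.e. (E|S_n|^s)^(1/n) \<longrightarrow> 1 (an infinite moment maps to 0
  under enn2real, so this forces the moments to be eventually finite).\<close>
definition k_eq_1 :: "'n::finite aff measure \<Rightarrow> real \<Rightarrow> bool" where
  "k_eq_1 M s \<longleftrightarrow> (\<lambda>n. root n (enn2real (moment_S M s n))) \<longlonglongrightarrow> 1"

definition cond_ce :: "'n::finite aff measure \<Rightarrow> bool" where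
  "cond_ce M \<longleftrightarrow>
     (\<integral>\<^sup>+h. ennreal (ln (gamma (fst h))) \<partial>M) < \<infinity> \<and>
     \<not> (\<exists>x. \<forall>h\<in>supp_H M. fst h *v x + snd h = x) \<and>
     (\<exists>\<alpha>>0. k_eq_1 M \<alpha> \<and>
        (\<exists>\<epsilon>>0. (\<integral>\<^sup>+h. ennreal (opnorm (fst h) powr \<alpha> * gamma (fst h) powr \<epsilon>
                              + norm (snd h) powr (\<alpha> + \<epsilon>)) \<partial>M) < \<infinity>)) \<and>
     (CARD('n) > 1 \<longrightarrow> cond_ip (semigrp_T M))"

end

theory Submission
  imports Defs "HOL-Computational_Algebra.Fundamental_Theorem_Algebra"
begin

text \<open>
  Write \<open>a\<^sub>m(s) = E |S\<^sub>m|\<^sup>s\<close>. Irreducibility gives, uniformly along the sequence of laws, \<open>c a\<^sub>i(s) a\<^sub>j(s) \<le> a\<^sub>i\<^sub>+\<^sub>j(s)\<close>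
  besides \<open>a\<^sub>i\<^sub>+\<^sub>j(s) \<le> a\<^sub>i(s) a\<^sub>j(s)\<close>, and every single \<open>a\<^sub>m(s)\<close> is continuous in the law. At the critical exponent \<open>\<alpha>\<close>
  the moments \<open>a\<^sub>m(\<alpha>)\<close> stay in \<open>[1, C]\<close>, so a lower limit of \<open>E |S\<^sub>m x|\<^sup>\<alpha>\<close> is a superharmonic function comparable to \<open>|x|\<^sup>\<alpha>\<close>;
  its square root is strictly superharmonic because under i-p no orbit of the semigroup stays bounded away from \<open>0\<close> and \<open>\<infinity>\<close>.
  Hence \<open>k(\<alpha>/2) < 1\<close>, Cauchy-Schwarz gives \<open>k(3\<alpha>/2) > 1\<close>, both inequalities persist for nearby laws, and log-convexity
  of \<open>k\<close> provides an exponent with \<open>k = 1\<close> in between.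

  For i-p, a finite invariant family of a nearby semigroup is tested on a nearby proximal element: each member contains its
  dominant eigenvector or lies in its repelling hyperplane. Limits of unit vectors \<open>w\<close> in such a member and \<open>m\<close> orthogonal
  to it satisfy \<open>f \<bullet> u w = 0\<close> or \<open>m \<bullet> u\<^sup>-\<^sup>1 v = 0\<close> for all \<open>u\<close> in the semigroup, which strong irreducibility forbids.
  Fixed points of nearby laws converge to a fixed point or, after escaping to infinity, to a line fixed by the linear parts.
\<close>

subsection \<open>Operator norms and inverses\<close>

text \<open>The obstacle is that k(s) is a limit over the number of factors. Submultiplicativity
  makes it the infimum of \<open>a_m(s)^(1/m)\<close>, each continuous in the law, so k(s) < 1
  persists for nearby laws while k(s) > 1 need not. The uniform constant c makes it the supremum of
  \<open>(c a_m(s))^(1/m)\<close> as well; then both inequalities are decided by a single moment.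
  Strictness at \<alpha>/2 is essential: log-convexity with k(0) = k(\<alpha>) = 1 still allows k =
  1 on all of [0, \<alpha>], and a perturbation could then leave no positive exponent with k = 1.
  Strictness comes from one superharmonic function and a variance estimate, without spectral theory
  on projective space. For i-p the obstacle is that the invariant families of nearby semigroups may
  grow without bound, so that they have no limit. The test by a proximal element keeps only four
  unit vectors of each, which range over a compact set.\<close>

lemma opnorm_mv: "norm (a *v x) \<le> opnorm a * norm x" for a :: "'n::finite mat"
  unfolding opnorm_def by (rule onorm) simp

lemma opnorm_nonneg [simp]: "0 \<le> opnorm (a :: 'n::finite mat)"
  unfolding opnorm_def by (rule onorm_pos_le) simp

lemma opnorm_mult: "opnorm (a ** b) \<le> opnorm a * opnorm b" for a b :: "'n::finite mat"
proof -
  have "(\<lambda>x. (a ** b) *v x) = (*v) a \<circ> (*v) b"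
    by (auto simp: matrix_vector_mul_assoc)
  then show ?thesis unfolding opnorm_def
    using onorm_compose[of "(*v) a" "(*v) b"] by simp
qed

lemma opnorm_I [simp]: "opnorm (mat 1 :: 'n::finite mat) = 1"
proof -
  have "(*v) (mat 1 :: 'n mat) = (\<lambda>x. x)" by (rule ext) simp
  then show ?thesis unfolding opnorm_def using onorm_id[where 'a="real^'n"] by simp
qed

lemma opnorm_0 [simp]: "opnorm (0 :: 'n::finite mat) = 0"
proof -
  have "(*v) (0 :: 'n mat) = (\<lambda>x. 0)" by (rule ext) simp
  then show ?thesis unfolding opnorm_def using onorm_zero by simp
qed

lemma opnorm_eq_0: "opnorm a = 0 \<longleftrightarrow> a = 0" for a :: "'n::finite mat"
proof
  assume "opnorm a = 0"
  then have "a *v x = 0" for x using opnorm_mv[of a x] by simp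
  then show "a = 0" by (simp add: matrix_eq)
qed simp

lemma opnorm_triangle: "opnorm (a + b) \<le> opnorm a + opnorm b" for a b :: "'n::finite mat"
  unfolding opnorm_def matrix_vector_mult_add_rdistrib by (rule onorm_triangle) simp_all

lemma opnorm_minus: "opnorm (- a) = opnorm a" for a :: "'n::finite mat"
proof -
  have "(\<lambda>x. (- a) *v x) = (\<lambda>x. - (a *v x))"
    by (auto simp: matrix_vector_mult_def vec_eq_iff sum_negf)
  then show ?thesis unfolding opnorm_def by (simp add: onorm_neg)
qed

lemma opnorm_diff_le: "\<bar>opnorm a - opnorm b\<bar> \<le> opnorm (a - b)" for a b :: "'n::finite mat"
  using opnorm_triangle[of "a - b" b] opnorm_triangle[of "b - a" a] opnorm_minus[of "a - b"] by simp

text \<open>The largest row carries the operator norm up to the factor \<open>CARD('n)\<close>. It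
  turns a lower bound for a single inner product into one for \<open>norm (a *v y)\<close> in
  \<open>nonvanishing_lower_bound\<close>; \<open>opnorm_le_column\<close> plays the dual part where
  norms of vectors must control an operator norm.\<close>

lemma opnorm_le_row: "\<exists>i. opnorm a \<le> CARD('n) * norm (a $ i)" for a :: "'n::finite mat"
proof -
  obtain i where i: "\<And>k. norm (a $ k) \<le> norm (a $ i)"
  proof -
    have "finite (range (\<lambda>k. norm (a $ k)))" by simp
    then have "Max (range (\<lambda>k. norm (a $ k))) \<in> range (\<lambda>k. norm (a $ k))" by (intro Max_in) auto
    then obtain i where "Max (range (\<lambda>k. norm (a $ k))) = norm (a $ i)" by (elim imageE)
    then show ?thesis using that[of i] Max_ge[of "range (\<lambda>k. norm (a $ k))"] by auto
  qed
  have "norm (a *v x) \<le> CARD('n) * norm (a $ i) * norm x" for x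
  proof -
    have "norm (a *v x) \<le> (\<Sum>k\<in>UNIV. \<bar>(a *v x) $ k\<bar>)" by (rule norm_le_l1_cart)
    also have "\<dots> \<le> (\<Sum>k\<in>(UNIV::'n set). norm (a $ i) * norm x)"
    proof (rule sum_mono)
      fix k
      have "\<bar>(a *v x) $ k\<bar> = \<bar>(a $ k) \<bullet> x\<bar>" by (simp add: matrix_vector_mul_component)
      also have "\<dots> \<le> norm (a $ k) * norm x" by (rule Cauchy_Schwarz_ineq2)
      also have "\<dots> \<le> norm (a $ i) * norm x" using i by (intro mult_right_mono) auto
      finally show "\<bar>(a *v x) $ k\<bar> \<le> norm (a $ i) * norm x" .
    qed
    finally show ?thesis by simp
  qed
  then show ?thesis unfolding opnorm_def by (intro exI[of _ i] onorm_le) simp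
qed

lemma norm_mv_axis_sum: "norm (a *v x) \<le> (\<Sum>j\<in>UNIV. norm (a *v axis j 1)) * norm x" for a :: "'n::finite mat"
proof -
  have "a *v x = a *v (\<Sum>j\<in>UNIV. x $ j *\<^sub>R axis j 1)"
    using basis_expansion[of x] by (simp add: scalar_mult_eq_scaleR)
  also have "\<dots> = (\<Sum>j\<in>UNIV. x $ j *\<^sub>R (a *v axis j 1))"
    by (simp add: matrix_vector_mult_scaleR linear_sum[of "(*v) a"])
  finally have "norm (a *v x) \<le> (\<Sum>j\<in>UNIV. norm (x $ j *\<^sub>R (a *v axis j 1)))"
    by (simp only: norm_sum)
  also have "\<dots> \<le> (\<Sum>j\<in>UNIV. norm x * norm (a *v axis j 1))"
    by (intro sum_mono) (auto intro!: mult_right_mono component_le_norm_cart simp: )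
  finally show ?thesis by (simp add: sum_distrib_left mult.commute)
qed

lemma opnorm_le_sum_columns: "opnorm a \<le> (\<Sum>j\<in>UNIV. norm (a *v axis j 1))" for a :: "'n::finite mat"
  unfolding opnorm_def by (rule onorm_le) (rule norm_mv_axis_sum)

lemma opnorm_le_column: "\<exists>j. opnorm a \<le> CARD('n) * norm (a *v axis j 1)" for a :: "'n::finite mat"
proof -
  obtain i where i: "\<And>k. norm (a *v axis k 1) \<le> norm (a *v axis i 1)"
  proof -
    let ?f = "\<lambda>k. norm (a *v axis k 1)"
    have "finite (range ?f)" by simp
    then have "Max (range ?f) \<in> range ?f" by (intro Max_in) auto
    then obtain i where "Max (range ?f) = ?f i" by (elim imageE)
    then show ?thesis using that[of i] Max_ge[of "range ?f"] by auto
  qed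
  have "(\<Sum>j\<in>UNIV. norm (a *v axis j 1)) \<le> CARD('n) * norm (a *v axis i 1)"
    using sum_bounded_above[of UNIV "\<lambda>j. norm (a *v axis j 1)", OF i] by simp
  with opnorm_le_sum_columns[of a] show ?thesis by (meson order_trans)
qed

lemma opnorm_le_norm: "opnorm a \<le> CARD('n) * norm a" for a :: "'n::finite mat"
proof -
  obtain i where "opnorm a \<le> CARD('n) * norm (a $ i)" using opnorm_le_row by blast
  also have "\<dots> \<le> CARD('n) * norm a" by (intro mult_left_mono Finite_Cartesian_Product.norm_nth_le) auto
  finally show ?thesis .
qed

section \<open>Continuity and measurability of the matrix operations\<close>

lemma continuous_opnorm: "continuous_on UNIV (opnorm :: 'n::finite mat \<Rightarrow> real)"
proof -
  have "norm (opnorm x - opnorm y) \<le> CARD('n) * norm (x - y)" for x y :: "'n mat"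
    using opnorm_diff_le[of x y] opnorm_le_norm[of "x - y"] by simp
  then have "CARD('n)-lipschitz_on UNIV (opnorm :: 'n mat \<Rightarrow> real)"
    by (intro lipschitz_onI) (auto simp: dist_norm)
  then show ?thesis by (rule lipschitz_on_continuous_on)
qed

lemmas continuous_on_opnorm [continuous_intros] =
  continuous_on_compose2[OF continuous_opnorm _ subset_UNIV]

lemma borel_measurable_opnorm [measurable]: "opnorm \<in> borel_measurable borel"
  by (rule borel_measurable_continuous_onI[OF continuous_opnorm])

lemma continuous_on_matrix_mult [continuous_intros]:
  fixes f g :: "'a::topological_space \<Rightarrow> 'n::finite mat"
  assumes "continuous_on S f" "continuous_on S g"
  shows "continuous_on S (\<lambda>x. f x ** g x)"
  unfolding matrix_matrix_mult_def using assms by (intro continuous_intros)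

lemma continuous_on_square_matrix_vector_mult [continuous_intros]:
  fixes f :: "'a::topological_space \<Rightarrow> 'n::finite mat"
  assumes "continuous_on S f" "continuous_on S g"
  shows "continuous_on S (\<lambda>x. f x *v g x)"
  unfolding matrix_vector_mult_def using assms by (intro continuous_intros)

lemma tendsto_matrix_mult [tendsto_intros]:
  fixes f g :: "'a \<Rightarrow> 'n::finite mat"
  assumes "(f \<longlongrightarrow> a) F" "(g \<longlongrightarrow> b) F"
  shows "((\<lambda>x. f x ** g x) \<longlongrightarrow> a ** b) F"
  unfolding matrix_matrix_mult_def using assms by (intro tendsto_intros)

lemma tendsto_square_matrix_vector_mult [tendsto_intros]:
  fixes f :: "'a \<Rightarrow> 'b::real_normed_field^'n::finite^'n"
  assumes "(f \<longlongrightarrow> a) F" "(g \<longlongrightarrow> b) F"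
  shows "((\<lambda>x. f x *v g x) \<longlongrightarrow> a *v b) F"
  unfolding matrix_vector_mult_def using assms by (intro tendsto_intros)

lemma continuous_on_det [continuous_intros]:
  fixes f :: "'a::topological_space \<Rightarrow> 'b::{real_normed_field}^'n::finite^'n"
  assumes "continuous_on S f"
  shows "continuous_on S (\<lambda>x. det (f x))"
  unfolding det_def using assms by (intro continuous_intros)

lemma tendsto_det [tendsto_intros]:
  fixes f :: "'a \<Rightarrow> 'b::{real_normed_field}^'n::finite^'n"
  assumes "(f \<longlongrightarrow> a) F"
  shows "((\<lambda>x. det (f x)) \<longlongrightarrow> det a) F"
  unfolding det_def using assms by (intro tendsto_intros)

lemma borel_measurable_matrix_mult [measurable (raw)]:
  fixes f g :: "'a \<Rightarrow> 'n::finite mat"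
  assumes "f \<in> borel_measurable M" "g \<in> borel_measurable M"
  shows "(\<lambda>x. f x ** g x) \<in> borel_measurable M"
  using assms by (rule borel_measurable_continuous_Pair) (auto intro!: continuous_intros)

lemma borel_measurable_matrix_vector_mult [measurable (raw)]:
  fixes f :: "'a \<Rightarrow> 'n::finite mat"
  assumes "f \<in> borel_measurable M" "g \<in> borel_measurable M"
  shows "(\<lambda>x. f x *v g x) \<in> borel_measurable M"
  using assms by (rule borel_measurable_continuous_Pair) (auto intro!: continuous_intros)

section \<open>Invertible matrices\<close>

lemma Gset_iff_det: "g \<in> Gset \<longleftrightarrow> det g \<noteq> 0"
  by (simp add: Gset_def invertible_det_nz)

lemma open_Gset: "open (Gset :: 'n::finite mat set)"
proof -
  have "Gset = {g :: 'n mat. det g \<noteq> 0}" by (auto simp: Gset_iff_det)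
  moreover have "open {g :: 'n mat. det g \<noteq> 0}"
    by (intro open_Collect_neq continuous_on_det continuous_on_id continuous_on_const)
  ultimately show ?thesis by simp
qed

lemma open_Hset: "open (Hset :: 'n::finite aff set)"
  unfolding Hset_def by (intro open_Times open_Gset open_UNIV)

lemma Gset_mult: "a \<in> Gset \<Longrightarrow> b \<in> Gset \<Longrightarrow> a ** b \<in> Gset"
  by (simp add: Gset_iff_det det_mul)

lemma matrix_inv_right: "g \<in> Gset \<Longrightarrow> g ** matrix_inv g = mat 1"
  and matrix_inv_left: "g \<in> Gset \<Longrightarrow> matrix_inv g ** g = mat 1"
proof -
  assume "g \<in> Gset"
  then have "\<exists>A'. g ** A' = mat 1 \<and> A' ** g = mat 1" by (simp add: Gset_def invertible_def)
  from someI_ex[OF this] show "g ** matrix_inv g = mat 1" "matrix_inv g ** g = mat 1"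
    by (simp_all add: matrix_inv_def)
qed

lemma matrix_inv_mv: "g \<in> Gset \<Longrightarrow> g *v (matrix_inv g *v x) = x"
  "g \<in> Gset \<Longrightarrow> matrix_inv g *v (g *v x) = x"
  by (simp_all add: matrix_vector_mul_assoc matrix_inv_left matrix_inv_right)

lemma Gset_inj: "g \<in> Gset \<Longrightarrow> g *v x = g *v y \<Longrightarrow> x = y"
  by (metis matrix_inv_mv(2))

lemma matrix_inv_unique: "g \<in> Gset \<Longrightarrow> g ** h = mat 1 \<Longrightarrow> matrix_inv g = h"
  by (metis matrix_inv_left matrix_mul_assoc matrix_mul_lid matrix_mul_rid)

lemma matrix_inv_mult:
  assumes "a \<in> Gset" "b \<in> Gset"
  shows "matrix_inv (a ** b) = matrix_inv b ** matrix_inv a"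
proof (rule matrix_inv_unique[OF Gset_mult[OF assms]])
  have "a ** b ** (matrix_inv b ** matrix_inv a) = a ** (b ** matrix_inv b) ** matrix_inv a"
    by (simp add: matrix_mul_assoc)
  then show "a ** b ** (matrix_inv b ** matrix_inv a) = mat 1"
    using assms by (simp add: matrix_inv_right)
qed

text \<open>Cramer's rule writes every entry of the inverse as a quotient of determinants whose
  denominator does not vanish on \<open>Gset\<close>.\<close>

lemma continuous_on_matrix_inv: "continuous_on Gset (matrix_inv :: 'n::finite mat \<Rightarrow> 'n mat)"
proof -
  define C :: "'n mat \<Rightarrow> 'n mat" where
    "C A = (\<chi> k l. det (\<chi> i j. if j = k then axis l 1 $ i else A $ i $ j) / det A)" for A
  have "continuous_on Gset (\<lambda>x :: 'n mat. if j = k then axis l 1 $ i else x $ i $ j)" for i j k l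
    by (cases "j = k") (auto intro!: continuous_intros)
  then have "continuous_on Gset C" unfolding C_def
    by (intro continuous_intros continuous_on_det) (auto simp: Gset_iff_det)
  moreover have "matrix_inv A = C A" if "A \<in> Gset" for A :: "'n mat"
  proof -
    have "matrix_inv A *v axis l 1 = (\<chi> k. det (\<chi> i j. if j = k then axis l 1 $ i else A $ i $ j) / det A)" for l
      using that matrix_inv_mv(1)[OF that, of "axis l 1"]
      by (subst cramer[symmetric]) (auto simp: Gset_iff_det)
    then have "matrix_inv A $ k $ l = C A $ k $ l" for k l
      by (simp add: C_def vec_eq_iff matrix_vector_mult_basis column_def)
    then show ?thesis by (simp add: vec_eq_iff)
  qed
  ultimately show ?thesis by (simp cong: continuous_on_cong)
qed

lemma tendsto_matrix_inv:
  fixes f :: "'a \<Rightarrow> 'n::finite mat"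
  assumes "(f \<longlongrightarrow> a) F" "a \<in> Gset"
  shows "((\<lambda>x. matrix_inv (f x)) \<longlongrightarrow> matrix_inv a) F"
  using continuous_on_matrix_inv assms open_Gset
  by (metis continuous_on_eq_continuous_at isCont_tendsto_compose)

lemma continuous_on_gamma: "continuous_on Gset (gamma :: 'n::finite mat \<Rightarrow> real)"
  unfolding gamma_def
  by (intro continuous_intros continuous_on_matrix_inv)

lemma opnorm_inv_ge: "g \<in> Gset \<Longrightarrow> 1 \<le> opnorm g * opnorm (matrix_inv g)" for g :: "'n::finite mat"
  using opnorm_mult[of g "matrix_inv g"] by (simp add: matrix_inv_right)

lemma opnorm_pos: "g \<in> Gset \<Longrightarrow> 0 < opnorm g" for g :: "'n::finite mat"
  using opnorm_inv_ge[of g] opnorm_nonneg[of g]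
  by (cases "opnorm g = 0") (auto simp del: opnorm_nonneg)

lemma opnorm_le_gamma: "opnorm g \<le> gamma g" by (simp add: gamma_def)

lemma gamma_nonneg [simp]: "0 \<le> gamma (g :: 'n::finite mat)"
  using opnorm_le_gamma[of g] opnorm_nonneg[of g] by linarith

lemma gamma_ge_1: "g \<in> Gset \<Longrightarrow> 1 \<le> gamma g" for g :: "'n::finite mat"
proof (rule ccontr)
  assume g: "g \<in> Gset" "\<not> 1 \<le> gamma g"
  then have "opnorm g < 1" "opnorm (matrix_inv g) < 1" by (auto simp: gamma_def)
  then have "opnorm g * opnorm (matrix_inv g) < 1 * 1"
    using opnorm_nonneg by (intro mult_strict_mono') auto
  then show False using opnorm_inv_ge[OF g(1)] by simp
qed

lemma opnorm_mult_ge: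
  fixes X :: "'n::finite mat"
  assumes "g \<in> Gset"
  shows "opnorm X \<le> opnorm (matrix_inv g) * opnorm (g ** X)"
  using opnorm_mult[of "matrix_inv g" "g ** X"] assms
  by (simp add: matrix_mul_assoc matrix_inv_left)

subsection \<open>Proximal matrices\<close>

definition cmat :: "'n::finite mat \<Rightarrow> complex^'n^'n" where
  "cmat g = (\<chi> i j. complex_of_real (g $ i $ j))"

definition cvec :: "real^'n::finite \<Rightarrow> complex^'n" where
  "cvec x = (\<chi> i. complex_of_real (x $ i))"

lemma cmat_mv: "cmat g *v cvec x = cvec (g *v x)"
  by (simp add: cmat_def cvec_def matrix_vector_mult_def vec_eq_iff)

lemma cvec_scale: "complex_of_real c *s cvec x = cvec (c *\<^sub>R x)"
  by (simp add: cvec_def vec_eq_iff)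

lemma cvec_diff: "cvec x - cvec y = cvec (x - y)"
  by (simp add: cvec_def vec_eq_iff)

lemma cvec_eq_0 [simp]: "cvec x = 0 \<longleftrightarrow> x = 0"
  by (simp add: cvec_def vec_eq_iff)

lemma det_cmat: "det (cmat A) = complex_of_real (det A)"
  by (simp add: det_def cmat_def)

lemma mat_minus_cmat: "mat (complex_of_real r) - cmat g = cmat (mat r - g)"
  by (simp add: vec_eq_iff cmat_def mat_def)

lemma mat_minus_mv: "(mat z - H) *v y = z *s y - H *v y" for H :: "complex^'n::finite^'n"
  by (simp add: matrix_vector_mult_def mat_def vec_eq_iff sum_subtractf left_diff_distrib
      if_distrib[of "\<lambda>x. x * _"] cong: if_cong)

lemma mat_minus_mv_real: "(mat z - H) *v y = z *\<^sub>R y - H *v y" for H :: "real^'n::finite^'n"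
  by (simp add: matrix_vector_mult_def mat_def vec_eq_iff sum_subtractf left_diff_distrib
      if_distrib[of "\<lambda>x. x * _"] cong: if_cong)

lemma poly_det: "poly (det A) z = det (\<chi> i j. poly (A $ i $ j) z)"
  for A :: "'a::comm_ring_1 poly^'n::finite^'n"
  by (simp add: det_def poly_sum poly_prod)

lemma poly_cpoly: "poly (cpoly g) z = det (mat z - cmat g)"
proof -
  have "(\<chi> i j. poly ((\<chi> i j. (if i = j then [:0, 1:] else 0) - [:complex_of_real (g $ i $ j):]) $ i $ j) z)
      = mat z - cmat g"
    by (auto simp: vec_eq_iff mat_def cmat_def)
  then show ?thesis unfolding cpoly_def poly_det by simp
qed

lemma det_eq_0_iff_ker: "det A = 0 \<longleftrightarrow> (\<exists>y. y \<noteq> 0 \<and> A *v y = 0)" for A :: "'a::field^'n::finite^'n"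
  using invertible_det_nz[of A] matrix_left_invertible_ker[of A] invertible_left_inverse[of A]
  by auto

lemma cpoly_root_iff: "poly (cpoly g) z = 0 \<longleftrightarrow> (\<exists>y. y \<noteq> 0 \<and> cmat g *v y = z *s y)"
  unfolding poly_cpoly det_eq_0_iff_ker mat_minus_mv by auto

text \<open>At a real root the matrix \<open>mat r - g\<close> is singular over the reals, so its
  kernel contains a real vector; transposing keeps the determinant and yields the left eigenvector
  \<open>f\<close>.\<close>

lemma cpoly_real_root:
  assumes "poly (cpoly g) (complex_of_real r) = 0"
  shows "\<exists>v. v \<noteq> 0 \<and> g *v v = r *\<^sub>R v" "\<exists>f. f \<noteq> 0 \<and> transpose g *v f = r *\<^sub>R f"
proof -
  have d: "det (mat r - g) = 0"
    using assms unfolding poly_cpoly mat_minus_cmat det_cmat by simp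
  then show "\<exists>v. v \<noteq> 0 \<and> g *v v = r *\<^sub>R v"
    by (auto simp: det_eq_0_iff_ker mat_minus_mv_real)
  have "transpose (mat r - g) = mat r - transpose g"
    by (auto simp: transpose_def mat_def vec_eq_iff)
  then have "det (mat r - transpose g) = 0" using d by (metis det_transpose)
  then show "\<exists>f. f \<noteq> 0 \<and> transpose g *v f = r *\<^sub>R f"
    by (auto simp: det_eq_0_iff_ker mat_minus_mv_real)
qed

section \<open>The derivative of the characteristic polynomial and simple roots\<close>

lemma pderiv_sum: "pderiv (sum f S) = (\<Sum>i\<in>S. pderiv (f i))" for f :: "_ \<Rightarrow> complex poly"
  by (induction S rule: infinite_finite_induct) (auto simp: pderiv_add)

lemma pderiv_det:
  "pderiv (det A) = (\<Sum>k\<in>UNIV. det (\<chi> i j. if i = k then pderiv (A $ i $ j) else A $ i $ j))"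
  for A :: "complex poly^'n::finite^'n"
proof -
  have 1: "pderiv (of_int s * q) = of_int s * pderiv q" for s and q :: "complex poly"
    by (simp add: of_int_poly pderiv_mult pderiv_pCons del: mult_pCons_left)
  have 2: "(\<Prod>i\<in>UNIV. (if i = k then pderiv (A $ i $ p i) else A $ i $ p i))
        = prod (\<lambda>i. A $ i $ p i) (UNIV - {k}) * pderiv (A $ k $ p k)" for k p
    by (subst prod.remove[of _ k]) (auto intro!: prod.cong simp: mult.commute)
  show ?thesis
    unfolding det_def pderiv_sum 1 pderiv_prod
    by (subst sum.swap) (simp add: 2 sum_distrib_left)
qed

text \<open>Row k of X - g differentiates to the k-th unit row, so the k-th summand is the principal
  minor of z - g with row and column k deleted. In this form the derivative can be evaluated on
  eigenvectors and is visibly continuous in g and z.\<close>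

lemma poly_pderiv_cpoly:
  "poly (pderiv (cpoly g)) z =
     (\<Sum>k\<in>UNIV. det (\<chi> i j. if i = k then (if i = j then 1 else 0) else (mat z - cmat g) $ i $ j))"
proof -
  have *: "(\<chi> i j. poly ((\<chi> i j. if i = k then pderiv ((if i = j then [:0, 1:] else 0) - [:complex_of_real (g $ i $ j):])
           else (if i = j then [:0, 1:] else 0) - [:complex_of_real (g $ i $ j):]) $ i $ j) z)
      = (\<chi> i j. if i = k then (if i = j then 1 else 0) else (mat z - cmat g) $ i $ j)" for k
    by (auto simp: vec_eq_iff mat_def cmat_def pderiv_diff pderiv_pCons)
  show ?thesis unfolding cpoly_def pderiv_det poly_sum poly_det
    by (intro sum.cong refl, subst *[symmetric], intro arg_cong[where f = det]) (simp add: vec_eq_iff)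
qed

lemma order_eq_1_iff:
  fixes p :: "complex poly"
  assumes "p \<noteq> 0" "poly p a = 0"
  shows "order a p = 1 \<longleftrightarrow> poly (pderiv p) a \<noteq> 0"
proof -
  have "degree p \<noteq> 0"
  proof
    assume "degree p = 0"
    then obtain c where "p = [:c:]" by (rule degree_eq_zeroE)
    with assms show False by simp
  qed
  then have "pderiv p \<noteq> 0" by (simp add: pderiv_eq_0_iff)
  show ?thesis
    using order_pderiv[OF assms] order_root[of "pderiv p" a] assms \<open>pderiv p \<noteq> 0\<close>
    by auto
qed

text \<open>A second independent eigenvector would give, for every k, a nonzero eigenvector whose
  k-th coordinate is 0. It lies in the kernel of the k-th matrix in
  \<open>poly_pderiv_cpoly\<close>, so all summands of the derivative would vanish.\<close>

lemma simple_root_eigenspace: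
  assumes "poly (pderiv (cpoly g)) (complex_of_real r) \<noteq> 0"
    and v: "g *v v = r *\<^sub>R v" "v \<noteq> 0" and y: "g *v y = r *\<^sub>R y"
  shows "\<exists>c. y = c *\<^sub>R v"
proof (rule ccontr)
  assume n: "\<not> (\<exists>c. y = c *\<^sub>R v)"
  have "det (\<chi> i j. if i = k then (if i = j then 1 else 0) else (mat (complex_of_real r) - cmat g) $ i $ j) = 0"
    (is "det ?A = 0") for k
  proof -
    obtain w where w: "w \<noteq> 0" "g *v w = r *\<^sub>R w" "w $ k = 0"
    proof (cases "v $ k = 0")
      case True
      then show ?thesis using v by (intro that[of v]) auto
    next
      case False
      let ?w = "y - (y $ k / v $ k) *\<^sub>R v"
      have "?w \<noteq> 0" using n by auto
      moreover have "g *v ?w = r *\<^sub>R ?w"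
        by (simp add: matrix_vector_mult_diff_distrib matrix_vector_mult_scaleR v y algebra_simps)
      ultimately show ?thesis using False by (intro that[of ?w]) auto
    qed
    have "(mat (complex_of_real r) - cmat g) *v cvec w = 0"
      unfolding mat_minus_mv cmat_mv cvec_scale w(2) by simp
    then have "(?A *v cvec w) $ i = 0" for i
      using w(3) by (cases "i = k") (auto simp: matrix_vector_mult_def vec_eq_iff cvec_def
          if_distrib[of "\<lambda>x. x * _"] cong: if_cong)
    then have "?A *v cvec w = 0" by (simp add: vec_eq_iff)
    then show ?thesis using w(1) det_eq_0_iff_ker[of ?A] cvec_eq_0 by blast
  qed
  then show False using assms(1) unfolding poly_pderiv_cpoly by simp
qed

text \<open>The vector p(H) y. The matrix p(H) is never formed, since every argument below follows
  the iterates of a single vector.\<close>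

definition poly_act :: "complex^'n^'n \<Rightarrow> complex poly \<Rightarrow> complex^'n \<Rightarrow> complex^'n::finite" where
  "poly_act H p y = (\<Sum>i\<le>degree p. coeff p i *s (((*v) H ^^ i) y))"

lemma poly_act_bound:
  assumes "degree p \<le> N"
  shows "poly_act H p y = (\<Sum>i\<le>N. coeff p i *s (((*v) H ^^ i) y))"
  unfolding poly_act_def using assms
  by (intro sum.mono_neutral_left) (auto simp: coeff_eq_0)

lemma mv_smult: "H *v (c *s y) = c *s (H *v y)" for H :: "complex^'n::finite^'n"
  by (simp add: matrix_vector_mult_def vec_eq_iff sum_distrib_left mult.left_commute)

lemma mv_sum: "H *v (sum f S) = (\<Sum>i\<in>S. H *v f i)" for H :: "complex^'n::finite^'n"
  by (induction S rule: infinite_finite_induct) (auto simp: matrix_vector_right_distrib)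

lemma pow_smult: "((*v) H ^^ i) (c *s y) = c *s ((*v) H ^^ i) y" for H :: "complex^'n::finite^'n"
  by (induction i) (auto simp: mv_smult)

lemma pow_diff: "((*v) H ^^ i) (x - y) = ((*v) H ^^ i) x - ((*v) H ^^ i) y" for H :: "complex^'n::finite^'n"
  by (induction i) (auto simp: matrix_vector_mult_diff_distrib)

lemma poly_act_pCons_0: "poly_act H (pCons 0 q) y = H *v poly_act H q y"
proof -
  have "poly_act H (pCons 0 q) y = (\<Sum>i\<le>Suc (degree q). coeff (pCons 0 q) i *s (((*v) H ^^ i) y))"
    by (intro poly_act_bound degree_pCons_le)
  also have "\<dots> = H *v poly_act H q y"
    unfolding poly_act_def by (subst sum.atMost_Suc_shift) (simp add: mv_sum mv_smult del: sum.atMost_Suc)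
  finally show ?thesis .
qed

lemma poly_act_factor: "poly_act H ([:-z, 1:] * q) y = H *v poly_act H q y - z *s poly_act H q y"
proof -
  let ?N = "Suc (degree q)"
  have "degree ([:-z, 1:] * q) \<le> ?N"
    using degree_mult_le[of "[:-z, 1:]" q] by simp
  then have "poly_act H ([:-z, 1:] * q) y = (\<Sum>i\<le>?N. coeff ([:-z, 1:] * q) i *s (((*v) H ^^ i) y))"
    by (rule poly_act_bound)
  also have "\<dots> = (\<Sum>i\<le>?N. coeff (pCons 0 q) i *s (((*v) H ^^ i) y)) - z *s (\<Sum>i\<le>?N. coeff q i *s (((*v) H ^^ i) y))"
    by (simp add: vec.scale_sum_right sum_subtractf[symmetric] vec.scale_left_diff_distrib algebra_simps
        del: sum.atMost_Suc)
  also have "\<dots> = H *v poly_act H q y - z *s poly_act H q y"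
    using poly_act_bound[of "pCons 0 q" ?N H y] poly_act_bound[of q ?N H y]
    by (simp add: poly_act_pCons_0 degree_pCons_le del: sum.atMost_Suc)
  finally show ?thesis .
qed

lemma poly_act_commute: "poly_act H q (H *v y - z *s y) = H *v poly_act H q y - z *s poly_act H q y"
  unfolding poly_act_def
  by (simp add: mv_sum mv_smult pow_diff pow_smult funpow_swap1[symmetric] vec.scale_sum_right
      sum_subtractf[symmetric] vec.scale_right_diff_distrib) (simp add: mult.commute)

text \<open>Over the complex numbers \<open>P\<close> splits, and one linear factor is stripped at a
  time: a property of P(H) y descends to y as soon as it passes from (H - z) y to y for every root
  z. It serves with \<open>G\<close> the vanishing of a vector and, in
  \<open>power_bounded_regular\<close>, with \<open>G\<close> a convergence to 0; there it replaces
  the Jordan form.\<close>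

lemma poly_act_peel:
  assumes "P \<noteq> 0" "G (poly_act H P y)"
    and "\<And>z y. poly P z = 0 \<Longrightarrow> G (H *v y - z *s y) \<Longrightarrow> G y"
    and "\<And>c y. c \<noteq> 0 \<Longrightarrow> G (c *s y) \<Longrightarrow> G y"
  shows "G y"
  using assms(1-3)
proof (induction "degree P" arbitrary: P)
  case 0
  then obtain c where c: "P = [:c:]" by (metis degree_eq_zeroE)
  with 0 have "c \<noteq> 0" "G (c *s y)" by (auto simp: poly_act_def)
  then show ?case using assms(4) by blast
next
  case (Suc n)
  then have "\<not> constant (poly P)" by (simp add: constant_degree)
  then obtain z where z: "poly P z = 0" using fundamental_theorem_of_algebra by blast
  then obtain Q where Q: "P = [:-z, 1:] * Q" by (metis poly_eq_0_iff_dvd dvdE)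
  then have "Q \<noteq> 0" using Suc.prems(1) by auto
  have 1: "G (poly_act H Q y)"
    using Suc.prems(3)[OF z] Suc.prems(2) unfolding Q poly_act_factor by blast
  have "Suc n = Suc (degree Q)"
    using Suc(2) \<open>Q \<noteq> 0\<close> unfolding Q by (subst (asm) degree_mult_eq) auto
  then have 2: "n = degree Q" by simp
  have 3: "poly P z = 0" if "poly Q z = 0" for z using that by (simp add: Q)
  show ?case
    by (rule Suc.hyps(1)[OF 2 \<open>Q \<noteq> 0\<close> 1]) (rule Suc.prems(3)[OF 3])
qed

text \<open>Dependence of an indexed sequence, not of its range: a repeated vector is a relation
  that the set of values forgets, hence the second case.\<close>

lemma seq_dependent:
  fixes w :: "nat \<Rightarrow> 'a::euclidean_space"
  shows "\<exists>N c. (\<exists>i\<le>N. c i \<noteq> 0) \<and> (\<Sum>i\<le>N. c i *\<^sub>R w i) = 0"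
proof (cases "inj_on w {..DIM('a)}")
  case True
  then have "dependent (w ` {..DIM('a)})"
    by (intro dependent_biggerset) (simp add: card_image)
  then obtain u where u: "\<exists>v\<in>w ` {..DIM('a)}. u v \<noteq> 0" "(\<Sum>v\<in>w ` {..DIM('a)}. u v *\<^sub>R v) = 0"
    by (auto simp: dependent_finite)
  then show ?thesis using True
    by (intro exI[of _ "DIM('a)"] exI[of _ "\<lambda>i. u (w i)"]) (auto simp: sum.reindex)
next
  case False
  then obtain i j where ij: "i \<noteq> j" "w i = w j" by (auto simp: inj_on_def)
  let ?c = "\<lambda>k. if k = i then 1 else if k = j then - 1 else (0::real)"
  have "(\<Sum>k\<le>max i j. ?c k *\<^sub>R w k) = (\<Sum>k\<in>{i, j}. ?c k *\<^sub>R w k)"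
    by (intro sum.mono_neutral_right) auto
  also have "\<dots> = 0" using ij by simp
  finally show ?thesis by (intro exI[of _ "max i j"] exI[of _ ?c]) auto
qed

text \<open>Takes the place of the Cayley-Hamilton theorem. The iterates of one vector are dependent
  already over the reals, because \<open>complex^'n\<close> has finite real dimension.\<close>

lemma annihilator_exists: "\<exists>P. P \<noteq> 0 \<and> poly_act H P y = 0"
proof -
  obtain N c where c: "\<exists>i\<le>N. c i \<noteq> 0" "(\<Sum>i\<le>N. c i *\<^sub>R ((*v) H ^^ i) y) = 0"
    using seq_dependent[of "\<lambda>i. ((*v) H ^^ i) y"] by blast
  define P where "P = (\<Sum>i\<le>N. monom (complex_of_real (c i)) i)"
  have coeff: "coeff P k = (if k \<le> N then complex_of_real (c k) else 0)" for k
    by (auto simp: P_def coeff_sum sum.delta if_distrib cong: if_cong)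
  have "P \<noteq> 0" using c(1) coeff by (metis coeff_0 of_real_eq_0_iff)
  moreover have "degree P \<le> N" by (rule degree_le) (simp add: coeff)
  then have "poly_act H P y = (\<Sum>i\<le>N. c i *\<^sub>R ((*v) H ^^ i) y)"
    by (subst poly_act_bound) (auto simp: coeff vec_eq_iff scaleR_conv_of_real[where 'a=complex] intro!: sum.cong)
  ultimately show ?thesis using c(2) by auto
qed

text \<open>The zero polynomial would have the root |r| + 1, which exceeds the bound.
  \<open>order_eq_1_iff\<close> asks for a nonzero polynomial.\<close>

lemma cpoly_nonzero_if_dominant:
  assumes dom: "\<And>z. poly (cpoly g) z = 0 \<Longrightarrow> z \<noteq> complex_of_real r \<Longrightarrow> cmod z < \<bar>r\<bar>"
  shows "cpoly g \<noteq> 0"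
proof
  assume "cpoly g = 0"
  then have "poly (cpoly g) (complex_of_real (\<bar>r\<bar> + 1)) = 0" by simp
  moreover have "\<bar>r\<bar> + 1 \<noteq> r" by linarith
  then have "complex_of_real (\<bar>r\<bar> + 1) \<noteq> complex_of_real r" by (simp only: of_real_eq_iff not_False_eq_True)
  ultimately show False using dom[of "complex_of_real (\<bar>r\<bar> + 1)"] by (simp only: norm_of_real) simp
qed

lemma proximalE:
  assumes "proximal g" "g \<in> Gset"
  obtains r v f where "r \<noteq> 0" "v \<noteq> 0" "g *v v = r *\<^sub>R v" "f \<noteq> 0" "transpose g *v f = r *\<^sub>R f"
    "\<And>y. g *v y = r *\<^sub>R y \<Longrightarrow> \<exists>c. y = c *\<^sub>R v"
    "\<And>z. poly (cpoly g) z = 0 \<Longrightarrow> z \<noteq> complex_of_real r \<Longrightarrow> cmod z < \<bar>r\<bar>"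
proof -
  obtain r where r: "poly (cpoly g) (complex_of_real r) = 0" "order (complex_of_real r) (cpoly g) = 1"
     "\<And>z. poly (cpoly g) z = 0 \<Longrightarrow> z \<noteq> complex_of_real r \<Longrightarrow> cmod z < \<bar>r\<bar>"
    using assms(1) unfolding proximal_def by blast
  have "cpoly g \<noteq> 0" using r(3) by (rule cpoly_nonzero_if_dominant)
  with r have d: "poly (pderiv (cpoly g)) (complex_of_real r) \<noteq> 0"
    using order_eq_1_iff[OF \<open>cpoly g \<noteq> 0\<close> r(1)] by blast
  obtain v f where vf: "v \<noteq> 0" "g *v v = r *\<^sub>R v" "f \<noteq> 0" "transpose g *v f = r *\<^sub>R f"
    using cpoly_real_root[OF r(1)] by blast
  have "r \<noteq> 0"
  proof
    assume "r = 0"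
    then have "g *v v = g *v 0" using vf by simp
    then show False using Gset_inj[OF assms(2)] vf(1) by blast
  qed
  show ?thesis
    by (rule that[OF \<open>r \<noteq> 0\<close> vf _ r(3)]) (use simple_root_eigenspace[OF d vf(2,1)] in auto)
qed

lemma cvec_pow: "((*v) (cmat g) ^^ i) (cvec y) = cvec (((*v) g ^^ i) y)"
  by (induction i) (auto simp: cmat_mv)

text \<open>Every other root of \<open>X^p - r^p\<close> has modulus \<open>\<bar>r\<bar>\<close>, hence is not an eigenvalue.\<close>
lemma power_eigenvector:
  assumes p: "p > 0" and "r \<noteq> 0"
    and dom: "\<And>z. poly (cpoly g) z = 0 \<Longrightarrow> z \<noteq> complex_of_real r \<Longrightarrow> cmod z < \<bar>r\<bar>"
    and y: "((*v) g ^^ p) y = r ^ p *\<^sub>R y"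
  shows "g *v y = r *\<^sub>R y"
proof -
  let ?H = "cmat g" and ?r = "complex_of_real r"
  define P where "P = monom 1 p - [:?r ^ p:]"
  have "poly P ?r = 0" by (simp add: P_def poly_monom)
  then obtain Q where Q: "P = [:-?r, 1:] * Q" by (metis poly_eq_0_iff_dvd dvdE)
  have dP: "degree P \<le> p" unfolding P_def by (intro degree_diff_le) (auto simp: degree_monom_le)
  have cP: "coeff P i = (if i = p then 1 else if i = 0 then - (?r ^ p) else 0)" for i
    using p by (auto simp: P_def coeff_pCons split: nat.splits)
  have "poly_act ?H P (cvec y) = (\<Sum>i\<le>p. coeff P i *s cvec (((*v) g ^^ i) y))"
    by (simp add: poly_act_bound[OF dP] cvec_pow)
  also have "\<dots> = (\<Sum>i\<in>{0, p}. coeff P i *s cvec (((*v) g ^^ i) y))"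
    by (intro sum.mono_neutral_right) (auto simp: cP)
  also have "\<dots> = 0"
    using p by (simp add: cP y of_real_power[symmetric] cvec_scale del: of_real_power)
  finally have P0: "poly_act ?H P (cvec y) = 0" .
  have "poly (pderiv P) ?r \<noteq> 0"
    using p \<open>r \<noteq> 0\<close> by (simp add: P_def pderiv_diff pderiv_monom poly_monom pderiv_pCons)
  then have Qr: "poly Q ?r \<noteq> 0"
    by (auto simp: Q pderiv_mult pderiv_pCons simp del: mult_pCons_left)
  have nev: "poly (cpoly g) z \<noteq> 0" if "poly Q z = 0" for z
  proof
    assume z: "poly (cpoly g) z = 0"
    have "poly P z = 0" using that by (simp add: Q)
    then have "z ^ p = ?r ^ p" by (simp add: P_def poly_monom)
    then have "cmod z ^ p = \<bar>r\<bar> ^ p" by (metis norm_of_real norm_power)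
    then have "cmod z = \<bar>r\<bar>" using p by (simp add: power_eq_iff_eq_base)
    then show False using dom[OF z] that Qr by auto
  qed
  have "Q \<noteq> 0" using Qr by auto
  \<comment> \<open>The factors commute, so Q(g) kills (g - r) y; no root of \<open>Q\<close> is an
    eigenvalue, so stripping the factors of \<open>Q\<close> loses nothing.\<close>
  have "poly_act ?H Q (?H *v cvec y - ?r *s cvec y) = 0"
    using P0 unfolding Q poly_act_factor poly_act_commute .
  then have "?H *v cvec y - ?r *s cvec y = 0"
  proof (rule poly_act_peel[where G = "\<lambda>w. w = 0", OF \<open>Q \<noteq> 0\<close>])
    fix z y assume "poly Q z = 0" "?H *v y - z *s y = 0"
    then show "y = 0" using nev[of z] by (auto simp: cpoly_root_iff)
  qed auto
  then show ?thesis by (simp add: cmat_mv cvec_scale cvec_diff)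
qed

section \<open>Invariant subspaces of a proximal matrix\<close>

lemma dim_image_Gset:
  assumes "g \<in> Gset" "subspace W"
  shows "dim ((*v) g ` W) = dim W" "subspace ((*v) g ` W)"
proof -
  have "inj_on ((*v) g) (span W)" using Gset_inj[OF assms(1)] by (auto intro: inj_onI)
  then show "dim ((*v) g ` W) = dim W" by (intro dim_image_eq) auto
  show "subspace ((*v) g ` W)" using assms(2) by (intro linear_subspace_image) auto
qed

lemma image_eq_if_subset:
  assumes "g \<in> Gset" "subspace W" "(*v) g ` W \<subseteq> W"
  shows "(*v) g ` W = W"
  using dim_image_Gset[OF assms(1,2)] assms(2,3) by (intro subspace_dim_equal) auto

lemma inner_power_left:
  fixes g :: "'n::finite mat"
  assumes "transpose g *v f = r *\<^sub>R f"
  shows "f \<bullet> (((*v) g ^^ i) y) = r ^ i * (f \<bullet> y)"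
proof (induction i)
  case (Suc i)
  have "f \<bullet> (g *v x) = r * (f \<bullet> x)" for x
  proof -
    have "f \<bullet> (g *v x) = (f v* g) \<bullet> x" by (rule dot_lmul_matrix[symmetric])
    also have "f v* g = r *\<^sub>R f" using assms by (simp only: transpose_matrix_vector)
    finally show ?thesis by simp
  qed
  with Suc show ?case by simp
qed simp

text \<open>Finiteness gives p > 0 such that the p-th power of g maps W onto itself. Then L = g^p -
  r^p maps W into its intersection with the kernel of f. If f does not vanish on W this is a proper
  part of W, so L has a nonzero kernel vector in W; by \<open>power_eigenvector\<close> it is an
  eigenvector for r, hence proportional to v.\<close>

lemma proximal_invariant_family:
  assumes "g \<in> Gset" "r \<noteq> 0" "v \<noteq> 0" "g *v v = r *\<^sub>R v" and f: "transpose g *v f = r *\<^sub>R f"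
    and one: "\<And>y. g *v y = r *\<^sub>R y \<Longrightarrow> \<exists>c. y = c *\<^sub>R v"
    and dom: "\<And>z. poly (cpoly g) z = 0 \<Longrightarrow> z \<noteq> complex_of_real r \<Longrightarrow> cmod z < \<bar>r\<bar>"
    and F: "finite F" "\<And>W. W \<in> F \<Longrightarrow> subspace W" "\<And>W. W \<in> F \<Longrightarrow> (*v) g ` W \<in> F"
    and W: "W \<in> F"
  shows "v \<in> W \<or> (\<forall>w\<in>W. f \<bullet> w = 0)"
proof (rule disjCI)
  assume "\<not> (\<forall>w\<in>W. f \<bullet> w = 0)"
  then obtain w where w: "w \<in> W" "f \<bullet> w \<noteq> 0" by blast
  let ?I = "\<lambda>i. (((*v) g) ^^ i) ` W"
  have "?I i \<in> F" for i
  proof (induction i)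
    case (Suc i)
    from F(3)[OF this] show ?case by (simp add: image_image)
  qed (use W in simp)
  then have "finite (range ?I)" using F(1) by (meson finite_subset image_subsetI)
  then have "\<not> inj ?I" using finite_imageD infinite_UNIV_nat by blast
  then obtain i j where ij: "?I i = ?I j" "i < j"
    unfolding inj_def by (metis linorder_neq_iff)
  define p where "p = j - i"
  have inj: "inj (((*v) g) ^^ i)" for i
    using Gset_inj[OF assms(1)] by (intro inj_fn) (auto intro: injI)
  have "(((*v) g) ^^ j) = (((*v) g) ^^ i) \<circ> (((*v) g) ^^ p)"
    using ij(2) by (simp add: p_def funpow_add[symmetric])
  with ij(1) have "(((*v) g) ^^ i) ` W = (((*v) g) ^^ i) ` (?I p)" by (simp add: image_comp)
  then have Wp: "?I p = W" by (simp only: inj_image_eq_iff[OF inj])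
  have p: "p > 0" using ij(2) by (simp add: p_def)
  define L where "L = (\<lambda>y. (((*v) g) ^^ p) y - r ^ p *\<^sub>R y)"
  have linp: "linear (((*v) g) ^^ i)" for i
    by (induction i) (auto simp: linear_id[unfolded id_def]
        intro!: linear_compose[OF _ matrix_vector_mul_linear, unfolded o_def])
  have lin: "linear L" unfolding L_def
    by (intro linear_compose_sub linp linear_scaleR) 
  have sW: "subspace W" using F(2) W by blast
  have LW: "L ` W \<subseteq> W" using Wp sW by (auto simp: L_def intro!: subspace_diff subspace_scale)
  have fL: "f \<bullet> L y = 0" for y
    by (simp add: L_def inner_diff_right inner_power_left[OF f])
  have "\<not> inj_on L (span W)"
  proof
    assume "inj_on L (span W)"
    then have "dim (L ` W) = dim W" using lin by (intro dim_image_eq) auto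
    then have "L ` W = W" using LW sW lin by (intro subspace_dim_equal linear_subspace_image) auto
    then show False using fL w by (metis imageE)
  qed
  then obtain a b where ab: "a \<in> W" "b \<in> W" "a \<noteq> b" "L a = L b"
    using span_eq_iff[THEN iffD2, OF sW] by (auto simp: inj_on_def)
  define y where "y = a - b"
  have y: "y \<in> W" "y \<noteq> 0" "L y = 0"
    using ab subspace_diff[OF sW] linear_diff[OF lin] by (auto simp: y_def)
  have "g *v y = r *\<^sub>R y"
    by (rule power_eigenvector[OF p assms(2) dom]) (use y(3) in \<open>auto simp: L_def\<close>)
  then obtain c where c: "y = c *\<^sub>R v" using one by blast
  with y(2) have "v = (1 / c) *\<^sub>R y" by auto
  with subspace_scale[OF sW y(1)] show "v \<in> W" by metis
qed

subsection \<open>Strong irreducibility\<close>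

declare transpose_matrix_vector [simp del]

definition no_invariant_family :: "'n::finite mat set \<Rightarrow> bool" where
  "no_invariant_family T \<longleftrightarrow>
     \<not> (\<exists>F::(real^'n) set set. finite F \<and> F \<noteq> {} \<and>
          (\<forall>W\<in>F. subspace W \<and> W \<noteq> {0} \<and> W \<noteq> UNIV) \<and>
          (\<forall>g\<in>T. \<forall>W\<in>F. (\<lambda>x. g *v x) ` W \<in> F))"

lemma cond_ip_iff: "cond_ip T \<longleftrightarrow> no_invariant_family T \<and> (\<exists>g\<in>T. proximal g)"
  by (simp add: cond_ip_def no_invariant_family_def)

lemma no_invariant_familyD:
  assumes "no_invariant_family T" "finite F" "F \<noteq> {}"
    "\<And>W. W \<in> F \<Longrightarrow> subspace W" "\<And>W. W \<in> F \<Longrightarrow> W \<noteq> {0}" "\<And>W. W \<in> F \<Longrightarrow> W \<noteq> UNIV"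
    "\<And>g W. g \<in> T \<Longrightarrow> W \<in> F \<Longrightarrow> (*v) g ` W \<in> F"
  shows False
  using assms(1) unfolding no_invariant_family_def
  by (rule notE) (intro exI[of _ F] conjI ballI assms(2-7); assumption)

lemma inner_transpose: "(transpose A *v x) \<bullet> y = x \<bullet> (A *v y)" for A :: "'n::finite mat"
  by (simp add: dot_lmul_matrix transpose_matrix_vector)

text \<open>The cover has the least possible maximal dimension k and, among such covers, the fewest
  members of dimension k. These members, collected in \<open>K\<close>, play the part of the
  top-dimensional irreducible components of the orbit: each of them lies inside a single member of
  any other finite cover by subspaces.\<close>

lemma minimal_cover:
  fixes Orb :: "'e::euclidean_space set"
  assumes "Orb \<noteq> {}"
  obtains L k K where "finite L" "\<And>W. W \<in> L \<Longrightarrow> subspace W" "Orb \<subseteq> \<Union>L" "\<And>W. W \<in> L \<Longrightarrow> dim W \<le> k"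
    "K = {W \<in> L. dim W = k}" "K \<noteq> {}"
    "\<forall>L' W. finite L' \<and> (\<forall>X\<in>L'. subspace X) \<and> Orb \<subseteq> \<Union>L' \<and> W \<in> K \<longrightarrow> (\<exists>X\<in>L'. W \<subseteq> X)"
    "\<And>W. W \<in> K \<Longrightarrow> W \<inter> Orb \<noteq> {}"
proof -
  define cov where "cov L \<longleftrightarrow> finite L \<and> (\<forall>W\<in>L. subspace W) \<and> Orb \<subseteq> \<Union>L" for L
  define good where "good k L \<longleftrightarrow> cov L \<and> (\<forall>W\<in>L. dim W \<le> k)" for k L
  have "good DIM('e) {UNIV}" by (auto simp: good_def cov_def)
  then have ex: "\<exists>k L. good k L" by blast
  define k where "k = (LEAST k. \<exists>L. good k L)"
  have k: "\<exists>L. good k L" unfolding k_def using ex by (rule LeastI_ex)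
  have kmin: "\<not> good k' L" if "k' < k" for k' L
    using that not_less_Least unfolding k_def by blast
  define num where "num L = card {W\<in>L. dim W = k}" for L :: "'e set set"
  obtain L where L: "good k L" and Lmin: "\<And>L'. good k L' \<Longrightarrow> num L \<le> num L'"
    using k ex_has_least_nat[of "good k" _ num] by blast
  have fL: "finite L" and sL: "\<And>W. W \<in> L \<Longrightarrow> subspace W" and cL: "Orb \<subseteq> \<Union>L"
    and dL: "\<And>W. W \<in> L \<Longrightarrow> dim W \<le> k"
    using L by (auto simp: good_def cov_def)
  define K where "K = {W \<in> L. dim W = k}"
  have fK: "finite K" using fL by (simp add: K_def)
  have "K \<noteq> {}"
  proof
    assume "K = {}"
    then have lt: "dim W < k" if "W \<in> L" for W using dL[OF that] that by (auto simp: K_def le_less)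
    have "L \<noteq> {}" using cL assms by auto
    then have "0 < k" using lt by fastforce
    moreover have "good (k - 1) L" using L lt by (auto simp: good_def dest!: lt)
    ultimately show False using kmin[of "k - 1" L] by simp
  qed
  moreover have "\<exists>X\<in>L'. W \<subseteq> X"
    if L': "finite L'" "\<And>X. X \<in> L' \<Longrightarrow> subspace X" "Orb \<subseteq> \<Union>L'" and W: "W \<in> K" for L' W
  proof -
    \<comment> \<open>The common refinement of both covers competes with \<open>L\<close>. Its
      members of dimension k are already members of \<open>L\<close>, because such an intersection
      exhausts the member of \<open>L\<close> that contains it. Minimality of their number keeps all
      of \<open>K\<close>.\<close>
    define M where "M = (\<lambda>(a, b). a \<inter> b) ` (L \<times> L')"
    have M: "X \<in> M \<longleftrightarrow> (\<exists>a\<in>L. \<exists>b\<in>L'. X = a \<inter> b)" for X by (auto simp: M_def)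
    have "cov M" unfolding cov_def
    proof (intro conjI)
      show "finite M" using fL L'(1) by (simp add: M_def)
      show "\<forall>W\<in>M. subspace W" by (auto simp: M intro!: subspace_inter[OF sL L'(2)])
      show "Orb \<subseteq> \<Union>M" using cL L'(3) unfolding M_def by fastforce
    qed
    moreover have "dim X \<le> k" if "X \<in> M" for X
      using that dL by (auto simp: M intro: order_trans[OF dim_subset])
    ultimately have g: "good k M" by (simp add: good_def)
    have sub: "{X\<in>M. dim X = k} \<subseteq> K"
    proof
      fix X assume "X \<in> {X\<in>M. dim X = k}"
      then obtain a b where ab: "a \<in> L" "b \<in> L'" "X = a \<inter> b" "dim X = k" by (auto simp: M)
      then have "X = a" using sL[OF ab(1)] L'(2)[OF ab(2)] dL[OF ab(1)]
        by (intro subspace_dim_equal) (auto intro: subspace_inter)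
      then show "X \<in> K" using ab by (auto simp: K_def)
    qed
    have "card K \<le> card {X\<in>M. dim X = k}" using Lmin[OF g] by (simp add: num_def K_def)
    then have "{X\<in>M. dim X = k} = K" using sub fK by (intro card_seteq)
    then have "W \<in> M" using W by blast
    then show ?thesis by (auto simp: M)
  qed
  moreover have "W \<inter> Orb \<noteq> {}" if W: "W \<in> K" for W
  proof
    assume e: "W \<inter> Orb = {}"
    have "Orb \<subseteq> \<Union>(L - {W})" using cL e by blast
    then have "good k (L - {W})" using L by (auto simp: good_def cov_def)
    then have "card K \<le> card (K - {W})"
      using Lmin[of "L - {W}"] by (simp add: num_def K_def set_diff_eq conj_ac)
    then show False using W fK by (metis card_Diff1_less not_less)
  qed
  ultimately show ?thesis using that[OF fL sL cL dL K_def] by blast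
qed

text \<open>Both conditions are put into one orbit, that of (w, m) under u acting by u on the first
  component and by the inverse transpose on the second. If the claim failed, two hyperplanes of the
  product would cover this orbit. The components \<open>K\<close> of a minimal cover are permuted by
  the semigroup and each lies in one of the hyperplanes; a projection or an annihilator carries them
  to a finite invariant family in V.\<close>

lemma strong_irreducible_pair:
  fixes T :: "'n::finite mat set"
  assumes T: "T \<subseteq> Gset" "T \<noteq> {}" "\<And>a b. a \<in> T \<Longrightarrow> b \<in> T \<Longrightarrow> a ** b \<in> T"
    and irr: "no_invariant_family T"
    and nz: "f \<noteq> 0" "v \<noteq> 0" "w \<noteq> 0" "m \<noteq> 0"
  shows "\<exists>u\<in>T. f \<bullet> (u *v w) \<noteq> 0 \<and> m \<bullet> (matrix_inv u *v v) \<noteq> 0"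
proof (rule ccontr)
  assume contra: "\<not> ?thesis"
  define act :: "'n mat \<Rightarrow> (real^'n) \<times> (real^'n) \<Rightarrow> (real^'n) \<times> (real^'n)" where
    "act u p = (u *v fst p, transpose (matrix_inv u) *v snd p)" for u p
  define Orb where "Orb = (\<lambda>u. act u (w, m)) ` T"
  define L1 :: "((real^'n) \<times> (real^'n)) set" where "L1 = {p. f \<bullet> fst p = 0}"
  define L2 :: "((real^'n) \<times> (real^'n)) set" where "L2 = {p. v \<bullet> snd p = 0}"
  have lin: "linear (act u)" for u
    unfolding act_def by (rule linearI) (auto simp: matrix_vector_right_distrib matrix_vector_mult_scaleR)
  have act_mult: "act a (act b p) = act (a ** b) p" if "a \<in> Gset" "b \<in> Gset" for a b p
    by (simp add: act_def matrix_inv_mult[OF that] matrix_transpose_mul matrix_vector_mul_assoc)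
  have tinv: "transpose g *v (transpose (matrix_inv g) *v x) = x"
    "transpose (matrix_inv g) *v (transpose g *v x) = x" if "g \<in> Gset" for g and x :: "real^'n"
    using that by (simp_all add: matrix_vector_mul_assoc matrix_transpose_mul[symmetric] matrix_inv_left matrix_inv_right
        transpose_mat)
  have inj: "inj (act u)" if "u \<in> Gset" for u
    using that tinv(1)[OF that] matrix_inv_mv(2)[OF that]
    by (auto simp: inj_def act_def prod_eq_iff) metis+
  have sL1: "subspace L1" and sL2: "subspace L2"
    by (auto simp: L1_def L2_def subspace_def inner_add_right)
  have "f \<bullet> (u *v w) = 0 \<or> v \<bullet> (transpose (matrix_inv u) *v m) = 0" if "u \<in> T" for u
  proof -
    have "v \<bullet> (transpose (matrix_inv u) *v m) = m \<bullet> (matrix_inv u *v v)"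
      by (subst inner_commute) (rule inner_transpose)
    then show ?thesis using contra that by auto
  qed
  then have cov12: "Orb \<subseteq> \<Union>{L1, L2}" 
    unfolding Orb_def L1_def L2_def act_def by fastforce
  have "Orb \<noteq> {}" using T(2) by (simp add: Orb_def)
  then obtain L k K where L: "finite L" "\<And>W. W \<in> L \<Longrightarrow> subspace W" "Orb \<subseteq> \<Union>L" "\<And>W. W \<in> L \<Longrightarrow> dim W \<le> k"
    "K = {W \<in> L. dim W = k}" "K \<noteq> {}"
    and min0: "\<forall>L' W. finite L' \<and> (\<forall>X\<in>L'. subspace X) \<and> Orb \<subseteq> \<Union>L' \<and> W \<in> K \<longrightarrow> (\<exists>X\<in>L'. W \<subseteq> X)"
    and meet: "\<And>W. W \<in> K \<Longrightarrow> W \<inter> Orb \<noteq> {}"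
    by (rule minimal_cover) (rule that, assumption+)
  have min: "\<exists>X\<in>L'. W \<subseteq> X" if "finite L'" "\<And>X. X \<in> L' \<Longrightarrow> subspace X" "Orb \<subseteq> \<Union>L'" "W \<in> K" for L' W
    using min0 that by blast
  have fK: "finite K" and sK: "\<And>W. W \<in> K \<Longrightarrow> subspace W" using L by auto
  have K12: "W \<subseteq> L1 \<or> W \<subseteq> L2" if "W \<in> K" for W
    using min[of "{L1, L2}" W] sL1 sL2 cov12 that by auto
  \<comment> \<open>\<open>act t\<close> maps the orbit into itself, so the preimages of
    \<open>L\<close> cover it as well and W lies in one of them. The image of W thus lies in a
    member of \<open>L\<close>, and its dimension k forces equality.\<close>
  have inv: "act t ` W \<in> K" if t: "t \<in> T" and W: "W \<in> K" for t W
  proof -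
    have tG: "t \<in> Gset" using T(1) t by auto
    have "Orb \<subseteq> \<Union>((\<lambda>X. act t -` X) ` L)"
    proof
      fix o' assume "o' \<in> Orb"
      then obtain u where u: "u \<in> T" "o' = act u (w, m)" by (auto simp: Orb_def)
      then have "act t o' = act (t ** u) (w, m)" using act_mult[OF tG] T(1) by auto
      then have "act t o' \<in> Orb" using T(3)[OF t u(1)] by (auto simp: Orb_def)
      then show "o' \<in> \<Union>((\<lambda>X. act t -` X) ` L)" using L(3) by blast
    qed
    then obtain X where X: "X \<in> L" "W \<subseteq> act t -` X"
      using min[of "(\<lambda>X. act t -` X) ` L" W] L(1,2) W linear_subspace_vimage[OF lin] by blast
    have "dim (act t ` W) = dim W"
      using inj[OF tG] by (intro dim_image_eq[OF lin]) (auto intro: inj_on_subset)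
    moreover have "dim W = k" using W L(5) by auto
    ultimately have "act t ` W = X" using X L(2,4)[OF X(1)] sK[OF W]
      by (intro subspace_dim_equal linear_subspace_image lin) auto
    then show ?thesis using X(1) \<open>dim (act t ` W) = dim W\<close> \<open>dim W = k\<close> L(5) by auto
  qed
  have wit: "\<exists>u\<in>T. act u (w, m) \<in> W" if "W \<in> K" for W
    using meet[OF that] by (auto simp: Orb_def)
  have nzT: "u *v w \<noteq> 0" "transpose (matrix_inv u) *v m \<noteq> 0" if "u \<in> T" for u
  proof -
    have "u \<in> Gset" using that T(1) by auto
    show "u *v w \<noteq> 0" using matrix_inv_mv(2)[OF \<open>u \<in> Gset\<close>, of w] nz(3) by auto
    show "transpose (matrix_inv u) *v m \<noteq> 0" using tinv(1)[OF \<open>u \<in> Gset\<close>, of m] nz(4) by auto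
  qed
  show False
  proof (cases "\<exists>W\<in>K. W \<subseteq> L1")
    case True
    then obtain W0 where W0: "W0 \<in> K" "W0 \<subseteq> L1" by blast
    \<comment> \<open>Not every member of \<open>K\<close> need have a proper projection. Those that
      have one form a nonempty invariant family, since elements of \<open>T\<close> preserve
      dimensions.\<close>
    define F where "F = {fst ` W |W. W \<in> K \<and> fst ` W \<noteq> (UNIV :: (real^'n) set)}"
    have "fst ` W0 \<noteq> UNIV"
    proof
      assume "fst ` W0 = UNIV"
      then have "f \<in> fst ` W0" by simp
      then obtain p where "p \<in> W0" "fst p = f" by auto
      then show False using W0(2) nz(1) by (auto simp: L1_def)
    qed
    then have "F \<noteq> {}" using W0 by (auto simp: F_def)
    show False
    proof (rule no_invariant_familyD[OF irr _ \<open>F \<noteq> {}\<close>])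
      have "F \<subseteq> (\<lambda>W. fst ` W) ` K" by (auto simp: F_def)
      then show "finite F" using fK by (rule finite_surj[rotated])
      fix Y assume "Y \<in> F"
      then obtain W where W: "W \<in> K" "Y = fst ` W" "Y \<noteq> UNIV" by (auto simp: F_def)
      show "subspace Y" using W sK by (auto intro!: linear_subspace_image linear_fst)
      show "Y \<noteq> UNIV" by fact
      obtain u where u: "u \<in> T" "act u (w, m) \<in> W" using wit[OF W(1)] by blast
      then have "u *v w \<in> Y" unfolding W(2) by (force simp: act_def)
      then show "Y \<noteq> {0}" using nzT(1)[OF u(1)] by auto
      fix g assume g: "g \<in> T"
      have e: "(*v) g ` Y = fst ` (act g ` W)" unfolding W(2) by (force simp: act_def image_def)
      have "dim ((*v) g ` Y) = dim Y" using g T(1) \<open>subspace Y\<close> by (intro dim_image_Gset) auto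
      then have "(*v) g ` Y \<noteq> UNIV"
        using \<open>Y \<noteq> UNIV\<close> \<open>subspace Y\<close> by (metis dim_eq_full span_eq_iff dim_UNIV)
      then show "(*v) g ` Y \<in> F" using inv[OF g W(1)] unfolding e F_def by blast
    qed
  next
    case False
    \<comment> \<open>Now all of \<open>K\<close> lies in \<open>L2\<close>. On second components
      the action is the dual one, so the projections are replaced by their annihilators, on which u
      acts by u itself; each of them contains \<open>v\<close>.\<close>
    define ann :: "((real^'n) \<times> (real^'n)) set \<Rightarrow> (real^'n) set" where "ann W = {x. \<forall>p\<in>W. x \<bullet> snd p = 0}" for W
    have "ann ` K \<noteq> {}" using L(6) by simp
    show False
    proof (rule no_invariant_familyD[OF irr _ \<open>ann ` K \<noteq> {}\<close>])
      show "finite (ann ` K)" using fK by simp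
      fix Y assume "Y \<in> ann ` K"
      then obtain W where W: "W \<in> K" "Y = ann W" by auto
      show "subspace Y" by (auto simp: W(2) ann_def subspace_def inner_add_left)
      have "W \<subseteq> L2" using False K12[OF W(1)] W(1) by blast
      then have "v \<in> Y" by (auto simp: W(2) ann_def L2_def)
      then show "Y \<noteq> {0}" using nz(2) by auto
      obtain u where u: "u \<in> T" "act u (w, m) \<in> W" using wit[OF W(1)] by blast
      then have "x \<bullet> (transpose (matrix_inv u) *v m) = 0" if "x \<in> Y" for x
        using that by (force simp: W(2) ann_def act_def)
      then show "Y \<noteq> UNIV" using nzT(2)[OF u(1)] by (metis UNIV_I inner_eq_zero_iff)
      fix g assume g: "g \<in> T"
      then have gG: "g \<in> Gset" using T(1) by auto
      have tr: "x \<bullet> (transpose (matrix_inv g) *v b) = (matrix_inv g *v x) \<bullet> b" for x b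
        by (metis inner_commute inner_transpose)
      have "(*v) g ` Y = ann (act g ` W)"
      proof (intro equalityI subsetI)
        fix x assume "x \<in> (*v) g ` Y"
        then obtain y where y: "y \<in> Y" "x = g *v y" by auto
        have "x \<bullet> (transpose (matrix_inv g) *v b) = y \<bullet> b" for b
          unfolding tr y(2) matrix_inv_mv(2)[OF gG] ..
        then show "x \<in> ann (act g ` W)" using y(1) by (auto simp: W(2) ann_def act_def)
      next
        fix x assume x: "x \<in> ann (act g ` W)"
        note tr[of x, symmetric]
        then have "matrix_inv g *v x \<in> Y" using x by (auto simp: W(2) ann_def act_def)
        moreover have "x = g *v (matrix_inv g *v x)" by (simp add: matrix_inv_mv(1)[OF gG])
        ultimately show "x \<in> (*v) g ` Y" by blast
      qed
      then show "(*v) g ` Y \<in> ann ` K" using inv[OF g W(1)] by simp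
    qed
  qed
qed

lemma span_orbit:
  fixes T :: "'n::finite mat set"
  assumes T: "T \<subseteq> Gset" "T \<noteq> {}" "\<And>a b. a \<in> T \<Longrightarrow> b \<in> T \<Longrightarrow> a ** b \<in> T"
    and irr: "no_invariant_family T" and "x \<noteq> 0"
  shows "span ((\<lambda>u. u *v x) ` T) = UNIV"
proof (rule ccontr)
  assume ne: "span ((\<lambda>u. u *v x) ` T) \<noteq> UNIV" (is "?W \<noteq> _")
  show False
  proof (rule no_invariant_familyD[OF irr, of "{?W}"])
    obtain u where u: "u \<in> T" using T(2) by auto
    then have "u *v x \<noteq> 0" using T(1) matrix_inv_mv(2)[of u x] \<open>x \<noteq> 0\<close> by auto
    moreover have "u *v x \<in> ?W" using u by (auto intro: span_base)
    ultimately have "?W \<noteq> {0}" by auto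
    then show "W \<noteq> {0}" if "W \<in> {?W}" for W using that by simp
    fix g W assume g: "g \<in> T" "W \<in> {?W}"
    have "(*v) g ` ?W = span ((*v) g ` ((\<lambda>u. u *v x) ` T))"
      by (rule linear_span_image[symmetric]) simp
    also have "\<dots> \<subseteq> ?W"
      using T(3)[OF g(1)] by (intro span_mono) (auto simp: matrix_vector_mul_assoc)
    finally have "(*v) g ` ?W = ?W" using g(1) T(1) by (intro image_eq_if_subset) auto
    then show "(*v) g ` W \<in> {?W}" using g(2) by simp
  qed (use ne in auto)
qed

text \<open>Irreducibility is given for \<open>T\<close>, not for the transposes. The argument
  therefore passes to \<open>Y\<close>, the annihilator of the dual orbit, which is a subspace
  invariant under \<open>T\<close>.\<close>

lemma span_dual_orbit:
  fixes T :: "'n::finite mat set"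
  assumes T: "T \<subseteq> Gset" "T \<noteq> {}" "\<And>a b. a \<in> T \<Longrightarrow> b \<in> T \<Longrightarrow> a ** b \<in> T"
    and irr: "no_invariant_family T" and "f \<noteq> 0"
  shows "span ((\<lambda>u. transpose u *v f) ` T) = UNIV"
proof (rule ccontr)
  assume ne: "span ((\<lambda>u. transpose u *v f) ` T) \<noteq> UNIV" (is "span ?S \<noteq> _")
  define Y where "Y = {y. \<forall>s\<in>T. f \<bullet> (s *v y) = 0}"
  have sY: "subspace Y" by (auto simp: Y_def subspace_def inner_add_right matrix_vector_right_distrib matrix_vector_mult_scaleR)
  have "dim ?S < DIM(real^'n)"
    using ne dim_subset_UNIV[of ?S] dim_eq_full[of ?S] by linarith
  then obtain z where z: "z \<noteq> 0" "\<And>y. y \<in> span ?S \<Longrightarrow> orthogonal z y"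
    using orthogonal_to_subspace_exists by blast
  have zY: "z \<in> Y" unfolding Y_def
  proof (intro CollectI ballI)
    fix s assume "s \<in> T"
    then have "z \<bullet> (transpose s *v f) = 0" using z(2) by (auto simp: orthogonal_def intro: span_base)
    then show "f \<bullet> (s *v z) = 0" by (simp add: inner_commute[of z] inner_transpose)
  qed
  have nU: "Y \<noteq> UNIV"
  proof
    assume "Y = UNIV"
    obtain s where s: "s \<in> T" using T(2) by auto
    have "f \<bullet> (s *v (matrix_inv s *v f)) = 0" using \<open>Y = UNIV\<close> s unfolding Y_def by blast
    then show False using s T(1) \<open>f \<noteq> 0\<close> by (auto simp: matrix_inv_mv)
  qed
  show False
  proof (rule no_invariant_familyD[OF irr, of "{Y}"])
    fix g W assume g: "g \<in> T" "W \<in> {Y}"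
    have "(*v) g ` Y \<subseteq> Y" using T(3)[OF _ g(1)] by (auto simp: Y_def matrix_vector_mul_assoc)
    then have "(*v) g ` Y = Y" using g(1) T(1) sY by (intro image_eq_if_subset) auto
    then show "(*v) g ` W \<in> {Y}" using g(2) by simp
  qed (use sY nU z zY in auto)
qed

subsection \<open>Proximal semigroups have no bounded orbits\<close>

lemma norm_smult: "norm (c *s y) = cmod c * norm y" for y :: "complex^'n::finite"
  by (simp add: norm_vec_def L2_set_def norm_mult power_mult_distrib sum_distrib_left[symmetric] real_sqrt_mult)

lemma norm_cvec [simp]: "norm (cvec x) = norm x"
  by (simp add: norm_vec_def L2_set_def cvec_def)

lemma contraction_tendsto_0:
  fixes a e :: "nat \<Rightarrow> real"
  assumes "0 \<le> c" "c < 1" "\<And>k. 0 \<le> a k" "\<And>k. a (Suc k) \<le> c * a k + e k" "e \<longlonglongrightarrow> 0"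
  shows "a \<longlonglongrightarrow> 0"
proof (rule LIMSEQ_I)
  fix r :: real assume r: "0 < r"
  have "eventually (\<lambda>k. e k < r * (1 - c) / 2) sequentially"
    using assms r by (intro order_tendstoD[OF assms(5)]) simp
  then obtain N where N: "\<And>k. k \<ge> N \<Longrightarrow> e k < r * (1 - c) / 2" by (auto simp: eventually_sequentially)
  have bd: "a (N + j) \<le> c ^ j * a N + r / 2" for j
  proof (induction j)
    case (Suc j)
    have "a (N + Suc j) \<le> c * a (N + j) + e (N + j)" using assms(4)[of "N + j"] by simp
    also have "\<dots> \<le> c * (c ^ j * a N + r / 2) + r * (1 - c) / 2"
      using Suc N[of "N + j"] assms(1) by (intro add_mono mult_left_mono) auto
    also have "\<dots> = c ^ Suc j * a N + r / 2" by (simp add: field_simps)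
    finally show ?case .
  qed (use r in simp)
  have "(\<lambda>j. c ^ j * a N) \<longlonglongrightarrow> 0 * a N"
    using assms by (intro tendsto_mult LIMSEQ_realpow_zero tendsto_const)
  then have "eventually (\<lambda>j. c ^ j * a N < r / 2) sequentially"
    using r by (intro order_tendstoD) auto
  then obtain J where J: "\<And>j. j \<ge> J \<Longrightarrow> c ^ j * a N < r / 2" by (auto simp: eventually_sequentially)
  have "norm (a k - 0) < r" if "k \<ge> N + J" for k
  proof -
    have "J \<le> k - N" "N + (k - N) = k" using that by auto
    then have "a k < r" using bd[of "k - N"] J[of "k - N"] by simp
    then show ?thesis using assms(3)[of k] by simp
  qed
  then show "\<exists>no. \<forall>n\<ge>no. norm (a n - 0) < r" by blast
qed

text \<open>Over m consecutive steps the first difference hardly changes, so a difference of size r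
  would move \<open>b\<close> by at least m r / 2. The choice m > 4 B / r makes this larger than 2
  B, the greatest possible distance between two terms.\<close>

lemma second_difference_tendsto_0:
  fixes b :: "nat \<Rightarrow> 'a::real_normed_vector"
  assumes B: "\<And>k. norm (b k) \<le> B"
    and d2: "(\<lambda>k. (b (Suc (Suc k)) - b (Suc k)) - (b (Suc k) - b k)) \<longlonglongrightarrow> 0"
  shows "(\<lambda>k. b (Suc k) - b k) \<longlonglongrightarrow> 0"
proof (rule LIMSEQ_I)
  fix r :: real assume r: "0 < r"
  let ?d = "\<lambda>k. b (Suc k) - b k"
  have B0: "0 \<le> B" using B[of 0] norm_ge_zero order_trans by blast
  obtain m :: nat where m: "4 * B / r < real m" using reals_Archimedean2 by blast
  have m0: "0 < m" using m r B0 by (cases m) (auto simp: field_simps)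
  have mB: "2 * B < m * (r / 2)" using m r by (simp add: field_simps)
  obtain N where N: "\<And>k. k \<ge> N \<Longrightarrow> norm (?d (Suc k) - ?d k) < r / (2 * m)"
    using LIMSEQ_D[OF d2, of "r / (2 * m)"] r m0 by auto
  have "norm (?d k - 0) < r" if k: "k \<ge> N" for k
  proof -
    have di: "norm (?d (k + i) - ?d k) \<le> i * (r / (2 * m))" for i
    proof (induction i)
      case (Suc i)
      have "norm (?d (k + Suc i) - ?d k) \<le> norm (?d (Suc (k + i)) - ?d (k + i)) + norm (?d (k + i) - ?d k)"
        using norm_triangle_ineq[of "?d (Suc (k + i)) - ?d (k + i)" "?d (k + i) - ?d k"] by (simp add: algebra_simps)
      also have "\<dots> \<le> r / (2 * m) + i * (r / (2 * m))" using N[of "k + i"] k Suc by (intro add_mono) auto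
      finally show ?case by (simp only: of_nat_Suc distrib_right mult_1_left)
    qed simp
    have di': "norm (?d (k + i) - ?d k) \<le> r / 2" if "i < m" for i
    proof -
      have "real i * (r / (2 * m)) \<le> real m * (r / (2 * m))" using that r by (intro mult_right_mono) auto
      also have "\<dots> = r / 2" using m0 by simp
      finally show ?thesis using di[of i] by linarith
    qed
    have tel: "(\<Sum>i<m. ?d (k + i)) = b (k + m) - b k" by (induction m) auto
    have sm: "(\<Sum>i<m. ?d (k + i) - ?d k) = (\<Sum>i<m. ?d (k + i)) - real m *\<^sub>R ?d k"
      by (subst sum_subtractf) (simp only: sum_constant_scaleR card_lessThan)
    have "real m *\<^sub>R ?d k = (b (k + m) - b k) - (\<Sum>i<m. ?d (k + i) - ?d k)"
      unfolding sm tel by simp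
    then have "norm (real m *\<^sub>R ?d k) \<le> norm (b (k + m) - b k) + norm (\<Sum>i<m. ?d (k + i) - ?d k)"
      by (simp only: norm_triangle_ineq4)
    also have "norm (b (k + m) - b k) \<le> B + B"
      by (rule order_trans[OF norm_triangle_ineq4]) (intro add_mono B)
    also have "norm (\<Sum>i<m. ?d (k + i) - ?d k) \<le> (\<Sum>i<m. r / 2)"
      by (intro order_trans[OF norm_sum] sum_mono di') auto
    finally have "real m * norm (?d k) \<le> 2 * B + m * (r / 2)" by simp
    also have "\<dots> < m * (r / 2) + m * (r / 2)" using mB by linarith
    finally have "real m * norm (?d k) < m * r" by (simp add: field_simps)
    then show ?thesis using m0 by simp
  qed
  then show "\<exists>no. \<forall>n\<ge>no. norm (?d n - 0) < r" by blast
qed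

text \<open>In Jordan form: boundedness excludes a nontrivial block at \<rho>, and the other blocks
  decay. The proof instead strips the factors X - z of an annihilating polynomial of the vector. A
  root inside the disc gives a contraction with a vanishing error, the root \<rho> gives a bounded
  sequence with vanishing second differences, and any other root is not an eigenvalue.\<close>

lemma power_bounded_regular:
  fixes g :: "'n::finite mat"
  assumes bdd: "\<And>y. \<exists>B. \<forall>k. norm (((*v) g ^^ k) y) \<le> B"
    and rho: "\<rho> * \<rho> = (1::real)"
    and ev: "\<And>z. poly (cpoly g) z = 0 \<Longrightarrow> z = complex_of_real \<rho> \<or> cmod z < 1"
  shows "(\<lambda>k. g *v (((*v) g ^^ k) y) - \<rho> *\<^sub>R ((*v) g ^^ k) y) \<longlonglongrightarrow> 0"
proof -
  let ?H = "cmat g"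
  define pw where "pw k y = ((*v) ?H ^^ k) y" for k y
  have pw_Suc: "?H *v pw k y = pw (Suc k) y" for k y by (simp add: pw_def)
  have pw_H: "pw k (?H *v y) = pw (Suc k) y" for k y by (simp add: pw_def funpow_swap1)
  have pw_diff: "pw k (x - y) = pw k x - pw k y" and pw_smult: "pw k (c *s y) = c *s pw k y" for k x y c
    by (simp_all add: pw_def pow_diff pow_smult)
  define D where "D y k = ?H *v pw k y - \<rho> *\<^sub>R pw k y" for y k
  define G where "G y \<longleftrightarrow> D y \<longlonglongrightarrow> 0" for y
  have smR: "c *s (r *\<^sub>R x) = r *\<^sub>R (c *s x)" for c r and x :: "complex^'n" by (simp add: vec_eq_iff)
  have smR1: "complex_of_real r *s x = r *\<^sub>R x" for r and x :: "complex^'n"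
    by (simp add: vec_eq_iff scaleR_conv_of_real[where 'a = complex])
  have cbdd: "\<exists>B. \<forall>k. norm (pw k y) \<le> B" for y
  proof -
    \<comment> \<open>Boundedness is assumed for real vectors only; it is transferred through real
      and imaginary parts.\<close>
    define a b where "a = (\<chi> i. Re (y $ i))" and "b = (\<chi> i. Im (y $ i))"
    have "y = cvec a - (- \<i>) *s cvec b" by (simp add: vec_eq_iff cvec_def a_def b_def complex_eq_iff)
    then have e: "pw k y = cvec (((*v) g ^^ k) a) - (- \<i>) *s cvec (((*v) g ^^ k) b)" for k
      by (simp only: pw_diff pw_smult) (simp only: pw_def cvec_pow)
    obtain A B where "\<And>k. norm (((*v) g ^^ k) a) \<le> A" "\<And>k. norm (((*v) g ^^ k) b) \<le> B" using bdd by metis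
    then have "norm (pw k y) \<le> A + B" for k
      unfolding e by (intro order_trans[OF norm_triangle_ineq4] add_mono) (simp_all add: norm_smult)
    then show ?thesis by blast
  qed
  have step: "G y" if G: "G (?H *v y - z *s y)" for y z
  proof -
    have Dz: "D (?H *v y - z *s y) k = D y (Suc k) - z *s D y k" for k
      by (simp add: D_def pw_diff pw_smult pw_H pw_Suc mv_smult matrix_vector_mult_diff_distrib smR
          vec.scale_right_diff_distrib scaleR_right_diff_distrib)
    have DH: "D y (Suc k) = ?H *v D y k" for k
      by (simp add: D_def pw_Suc[symmetric] matrix_vector_mult_diff_distrib)
         (simp add: vec_eq_iff matrix_vector_mult_def sum_distrib_left scaleR_conv_of_real[where 'a = complex] mult.left_commute)
    consider "cmod z < 1" | "z = complex_of_real \<rho>" | "poly (cpoly g) z \<noteq> 0" using ev by blast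
    then show ?thesis
    proof cases
      case 1
      have "(\<lambda>k. norm (D y k)) \<longlonglongrightarrow> 0"
      proof (rule contraction_tendsto_0[where c = "cmod z" and e = "\<lambda>k. norm (D (?H *v y - z *s y) k)"])
        fix k
        have "D y (Suc k) = z *s D y k + D (?H *v y - z *s y) k" by (simp add: Dz)
        then show "norm (D y (Suc k)) \<le> cmod z * norm (D y k) + norm (D (?H *v y - z *s y) k)"
          by (metis norm_triangle_ineq norm_smult)
      qed (use 1 G in \<open>auto simp: G_def intro: tendsto_norm_zero\<close>)
      then show ?thesis unfolding G_def by (rule tendsto_norm_zero_cancel)
    next
      case 2
      \<comment> \<open>Multiplying by \<rho>^k, which has modulus 1, turns \<open>D y\<close> into
        the first difference of a bounded sequence and the hypothesis into the decay of its second
        difference.\<close>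
      define b where "b k = \<rho> ^ k *\<^sub>R pw k y" for k
      have ar: "\<bar>\<rho>\<bar> = 1" using rho by (metis abs_mult_self_eq abs_mult abs_one abs_ge_zero mult_cancel_left1 power2_eq_1_iff power2_eq_square abs_minus_cancel)
      obtain B where B: "\<And>k. norm (pw k y) \<le> B" using cbdd by blast
      have nb: "norm (b k) \<le> B" for k using B[of k] ar by (simp add: b_def power_abs)
      have bD: "b (Suc k) - b k = \<rho> ^ Suc k *\<^sub>R D y k" for k
        using rho by (simp add: b_def D_def pw_Suc scaleR_right_diff_distrib)
      have r2: "\<rho> * (\<rho> * t) = t" for t using rho by (simp add: mult.assoc[symmetric])
      have Dr: "D (?H *v y - z *s y) k = D y (Suc k) - \<rho> *\<^sub>R D y k" for k
        unfolding Dz unfolding 2 smR1 ..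
      have "(b (Suc (Suc k)) - b (Suc k)) - (b (Suc k) - b k) = \<rho> ^ Suc (Suc k) *\<^sub>R D (?H *v y - z *s y) k" for k
        unfolding bD Dr by (simp add: scaleR_right_diff_distrib r2)
      then have e: "norm ((b (Suc (Suc k)) - b (Suc k)) - (b (Suc k) - b k)) = norm (D (?H *v y - z *s y) k)" for k
        using ar by (simp add: power_abs abs_mult)
      have "(\<lambda>k. norm ((b (Suc (Suc k)) - b (Suc k)) - (b (Suc k) - b k))) \<longlonglongrightarrow> 0"
        unfolding e using G unfolding G_def by (rule tendsto_norm_zero)
      then have "(\<lambda>k. (b (Suc (Suc k)) - b (Suc k)) - (b (Suc k) - b k)) \<longlonglongrightarrow> 0"
        by (rule tendsto_norm_zero_cancel)
      from second_difference_tendsto_0[OF nb this] have "(\<lambda>k. norm (b (Suc k) - b k)) \<longlonglongrightarrow> 0"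
        by (rule tendsto_norm_zero)
      then have "(\<lambda>k. norm (D y k)) \<longlonglongrightarrow> 0" unfolding bD using ar by (simp add: power_abs abs_mult)
      then show ?thesis unfolding G_def by (rule tendsto_norm_zero_cancel)
    next
      \<comment> \<open>A root of the annihilating polynomial need not be an eigenvalue; then z - H
        is invertible and is simply divided out.\<close>
      case 3
      then have "det (mat z - ?H) \<noteq> 0" by (simp add: poly_cpoly)
      then obtain C where C: "C ** (mat z - ?H) = mat 1"
        by (metis invertible_det_nz invertible_def)
      have DC: "D y = (\<lambda>k. C *v (- D (?H *v y - z *s y) k))"
      proof (rule ext)
        fix k
        have "(mat z - ?H) *v D y k = - D (?H *v y - z *s y) k"
          unfolding mat_minus_mv Dz DH by simp
        then show "D y k = C *v (- D (?H *v y - z *s y) k)"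
          by (metis C matrix_vector_mul_assoc matrix_vector_mul_lid)
      qed
      have "(\<lambda>k. C *v (- D (?H *v y - z *s y) k)) \<longlonglongrightarrow> C *v (- 0)"
        using G unfolding G_def by (intro tendsto_intros)
      then show ?thesis unfolding G_def DC by simp
    qed
  qed
  obtain P where P: "P \<noteq> 0" "poly_act ?H P (cvec y) = 0" using annihilator_exists by blast
  have "((*v) ?H ^^ k) 0 = 0" for k by (induction k) auto
  then have "D 0 = (\<lambda>k. 0)" by (intro ext) (simp add: D_def pw_def)
  then have "G 0" by (simp add: G_def)
  with P(2) have "G (poly_act ?H P (cvec y))" by simp
  then have "G (cvec y)"
  proof (rule poly_act_peel[where G = G, OF P(1)])
    fix c y assume c: "c \<noteq> 0" "G (c *s y)"
    have "D (c *s y) k = c *s D y k" for k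
      by (simp add: D_def pw_smult mv_smult smR vec.scale_right_diff_distrib)
    then have e: "norm (D y k) = norm (D (c *s y) k) / cmod c" for k using c(1) by (simp add: norm_smult)
    have "(\<lambda>k. norm (D (c *s y) k) / cmod c) \<longlonglongrightarrow> 0 / cmod c"
      using c unfolding G_def by (intro tendsto_divide tendsto_norm_zero tendsto_const) auto
    then have "(\<lambda>k. norm (D y k)) \<longlonglongrightarrow> 0" unfolding e by simp
    then show "G y" unfolding G_def by (rule tendsto_norm_zero_cancel)
  qed (rule step)
  moreover have e: "norm (D (cvec y) k) = norm (g *v (((*v) g ^^ k) y) - \<rho> *\<^sub>R ((*v) g ^^ k) y)" for k
    unfolding D_def pw_def cvec_pow cmat_mv smR1[symmetric] cvec_scale cvec_diff norm_cvec ..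
  ultimately have "(\<lambda>k. norm (D (cvec y) k)) \<longlonglongrightarrow> 0" unfolding G_def by (intro tendsto_norm_zero)
  then show ?thesis unfolding e by (rule tendsto_norm_zero_cancel)
qed

lemma norm_matrix_le: "norm A \<le> (\<Sum>i\<in>(UNIV :: 'n set). \<Sum>j\<in>UNIV. norm (A *v axis j 1))" for A :: "'n::finite mat"
proof -
  have "norm A \<le> (\<Sum>i\<in>UNIV. norm (A $ i))" unfolding norm_vec_def by (rule L2_set_le_sum) simp
  also have "\<dots> \<le> (\<Sum>i\<in>UNIV. \<Sum>j\<in>UNIV. \<bar>A $ i $ j\<bar>)" by (intro sum_mono norm_le_l1_cart)
  also have "\<dots> \<le> (\<Sum>i\<in>(UNIV :: 'n set). \<Sum>j\<in>UNIV. norm (A *v axis j 1))"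
  proof (intro sum_mono)
    fix i j
    have "A $ i $ j = (A *v axis j 1) $ i" by (simp add: matrix_vector_mult_basis column_def)
    then show "\<bar>A $ i $ j\<bar> \<le> norm (A *v axis j 1)" by (metis component_le_norm_cart)
  qed
  finally show ?thesis .
qed

text \<open>Were some orbit bounded away from \<open>0\<close> and \<open>\<infinity>\<close>, then the closure of \<open>T\<close> would contain a
  rank one projection \<open>y \<mapsto> (f \<bullet> y) / (f \<bullet> v) v\<close> and \<open>f \<bullet> (t v) = \<plusminus> f \<bullet> v\<close> for all \<open>t \<in> T\<close>,
  so that the orbit of \<open>v\<close> would be finite.\<close>
lemma orbit_escapes:
  fixes T :: "'n::finite mat set"
  assumes T: "T \<subseteq> Gset" and mult: "\<And>a b. a \<in> T \<Longrightarrow> b \<in> T \<Longrightarrow> a ** b \<in> T"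
    and irr: "no_invariant_family T" and g: "g \<in> T" "proximal g"
    and d: "CARD('n) > 1" and x: "x \<noteq> 0" and K: "K > 0"
  shows "\<exists>u\<in>T. norm (u *v x) > K \<or> norm (u *v x) < 1 / K"
proof (rule ccontr)
  assume "\<not> ?thesis"
  then have bd: "norm (u *v x) \<le> K" "1 / K \<le> norm (u *v x)" if "u \<in> T" for u using that by force+
  have T0: "T \<noteq> {}" using g by auto
  have orb: "span ((\<lambda>u. u *v x) ` T) = UNIV"
    by (rule span_orbit[OF T T0 _ irr x]) (rule mult)
  have gG: "g \<in> Gset" using g T by auto
  obtain r v f where r: "r \<noteq> 0" and v: "v \<noteq> 0" "g *v v = r *\<^sub>R v"
    and f: "f \<noteq> 0" "transpose g *v f = r *\<^sub>R f"
    and one: "\<And>y. g *v y = r *\<^sub>R y \<Longrightarrow> \<exists>c. y = c *\<^sub>R v"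
    and dom: "\<And>z. poly (cpoly g) z = 0 \<Longrightarrow> z \<noteq> complex_of_real r \<Longrightarrow> cmod z < \<bar>r\<bar>"
    using proximalE[OF g(2) gG] by metis
  have Tb: "\<exists>B. \<forall>u\<in>T. norm (u *v y) \<le> B" for y
  proof -
    \<comment> \<open>The vectors with bounded orbit form a subspace. It contains the orbit of x,
      which spans, so every orbit is bounded.\<close>
    define Y where "Y = {y. \<exists>B. \<forall>u\<in>T. norm (u *v y) \<le> B}"
    have "subspace Y"
    proof (rule subspaceI)
      show "0 \<in> Y" by (auto simp: Y_def)
      fix a b c assume "a \<in> Y" "b \<in> Y"
      then obtain A B where "\<And>u. u \<in> T \<Longrightarrow> norm (u *v a) \<le> A" "\<And>u. u \<in> T \<Longrightarrow> norm (u *v b) \<le> B"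
        by (auto simp: Y_def)
      then have "norm (u *v (a + b)) \<le> A + B" "norm (u *v (c *\<^sub>R a)) \<le> \<bar>c\<bar> * A" if "u \<in> T" for u
        using that by (auto simp: matrix_vector_right_distrib matrix_vector_mult_scaleR
            intro!: mult_left_mono order_trans[OF norm_triangle_ineq] add_mono)
      then show "a + b \<in> Y" "c *\<^sub>R a \<in> Y" unfolding Y_def by blast+
    qed
    moreover have "(\<lambda>u. u *v x) ` T \<subseteq> Y"
    proof clarify
      fix u assume "u \<in> T"
      then have "\<forall>w\<in>T. norm (w *v (u *v x)) \<le> K"
        by (auto simp: matrix_vector_mul_assoc intro: bd(1) mult)
      then show "u *v x \<in> Y" by (auto simp: Y_def)
    qed
    ultimately have "span ((\<lambda>u. u *v x) ` T) \<subseteq> Y" by (intro span_minimal)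
    then have "y \<in> Y" using orb by auto
    then show ?thesis by (simp add: Y_def)
  qed
  define P where "P k = (((**) g) ^^ k) g" for k
  have PT: "P k \<in> T" for k by (induction k) (auto simp: P_def g mult)
  have Pv: "P k *v y = ((*v) g ^^ Suc k) y" for k y
    by (induction k) (auto simp: P_def matrix_vector_mul_assoc[symmetric])
  have "\<exists>t0\<in>T. f \<bullet> (t0 *v x) \<noteq> 0"
  proof (rule ccontr)
    assume "\<not> ?thesis"
    then have "(\<lambda>u. u *v x) ` T \<subseteq> {y. f \<bullet> y = 0}" by auto
    then have "span ((\<lambda>u. u *v x) ` T) \<subseteq> {y. f \<bullet> y = 0}"
      by (rule span_minimal) (auto simp: subspace_def inner_add_right)
    then have "f \<bullet> f = 0" using orb by blast
    then show False using f(1) by simp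
  qed
  then obtain t0 where t0: "t0 \<in> T" "f \<bullet> (t0 *v x) \<noteq> 0" by blast
  define q where "q = t0 *v x"
  have fq: "f \<bullet> q \<noteq> 0" using t0 by (simp add: q_def)
  have r1: "\<bar>r\<bar> \<le> 1"
  proof (rule ccontr)
    assume "\<not> \<bar>r\<bar> \<le> 1"
    then obtain n where n: "norm f * K / \<bar>f \<bullet> q\<bar> < \<bar>r\<bar> ^ n" using real_arch_pow[of "\<bar>r\<bar>"] by auto
    also have "\<dots> \<le> \<bar>r\<bar> ^ Suc n" using \<open>\<not> \<bar>r\<bar> \<le> 1\<close> by (intro power_increasing) auto
    finally have "norm f * K < \<bar>r\<bar> ^ Suc n * \<bar>f \<bullet> q\<bar>" using fq by (simp add: field_simps)
    also have "\<dots> = \<bar>f \<bullet> (P n *v q)\<bar>" unfolding Pv inner_power_left[OF f(2)] by (simp add: abs_mult power_abs)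
    also have "\<dots> \<le> norm f * norm (P n *v q)" by (rule Cauchy_Schwarz_ineq2)
    also have "\<dots> \<le> norm f * K"
      using bd(1)[OF mult[OF PT t0(1)]] by (intro mult_left_mono) (auto simp: q_def matrix_vector_mul_assoc)
    finally show False by simp
  qed
  \<comment> \<open>For |r| < 1 all eigenvalues lie inside the unit disc and 1 is merely a value
    whose square is 1. In that case g would fix the nonzero vector \<open>\<pi> *v q\<close>, which
    is how |r| = 1 is proved further down.\<close>
  define \<rho> where "\<rho> = (if \<bar>r\<bar> = 1 then r else 1)"
  have rho: "\<rho> * \<rho> = 1" by (auto simp: \<rho>_def abs_if split: if_splits)
  have gb: "\<exists>B. \<forall>k. norm (((*v) g ^^ k) y) \<le> B" for y
  proof -
    obtain B where B: "\<And>u. u \<in> T \<Longrightarrow> norm (u *v y) \<le> B" using Tb by blast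
    have "norm (((*v) g ^^ k) y) \<le> max B (norm y)" for k
    proof (cases k)
      case (Suc j)
      have "norm (((*v) g ^^ k) y) \<le> B" unfolding Suc Pv[symmetric] by (rule B[OF PT])
      then show ?thesis by simp
    qed simp
    then show ?thesis by blast
  qed
  have reg: "(\<lambda>k. g *v (((*v) g ^^ k) y) - \<rho> *\<^sub>R ((*v) g ^^ k) y) \<longlonglongrightarrow> 0" for y
  proof (rule power_bounded_regular[OF gb rho])
    fix z assume z: "poly (cpoly g) z = 0"
    show "z = complex_of_real \<rho> \<or> cmod z < 1"
    proof (cases "z = complex_of_real r")
      case True
      then show ?thesis using r1 by (auto simp: \<rho>_def)
    next
      case False
      then show ?thesis using dom[OF z] r1 by auto
    qed
  qed
  \<comment> \<open>\<open>Q k\<close> is the power 2 k + 2 of \<open>g\<close>. Even exponents give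
    r^(2 k + 2) = 1 also for r = -1, so the limit \<pi> preserves \<open>f\<close> exactly
    (\<open>fpi\<close>).\<close>
  define Q where "Q k = P (2 * k + 1)" for k
  have "bounded (range Q)"
  proof -
    obtain B where B: "\<And>j u. u \<in> T \<Longrightarrow> norm (u *v axis j 1) \<le> B j"
      using choice[of "\<lambda>j B. \<forall>u\<in>T. norm (u *v axis j 1) \<le> B"] Tb by blast
    have "norm (Q k) \<le> (\<Sum>i\<in>(UNIV::'n set). \<Sum>j\<in>UNIV. B j)" for k
      by (rule order_trans[OF norm_matrix_le]) (intro sum_mono B, simp add: Q_def PT)
    then show ?thesis by (auto simp: bounded_iff)
  qed
  then obtain \<pi> s where s: "strict_mono s" "(Q \<circ> s) \<longlonglongrightarrow> \<pi>"
    using bounded_imp_convergent_subsequence by blast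
  have Qv: "(\<lambda>k. Q (s k) *v y) \<longlonglongrightarrow> \<pi> *v y" for y
    using s(2) unfolding o_def by (intro tendsto_intros)
  have Qpow: "Q k *v y = ((*v) g ^^ (2 * k + 2)) y" for k y by (simp add: Q_def Pv del: funpow.simps)
  have gpi: "g *v (\<pi> *v y) = \<rho> *\<^sub>R (\<pi> *v y)" for y
  proof -
    have "strict_mono (\<lambda>k. 2 * s k + 2)" using s(1) by (auto simp: strict_mono_def)
    from LIMSEQ_subseq_LIMSEQ[OF reg[of y] this]
    have "(\<lambda>k. g *v (Q (s k) *v y) - \<rho> *\<^sub>R (Q (s k) *v y)) \<longlonglongrightarrow> 0"
      unfolding o_def Qpow .
    moreover have "(\<lambda>k. g *v (Q (s k) *v y) - \<rho> *\<^sub>R (Q (s k) *v y)) \<longlonglongrightarrow> g *v (\<pi> *v y) - \<rho> *\<^sub>R (\<pi> *v y)"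
      by (intro tendsto_intros Qv)
    ultimately have "g *v (\<pi> *v y) - \<rho> *\<^sub>R (\<pi> *v y) = 0" using LIMSEQ_unique by blast
    then show ?thesis by simp
  qed
  \<comment> \<open>The closure is taken among all matrices, since \<pi> may be singular. Products
    and the two-sided bound on the orbit of \<open>x\<close> pass to it.\<close>
  define C where "C = closure T"
  have CT: "T \<subseteq> C" by (simp add: C_def closure_subset)
  have piC: "\<pi> \<in> C"
    unfolding C_def closure_sequential using s(2) PT by (intro exI[of _ "Q \<circ> s"]) (auto simp: Q_def)
  have Cmult: "a ** b \<in> C" if "a \<in> C" "b \<in> C" for a b
  proof -
    from that obtain A B where "\<And>n. A n \<in> T" "A \<longlonglongrightarrow> a" "\<And>n. B n \<in> T" "B \<longlonglongrightarrow> b"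
      unfolding C_def closure_sequential by blast
    then show ?thesis unfolding C_def closure_sequential
      by (intro exI[of _ "\<lambda>n. A n ** B n"]) (auto intro!: mult tendsto_intros)
  qed
  have Cbd: "norm (a *v x) \<le> K" "1 / K \<le> norm (a *v x)" if "a \<in> C" for a
  proof -
    from that obtain A where A: "\<And>n. A n \<in> T" "A \<longlonglongrightarrow> a"
      unfolding C_def closure_sequential by blast
    have l: "(\<lambda>n. norm (A n *v x)) \<longlonglongrightarrow> norm (a *v x)" using A(2) by (intro tendsto_intros)
    show "norm (a *v x) \<le> K" by (rule LIMSEQ_le_const2[OF l]) (use A bd in auto)
    show "1 / K \<le> norm (a *v x)" by (rule LIMSEQ_le_const[OF l]) (use A bd in auto)
  qed
  have piq: "\<pi> *v q \<noteq> 0"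
    using Cbd(2)[OF Cmult[OF piC]] CT t0(1) K by (fastforce simp: q_def matrix_vector_mul_assoc)
  have "\<bar>r\<bar> = 1"
  proof (rule ccontr)
    assume n: "\<bar>r\<bar> \<noteq> 1"
    then have "g *v (\<pi> *v q) = \<pi> *v q" using gpi[of q] by (simp add: \<rho>_def)
    then have "cmat g *v cvec (\<pi> *v q) = 1 *s cvec (\<pi> *v q)" by (simp add: cmat_mv)
    then have "poly (cpoly g) 1 = 0" using piq cpoly_root_iff by (metis cvec_eq_0)
    moreover have "1 \<noteq> complex_of_real r" using n by auto
    ultimately show False using dom[of 1] r1 by auto
  qed
  then have rr: "\<rho> = r" "r * r = 1" using rho by (auto simp: \<rho>_def)
  have fpi: "f \<bullet> (\<pi> *v y) = f \<bullet> y" for y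
  proof -
    have "f \<bullet> (Q k *v y) = f \<bullet> y" for k
      unfolding Qpow inner_power_left[OF f(2)] using rr(2) by (simp add: power_add power_mult power2_eq_square)
    moreover have "(\<lambda>k. f \<bullet> (Q (s k) *v y)) \<longlonglongrightarrow> f \<bullet> (\<pi> *v y)" by (intro tendsto_intros Qv)
    ultimately show ?thesis by (simp add: LIMSEQ_const_iff)
  qed
  have fv: "f \<bullet> v \<noteq> 0"
  proof
    assume "f \<bullet> v = 0"
    moreover obtain c where "\<pi> *v q = c *\<^sub>R v" using one gpi[of q] rr(1) by auto
    ultimately show False using fpi[of q] fq by simp
  qed
  have pi: "\<pi> *v y = ((f \<bullet> y) / (f \<bullet> v)) *\<^sub>R v" for y
  proof -
    obtain c where c: "\<pi> *v y = c *\<^sub>R v" using one gpi[of y] rr(1) by auto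
    then have "f \<bullet> y = c * (f \<bullet> v)" using fpi[of y] by simp
    then show ?thesis using c fv by simp
  qed
  have ftv: "\<bar>f \<bullet> (t *v v)\<bar> = \<bar>f \<bullet> v\<bar>" if t: "t \<in> T" for t
  proof -
    define \<beta> where "\<beta> = (f \<bullet> (t *v v)) / (f \<bullet> v)"
    \<comment> \<open>\<open>W n\<close> is (\<pi> t)^n \<pi> t0 and acts on \<open>x\<close> as
      \<beta>^n times \<open>\<pi> *v q\<close>. The two-sided bound on \<open>C\<close> then leaves
      only |\<beta>| = 1.\<close>
    define W where "W n = (((**) (\<pi> ** t)) ^^ n) (\<pi> ** t0)" for n
    have WC: "W n \<in> C" for n
      by (induction n) (use piC CT t t0(1) in \<open>auto simp: W_def intro!: Cmult\<close>)
    have Wx: "W n *v x = \<beta> ^ n *\<^sub>R (\<pi> *v q)" for n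
    proof (induction n)
      case 0
      then show ?case by (simp add: W_def q_def matrix_vector_mul_assoc)
    next
      case (Suc n)
      have "W (Suc n) *v x = \<pi> *v (t *v (W n *v x))"
        by (simp add: W_def matrix_vector_mul_assoc matrix_mul_assoc)
      also have "\<dots> = \<beta> ^ n *\<^sub>R (\<pi> *v (t *v (\<pi> *v q)))"
        unfolding Suc by (simp add: matrix_vector_mult_scaleR)
      also have "\<pi> *v (t *v (\<pi> *v q)) = \<beta> *\<^sub>R (\<pi> *v q)"
        unfolding pi[of q] by (simp add: matrix_vector_mult_scaleR pi[of "t *v v"] \<beta>_def)
      finally show ?case by simp
    qed
    define N where "N = norm (\<pi> *v q)"
    have N: "N > 0" using piq by (simp add: N_def)
    have b1: "\<bar>\<beta>\<bar> ^ n * N \<le> K" and b2: "1 / K \<le> \<bar>\<beta>\<bar> ^ n * N" for n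
      using Cbd[OF WC[of n]] unfolding Wx by (simp_all add: N_def power_abs)
    have "\<not> \<bar>\<beta>\<bar> > 1"
    proof
      assume "\<bar>\<beta>\<bar> > 1"
      then obtain n where "K / N < \<bar>\<beta>\<bar> ^ n" using real_arch_pow by blast
      then show False using b1[of n] N by (simp add: field_simps)
    qed
    moreover have "\<not> \<bar>\<beta>\<bar> < 1"
    proof
      assume "\<bar>\<beta>\<bar> < 1"
      then obtain n where "\<bar>\<beta>\<bar> ^ n < 1 / K / N" using real_arch_pow_inv[of "1 / K / N" "\<bar>\<beta>\<bar>"] N K by auto
      then have "\<bar>\<beta>\<bar> ^ n * N < 1 / K / N * N" using N by (intro mult_strict_right_mono)
      then show False using b2[of n] N by simp
    qed
    ultimately have "\<bar>\<beta>\<bar> = 1" by linarith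
    then show ?thesis using fv by (simp add: \<beta>_def abs_divide field_simps)
  qed
  \<comment> \<open>A basis of functionals of the form y -> f . (u y) with u in \<open>T\<close>. On
    the orbit of v each of them takes only the two values \<plusminus>(f . v), so its coordinates
    have finitely many values and this orbit is finite.\<close>
  obtain B where B: "B \<subseteq> (\<lambda>u. transpose u *v f) ` T" "independent B" "(\<lambda>u. transpose u *v f) ` T \<subseteq> span B"
    using maximal_independent_subset by blast
  have "span ((\<lambda>u. transpose u *v f) ` T) = UNIV"
    by (rule span_dual_orbit[OF T T0 _ irr f(1)]) (rule mult)
  then have spB: "span B = UNIV"
    using span_mono[OF B(3)] unfolding span_span by blast
  have finB: "finite B" using B(2) by (rule independent_imp_finite)
  define \<phi> where "\<phi> y = restrict (\<lambda>b. b \<bullet> y) B" for y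
  have "inj \<phi>"
  proof (rule injI)
    fix y z assume "\<phi> y = \<phi> z"
    then have "b \<bullet> y = b \<bullet> z" if "b \<in> B" for b
      using that unfolding \<phi>_def by (metis restrict_apply')
    then have "B \<subseteq> {b. b \<bullet> (y - z) = 0}" by (auto simp: inner_diff_right)
    then have "span B \<subseteq> {b. b \<bullet> (y - z) = 0}"
      by (rule span_minimal) (auto simp: subspace_def inner_add_left)
    then have "(y - z) \<bullet> (y - z) = 0" using spB by blast
    then show "y = z" by simp
  qed
  define Tv where "Tv = (\<lambda>t. t *v v) ` T"
  have "\<phi> ` Tv \<subseteq> B \<rightarrow>\<^sub>E {f \<bullet> v, - (f \<bullet> v)}"
  proof clarify
    fix y assume "y \<in> Tv"
    then obtain t where t: "t \<in> T" "y = t *v v" by (auto simp: Tv_def)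
    have "b \<bullet> y \<in> {f \<bullet> v, - (f \<bullet> v)}" if b: "b \<in> B" for b
    proof -
      obtain u where u: "u \<in> T" "b = transpose u *v f" using b B(1) by auto
      have "b \<bullet> y = f \<bullet> ((u ** t) *v v)" by (simp add: u(2) t(2) inner_transpose matrix_vector_mul_assoc)
      then show ?thesis using ftv[OF mult[OF u(1) t(1)]] by (auto simp: abs_if split: if_splits)
    qed
    then show "\<phi> y \<in> B \<rightarrow>\<^sub>E {f \<bullet> v, - (f \<bullet> v)}" by (auto simp: \<phi>_def)
  qed
  then have "finite (\<phi> ` Tv)" by (rule finite_subset) (intro finite_PiE finB, simp)
  then have finO: "finite Tv" by (rule finite_imageD) (rule inj_on_subset[OF \<open>inj \<phi>\<close> subset_UNIV])
  show False
  proof (rule no_invariant_familyD[OF irr, of "(\<lambda>y. span {y}) ` Tv"])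
    show "finite ((\<lambda>y. span {y}) ` Tv)" using finO by simp
    show "(\<lambda>y. span {y}) ` Tv \<noteq> {}" using T0 by (simp add: Tv_def)
    fix W assume "W \<in> (\<lambda>y. span {y}) ` Tv"
    then obtain t where t: "t \<in> T" "W = span {t *v v}" by (auto simp: Tv_def)
    show "subspace W" by (simp add: t)
    have "t *v v \<noteq> 0" using ftv[OF t(1)] fv by auto
    moreover have "t *v v \<in> W" by (simp add: t span_base)
    ultimately show "W \<noteq> {0}" by auto
    have "dim W \<le> 1" unfolding t dim_span using dim_le_card'[of "{t *v v}"] by simp
    then show "W \<noteq> UNIV" using d by (auto simp: dim_UNIV)
    fix h assume h: "h \<in> T"
    have "(*v) h ` W = span ((*v) h ` {t *v v})"
      unfolding t(2) by (rule linear_span_image[symmetric]) simp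
    also have "\<dots> = span {(h ** t) *v v}" by (simp add: matrix_vector_mul_assoc)
    finally show "(*v) h ` W \<in> (\<lambda>y. span {y}) ` Tv" using mult[OF h t(1)] by (auto simp: Tv_def)
  qed
qed

subsection \<open>Supports and weak convergence\<close>

lemma prob_HD:
  assumes "prob_H M"
  shows "prob_space M" "sets M = sets borel" "space M = UNIV" "emeasure M Hset = 1"
  using assms sets_eq_imp_space_eq[of M borel] by (auto simp: prob_H_def)

lemma open_in_sets: "prob_H M \<Longrightarrow> open U \<Longrightarrow> U \<in> sets M"
  and closed_in_sets: "prob_H M \<Longrightarrow> closed U \<Longrightarrow> U \<in> sets M"
  by (simp_all add: prob_HD)

lemma AE_Hset: "prob_H M \<Longrightarrow> AE h in M. h \<in> Hset"
proof -
  assume M: "prob_H M"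
  interpret prob_space M using prob_HD(1)[OF M] .
  have "Hset \<in> sets M" by (rule open_in_sets[OF M open_Hset])
  then show ?thesis using prob_HD(4)[OF M] by (intro AE_prob_1) (auto simp: emeasure_eq_measure)
qed

lemma AE_Gset: "prob_H M \<Longrightarrow> AE h in M. fst h \<in> Gset"
  using AE_Hset by (rule AE_mp) (auto simp: Hset_def)

text \<open>Otherwise finitely many open null sets would cover \<open>K\<close>. This is how points
  of the support are produced throughout.\<close>

lemma compact_meets_supp_H:
  assumes M: "prob_H M" and K: "compact K" "K \<subseteq> Hset" "emeasure M K > 0"
  shows "\<exists>h\<in>K. h \<in> supp_H M"
proof (rule ccontr)
  assume "\<not> ?thesis"
  then have "K \<subseteq> \<Union>{U. open U \<and> emeasure M U = 0}"
    using K(2) by (auto simp: supp_H_def)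
  then obtain D where D: "D \<subseteq> {U. open U \<and> emeasure M U = 0}" "finite D" "K \<subseteq> \<Union>D"
    using compactE[OF K(1)] by (metis (no_types, lifting) mem_Collect_eq)
  have "emeasure M K \<le> emeasure M (\<Union>D)"
    using D(1,3) by (intro emeasure_mono open_in_sets[OF M]) auto
  also have "\<dots> \<le> (\<Sum>U\<in>D. emeasure M U)"
    using emeasure_subadditive_finite[OF D(2), of "\<lambda>U. U" M] D(1) open_in_sets[OF M] by auto
  also have "\<dots> = 0" using D(1) by (intro sum.neutral) auto
  finally show False using K(3) by simp
qed

lemma emeasure_distr_fst:
  "prob_H M \<Longrightarrow> open U \<Longrightarrow> emeasure (distr M borel fst) U = emeasure M (fst -` U)"
  by (subst emeasure_distr) (auto simp: prob_HD cong: measurable_cong_sets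
      intro!: borel_measurable_continuous_onI continuous_intros)

lemma fst_supp_H:
  assumes "prob_H M" "h \<in> supp_H M"
  shows "fst h \<in> supp_G M"
  unfolding supp_G_def
proof (intro CollectI conjI allI impI)
  show "fst h \<in> Gset" using assms(2) by (auto simp: supp_H_def Hset_def)
  fix U :: "'a mat set" assume U: "open U \<and> fst h \<in> U"
  then have "open (fst -` U :: 'a aff set)" "h \<in> fst -` U" by (auto intro: open_vimage_fst)
  then show "emeasure (distr M borel fst) U > 0"
    using assms U by (simp add: emeasure_distr_fst supp_H_def)
qed

text \<open>Projecting the support of the law may give a set that is not closed, so a point of
  \<open>supp_G\<close> is only a limit of linear parts of support points. The sets
  \<open>K n\<close> bound the translation part, which makes the preimage of a small ball a
  countable union of compact pieces up to its boundary.\<close>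

lemma supp_G_approx:
  fixes M :: "'n::finite aff measure"
  assumes M: "prob_H M" and g: "g \<in> supp_G M" and U: "open U" "g \<in> U"
  shows "\<exists>h\<in>supp_H M. fst h \<in> U"
proof -
  have "open (U \<inter> Gset)" "g \<in> U \<inter> Gset" using U open_Gset g by (auto simp: supp_G_def)
  then obtain e where e: "e > 0" "cball g e \<subseteq> U \<inter> Gset" using open_contains_cball by metis
  define K where "K n = cball g e \<times> cball (0::real^'n) (real n)" for n
  have Ks: "K n \<in> sets M" for n
    unfolding K_def by (intro closed_in_sets[OF M] closed_Times closed_cball)
  have "0 < emeasure (distr M borel fst) (ball g e)"
    using g e(1) by (auto simp: supp_G_def)
  also have "\<dots> = emeasure M (fst -` ball g e)" by (simp add: emeasure_distr_fst[OF M])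
  also have "\<dots> \<le> emeasure M (\<Union>n. K n)"
  proof (intro emeasure_mono)
    show "fst -` ball g e \<subseteq> (\<Union>n. K n)"
    proof
      fix h :: "'n aff" assume h: "h \<in> fst -` ball g e"
      obtain n where "norm (snd h) \<le> real n" using real_arch_simple by blast
      then have "h \<in> K n" using h by (auto simp: K_def mem_Times_iff)
      then show "h \<in> (\<Union>n. K n)" by blast
    qed
  qed (use Ks in auto)
  finally have pos: "0 < emeasure M (\<Union>n. K n)" .
  have "\<exists>n. emeasure M (K n) > 0"
  proof (rule ccontr)
    assume "\<not> ?thesis"
    then have "\<And>n. emeasure M (K n) = 0" by (simp add: not_gr_zero)
    then have "emeasure M (\<Union>n. K n) = 0"
      using Ks by (intro emeasure_UN_eq_0) auto
    then show False using pos by simp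
  qed
  then obtain n where n: "emeasure M (K n) > 0" by blast
  have "\<exists>h\<in>K n. h \<in> supp_H M" using e(2)
    by (intro compact_meets_supp_H[OF M _ _ n]) (auto simp: K_def Hset_def intro!: compact_Times)
  then obtain h where h: "h \<in> K n" "h \<in> supp_H M" by blast
  then have "fst h \<in> cball g e" by (auto simp: K_def mem_Times_iff)
  then show ?thesis using e(2) h(2) by blast
qed

text \<open>A tent function centred at h is an admissible test function for \<open>W_conv\<close>,
  being supported in a ball inside \<open>Hset\<close>. Half of its integral under \<open>M\<close>
  is a mass p that the laws eventually give to this ball.\<close>

lemma W_conv_open_mass:
  fixes M :: "'n::finite aff measure"
  assumes M: "prob_H M" and Ms: "\<And>n. prob_H (Ms n)" and W: "W_conv Ms M"
    and h: "h \<in> supp_H M" and U: "open U" "h \<in> U"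
  shows "\<exists>p>0. \<exists>K. compact K \<and> K \<subseteq> U \<inter> Hset \<and> (\<forall>\<^sub>F n in sequentially. measure (Ms n) K \<ge> p)"
proof -
  interpret M: prob_space M using prob_HD(1)[OF M] .
  have "open (U \<inter> Hset)" "h \<in> U \<inter> Hset" using U open_Hset h by (auto simp: supp_H_def)
  then obtain e where e: "e > 0" "cball h e \<subseteq> U \<inter> Hset" using open_contains_cball by metis
  define \<phi> where "\<phi> x = max 0 (1 - dist h x / e)" for x
  have cont: "continuous_on UNIV \<phi>" unfolding \<phi>_def using e(1) by (intro continuous_intros) auto
  have zero: "\<phi> x = 0" if "x \<notin> cball h e" for x
    using that e(1) by (auto simp: \<phi>_def field_simps)
  have "Cc_H \<phi>" unfolding Cc_H_def
    using cont zero e(2) compact_cball[of h e] by (intro conjI exI[of _ "cball h e"]) auto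
  then have lim: "(\<lambda>n. \<integral>h. \<phi> h \<partial>Ms n) \<longlonglongrightarrow> (\<integral>h. \<phi> h \<partial>M)" using W by (simp add: W_conv_def)
  have range: "0 \<le> \<phi> x" "\<phi> x \<le> 1" for x using e(1) by (auto simp: \<phi>_def)
  have int: "integrable N \<phi>" if "prob_H N" for N
  proof -
    interpret prob_space N using prob_HD(1)[OF that] .
    show ?thesis
      using range borel_measurable_continuous_onI[OF cont] prob_HD(2)[OF that]
      by (intro integrable_const_bound[of _ 1]) (auto cong: measurable_cong_sets)
  qed
  define p where "p = (\<integral>h. \<phi> h \<partial>M) / 2"
  have "p > 0"
  proof -
    have "0 < emeasure M (ball h (e / 2))" using h e(1) by (auto simp: supp_H_def)
    then have m: "0 < measure M (ball h (e / 2))"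
      by (simp add: M.emeasure_eq_measure)
    have "1 / 2 * indicator (ball h (e / 2)) x \<le> \<phi> x" for x
      using e(1) by (auto simp: indicator_def \<phi>_def field_simps)
    then have "(\<integral>x. 1 / 2 * indicator (ball h (e / 2)) x \<partial>M) \<le> (\<integral>x. \<phi> x \<partial>M)"
      using int[OF M] open_in_sets[OF M, of "ball h (e / 2)"]
      by (intro integral_mono integrable_mult_right integrable_real_indicator) (auto simp: M.emeasure_eq_measure)
    then have "measure M (ball h (e / 2)) / 2 \<le> 2 * p"
      using open_in_sets[OF M, of "ball h (e / 2)"] sets.sets_into_space by (simp add: p_def prob_HD(3)[OF M])
    then show ?thesis using m by linarith
  qed
  have "\<forall>\<^sub>F n in sequentially. (\<integral>h. \<phi> h \<partial>Ms n) > p"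
    using \<open>p > 0\<close> by (intro order_tendstoD(1)[OF lim]) (simp add: p_def)
  then have "\<forall>\<^sub>F n in sequentially. measure (Ms n) (cball h e) \<ge> p"
  proof (rule eventually_mono)
    fix n assume n: "(\<integral>h. \<phi> h \<partial>Ms n) > p"
    interpret N: prob_space "Ms n" using prob_HD(1)[OF Ms] .
    have s: "cball h e \<in> sets (Ms n)" by (rule closed_in_sets[OF Ms]) simp
    have "(\<integral>h. \<phi> h \<partial>Ms n) \<le> (\<integral>x. indicator (cball h e) x \<partial>Ms n)"
    proof (intro integral_mono int[OF Ms] integrable_real_indicator s)
      fix x show "\<phi> x \<le> indicator (cball h e) x"
        using range(2)[of x] zero[of x] by (auto simp: indicator_def)
    qed (simp add: N.emeasure_eq_measure)
    also have "\<dots> = measure (Ms n) (cball h e)" using s by (simp add: prob_HD(3)[OF Ms])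
    finally show "measure (Ms n) (cball h e) \<ge> p" using n by simp
  qed
  then show ?thesis using \<open>p > 0\<close> e(2) by (intro exI[of _ p] conjI exI[of _ "cball h e"]) auto
qed

lemma W_conv_supp_H:
  assumes M: "prob_H M" and Ms: "\<And>n. prob_H (Ms n)" and W: "W_conv Ms M"
    and h: "h \<in> supp_H M" and U: "open U" "h \<in> U"
  shows "\<forall>\<^sub>F n in sequentially. \<exists>h'\<in>supp_H (Ms n). h' \<in> U"
proof -
  obtain p K where pK: "p > 0" "compact K" "K \<subseteq> U \<inter> Hset" "\<forall>\<^sub>F n in sequentially. measure (Ms n) K \<ge> p"
    using W_conv_open_mass[OF M Ms W h U] by blast
  show ?thesis using pK(4)
  proof (rule eventually_mono)
    fix n assume "measure (Ms n) K \<ge> p"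
    then have "emeasure (Ms n) K \<noteq> 0" using pK(1) by (auto simp: measure_def)
    then have "emeasure (Ms n) K > 0" by (simp add: zero_less_iff_neq_zero)
    then show "\<exists>h'\<in>supp_H (Ms n). h' \<in> U"
      using compact_meets_supp_H[OF Ms pK(2), of n] pK(3) by blast
  qed
qed

section \<open>The closed semigroup generated by the support\<close>

lemma supp_G_subset: "supp_G M \<subseteq> Gset" by (auto simp: supp_G_def)

lemma semigrp_T_subset: "semigrp_T M \<subseteq> Gset"
proof -
  have "semigrp_T M \<subseteq> Gset" unfolding semigrp_T_def
    by (rule Inter_lower) (auto simp: supp_G_subset Gset_mult)
  then show ?thesis .
qed

lemma supp_G_subset_semigrp_T: "supp_G M \<subseteq> semigrp_T M"
  by (auto simp: semigrp_T_def)

lemma semigrp_T_mult: "a \<in> semigrp_T M \<Longrightarrow> b \<in> semigrp_T M \<Longrightarrow> a ** b \<in> semigrp_T M"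
  by (auto simp: semigrp_T_def)

lemma semigrp_T_least:
  assumes "supp_G M \<subseteq> S" "\<And>a b. a \<in> S \<Longrightarrow> b \<in> S \<Longrightarrow> a \<in> Gset \<Longrightarrow> b \<in> Gset \<Longrightarrow> a ** b \<in> S" "closed S"
  shows "semigrp_T M \<subseteq> S"
proof -
  have "semigrp_T M \<subseteq> S \<inter> Gset" unfolding semigrp_T_def
    using assms supp_G_subset Gset_mult closedin_closed_Int[of S Gset]
    by (intro Inter_lower) (auto simp: Int_commute dest: subsetD[OF supp_G_subset])
  then show ?thesis by blast
qed

text \<open>The semigroup is defined as an intersection, so its elements are not given as limits of
  words. Induction over open sets gets around this: the points all of whose neighbourhoods satisfy
  \<open>Q\<close> form a closed set, and continuity of the product makes it a semigroup.\<close>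

lemma semigrp_T_open_induct:
  fixes M :: "'n::finite aff measure"
  assumes base: "\<And>g U. g \<in> supp_G M \<Longrightarrow> open U \<Longrightarrow> g \<in> U \<Longrightarrow> Q U"
    and mult: "\<And>A B U. open A \<Longrightarrow> open B \<Longrightarrow> open U \<Longrightarrow> Q A \<Longrightarrow> Q B \<Longrightarrow> (\<And>a b. a \<in> A \<Longrightarrow> b \<in> B \<Longrightarrow> a ** b \<in> U) \<Longrightarrow> Q U"
    and u: "u \<in> semigrp_T M" and U: "open U" "u \<in> U"
  shows "Q U"
proof -
  define S where "S = {u :: 'n mat. \<forall>U. open U \<and> u \<in> U \<longrightarrow> Q U}"
  have "semigrp_T M \<subseteq> S"
  proof (rule semigrp_T_least)
    show "supp_G M \<subseteq> S" using base by (auto simp: S_def)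
    fix a b assume ab: "a \<in> S" "b \<in> S"
    show "a ** b \<in> S" unfolding S_def
    proof (intro CollectI allI impI)
      fix U assume U: "open U \<and> a ** b \<in> U"
      have "continuous_on UNIV (\<lambda>p :: 'n mat \<times> 'n mat. fst p ** snd p)" by (intro continuous_intros)
      then have "open ((\<lambda>p :: 'n mat \<times> 'n mat. fst p ** snd p) -` U)"
        using U by (simp add: open_vimage)
      then obtain A B where AB: "open A" "open B" "(a, b) \<in> A \<times> B"
        "A \<times> B \<subseteq> (\<lambda>p :: 'n mat \<times> 'n mat. fst p ** snd p) -` U"
        using U by (elim open_prod_elim[where x = "(a, b)"]) auto
      show "Q U"
      proof (rule mult[OF AB(1,2)])
        show "Q A" "Q B" using ab AB by (auto simp: S_def)
        fix a b assume "a \<in> A" "b \<in> B"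
        then have "(a, b) \<in> A \<times> B" by simp
        then show "a ** b \<in> U" using AB(4) by auto
      qed (use U in simp)
    qed
  next
    have "x \<in> S" if "x \<in> closure S" for x
      unfolding S_def
    proof (intro CollectI allI impI)
      fix U assume U: "open U \<and> x \<in> U"
      then have "U \<inter> S \<noteq> {}" using that open_Int_closure_eq_empty[of U S] by blast
      then show "Q U" using U by (auto simp: S_def)
    qed
    then have "closure S \<subseteq> S" by blast
    then show "closed S" by (simp only: closure_subset_eq)
  qed
  then show ?thesis using u U by (auto simp: S_def)
qed

text \<open>Lower semicontinuity of the semigroup in the law. Induction over neighbourhoods combines
  two eventual statements at each product, and no uniformity in the length of words is
  required.\<close>

lemma semigrp_T_approx:
  fixes M :: "'n::finite aff measure"
  assumes M: "prob_H M" and Ms: "\<And>n. prob_H (Ms n)" and W: "W_conv Ms M"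
    and u: "u \<in> semigrp_T M" and U: "open U" "u \<in> U"
  shows "\<forall>\<^sub>F n in sequentially. \<exists>u'\<in>semigrp_T (Ms n). u' \<in> U"
proof (rule semigrp_T_open_induct[where Q = "\<lambda>U. \<forall>\<^sub>F n in sequentially. \<exists>u'\<in>semigrp_T (Ms n). u' \<in> U", OF _ _ u U])
  fix g U assume g: "g \<in> supp_G M" and U: "open U" "g \<in> (U :: 'n mat set)"
  obtain h where h: "h \<in> supp_H M" "fst h \<in> U" using supp_G_approx[OF M g U] by blast
  have "open (fst -` U :: 'n aff set)" using U(1) by (rule open_vimage_fst)
  from W_conv_supp_H[OF M Ms W h(1) this] h(2)
  have "\<forall>\<^sub>F n in sequentially. \<exists>h'\<in>supp_H (Ms n). h' \<in> fst -` U" by auto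
  then show "\<forall>\<^sub>F n in sequentially. \<exists>u'\<in>semigrp_T (Ms n). u' \<in> U"
    by (rule eventually_mono) (use fst_supp_H[OF Ms] supp_G_subset_semigrp_T in \<open>fastforce\<close>)
next
  fix A B U :: "'n mat set"
  assume 1: "\<forall>\<^sub>F n in sequentially. \<exists>u'\<in>semigrp_T (Ms n). u' \<in> A"
    and 2: "\<forall>\<^sub>F n in sequentially. \<exists>u'\<in>semigrp_T (Ms n). u' \<in> B"
    and AB: "\<And>a b. a \<in> A \<Longrightarrow> b \<in> B \<Longrightarrow> a ** b \<in> U"
  from 1 2 show "\<forall>\<^sub>F n in sequentially. \<exists>u'\<in>semigrp_T (Ms n). u' \<in> U"
    by eventually_elim (blast intro: semigrp_T_mult AB)
qed

section \<open>Cutoffs and convergence of integrals of polynomial growth\<close>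

definition cutoff :: "nat \<Rightarrow> 'n::finite aff \<Rightarrow> real" where
  "cutoff R h = max 0 (min 1 (real R + 1 - norm (fst h))) * max 0 (min 1 (real R + 1 - norm (snd h)))
     * max 0 (min 1 (real R * \<bar>det (fst h)\<bar> - 1))"

lemma cutoff_range: "0 \<le> cutoff R h" "cutoff R h \<le> 1"
  by (auto simp: cutoff_def intro!: mult_le_one)

lemma continuous_cutoff: "continuous_on UNIV (cutoff R :: 'n::finite aff \<Rightarrow> real)"
  unfolding cutoff_def by (intro continuous_intros continuous_on_det)

text \<open>Compactness must hold inside the group: two factors of \<open>cutoff\<close> bound the
  linear part and the translation, the third keeps the determinant away from 0.\<close>

lemma cutoff_support:
  "\<exists>K. compact K \<and> K \<subseteq> Hset \<and> (\<forall>h :: 'n::finite aff. h \<notin> K \<longrightarrow> cutoff R h = 0)"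
proof -
  define K where "K = {h :: 'n aff. norm (fst h) \<le> R + 1 \<and> norm (snd h) \<le> R + 1 \<and> 1 \<le> R * \<bar>det (fst h)\<bar>}"
  have "closed K" unfolding K_def
    by (intro closed_Collect_conj closed_Collect_le continuous_intros continuous_on_det)
  moreover have "K \<subseteq> cball 0 (R + 1) \<times> cball 0 (R + 1)" by (auto simp: K_def)
  then have "bounded K" by (rule bounded_subset[rotated]) (intro bounded_Times bounded_cball)
  ultimately have "compact K" by (simp add: compact_eq_bounded_closed)
  moreover have "K \<subseteq> Hset" by (auto simp: K_def Hset_def Gset_iff_det)
  moreover have "cutoff R h = 0" if "h \<notin> K" for h
    using that by (auto simp: K_def cutoff_def not_le max_def min_def)
  ultimately show ?thesis by blast
qed

lemma cutoff_tendsto: "h \<in> Hset \<Longrightarrow> (\<lambda>R. cutoff R h) \<longlonglongrightarrow> 1"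
proof -
  assume "h \<in> Hset"
  then have d: "\<bar>det (fst h)\<bar> > 0" by (auto simp: Hset_def Gset_iff_det)
  obtain N where N: "norm (fst h) + norm (snd h) + 2 / \<bar>det (fst h)\<bar> \<le> real N" using real_arch_simple by blast
  have "cutoff R h = 1" if "R \<ge> N" for R
  proof -
    have "norm (fst h) + norm (snd h) + 2 / \<bar>det (fst h)\<bar> \<le> real R" using N that by linarith
    moreover have "0 < 2 / \<bar>det (fst h)\<bar>" using d by simp
    ultimately have le: "norm (fst h) \<le> R" "norm (snd h) \<le> R" "2 / \<bar>det (fst h)\<bar> \<le> R"
      using norm_ge_zero[of "fst h"] norm_ge_zero[of "snd h"] by linarith+
    then have "2 \<le> real R * \<bar>det (fst h)\<bar>" using d by (simp add: field_simps)
    then show ?thesis using le unfolding cutoff_def by (simp add: min_absorb1)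
  qed
  then show ?thesis by (intro tendsto_eventually) (auto simp: eventually_sequentially)
qed

lemma Cc_H_cutoff:
  assumes "continuous_on Hset \<psi>"
  shows "Cc_H (\<lambda>h. cutoff R h * \<psi> h)"
proof -
  obtain K :: "'a aff set" where K: "compact K" "K \<subseteq> Hset" "\<And>h. h \<notin> K \<Longrightarrow> cutoff R h = 0"
    using cutoff_support by blast
  have "continuous_on Hset (\<lambda>h. cutoff R h * \<psi> h)"
    using assms continuous_cutoff continuous_on_subset by (intro continuous_intros) blast+
  moreover have "continuous_on (- K) (\<lambda>h. cutoff R h * \<psi> h)"
    by (rule continuous_on_eq[OF continuous_on_const[of _ 0]]) (use K(3) in auto)
  ultimately have "continuous_on (Hset \<union> - K) (\<lambda>h. cutoff R h * \<psi> h)"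
    using K(1) open_Hset by (intro continuous_on_open_Un) (auto simp: compact_imp_closed open_Compl)
  moreover have "Hset \<union> - K = UNIV" using K(2) by blast
  ultimately show ?thesis unfolding Cc_H_def using K by (intro conjI exI[of _ K]) auto
qed

text \<open>A cutoff loses little of the integral under the fixed law \<open>M\<close> by dominated
  convergence, and it can only decrease the integrals of a nonnegative function under
  \<open>Ms n\<close>. Test functions therefore give a bound from one side.\<close>

lemma W_conv_lower:
  fixes M :: "'a::finite aff measure" and \<psi> :: "'a aff \<Rightarrow> real"
  assumes M: "prob_H M" and Ms: "\<And>n. prob_H (Ms n)" and W: "W_conv Ms M"
    and \<psi>: "continuous_on Hset \<psi>" "\<And>h. h \<in> Hset \<Longrightarrow> 0 \<le> \<psi> h"
    and int: "integrable M \<psi>" "\<And>n. integrable (Ms n) \<psi>" and e: "e > 0"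
  shows "\<forall>\<^sub>F n in sequentially. (\<integral>h. \<psi> h \<partial>Ms n) > (\<integral>h. \<psi> h \<partial>M) - e"
proof -
  have cm: "cutoff R \<in> borel_measurable N" if "prob_H N" for R and N :: "'a aff measure"
    using borel_measurable_continuous_onI[OF continuous_cutoff] prob_HD(2)[OF that]
    by (simp cong: measurable_cong_sets)
  have bnd: "norm (cutoff R h * \<psi> h) \<le> norm (\<psi> h)" for R h
    using cutoff_range[of R h] by (auto simp: abs_mult intro!: mult_left_le_one_le)
  have ci: "integrable N (\<lambda>h. cutoff R h * \<psi> h)" if "prob_H N" "integrable N \<psi>" for R N
    using that cm[OF that(1)] bnd by (intro Bochner_Integration.integrable_bound[OF that(2)]) auto
  have "(\<lambda>R. \<integral>h. cutoff R h * \<psi> h \<partial>M) \<longlonglongrightarrow> (\<integral>h. \<psi> h \<partial>M)"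
  proof (rule integral_dominated_convergence[where w = "\<lambda>h. norm (\<psi> h)"])
    show "AE h in M. (\<lambda>R. cutoff R h * \<psi> h) \<longlonglongrightarrow> \<psi> h"
      using AE_Hset[OF M]
    proof (rule AE_mp, intro AE_I2 impI)
      fix h :: "'a aff" assume "h \<in> Hset"
      then have "(\<lambda>R. cutoff R h * \<psi> h) \<longlonglongrightarrow> 1 * \<psi> h" by (intro tendsto_mult cutoff_tendsto tendsto_const)
      then show "(\<lambda>R. cutoff R h * \<psi> h) \<longlonglongrightarrow> \<psi> h" by simp
    qed
  qed (use int(1) ci[OF M int(1)] bnd in auto)
  then have "\<forall>\<^sub>F R in sequentially. (\<integral>h. cutoff R h * \<psi> h \<partial>M) > (\<integral>h. \<psi> h \<partial>M) - e"
    using e by (intro order_tendstoD) auto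
  then obtain R where R: "(\<integral>h. cutoff R h * \<psi> h \<partial>M) > (\<integral>h. \<psi> h \<partial>M) - e"
    by (auto simp: eventually_sequentially)
  have "(\<lambda>n. \<integral>h. cutoff R h * \<psi> h \<partial>Ms n) \<longlonglongrightarrow> (\<integral>h. cutoff R h * \<psi> h \<partial>M)"
    using W Cc_H_cutoff[OF \<psi>(1)] by (simp add: W_conv_def)
  from order_tendstoD(1)[OF this R] show ?thesis
  proof (rule eventually_mono)
    fix n assume n: "(\<integral>h. \<psi> h \<partial>M) - e < (\<integral>h. cutoff R h * \<psi> h \<partial>Ms n)"
    have "(\<integral>h. cutoff R h * \<psi> h \<partial>Ms n) \<le> (\<integral>h. \<psi> h \<partial>Ms n)"
    proof (rule integral_mono_AE[OF ci[OF Ms int(2)] int(2)])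
      show "AE h in Ms n. cutoff R h * \<psi> h \<le> \<psi> h"
        using AE_Hset[OF Ms] by (rule AE_mp)
          (use \<psi>(2) cutoff_range in \<open>auto intro!: AE_I2 mult_left_le_one_le\<close>)
    qed
    then show "(\<integral>h. \<psi> h \<partial>M) - e < (\<integral>h. \<psi> h \<partial>Ms n)" using n by linarith
  qed
qed

lemma integrable_moment:
  assumes M: "prob_H M" "moments_H M" and \<psi>: "\<psi> \<in> borel_measurable borel"
    and bnd: "\<And>h. h \<in> Hset \<Longrightarrow> \<bar>\<psi> h\<bar> \<le> C * (gamma (fst h) ^ k + norm (snd h) ^ k)"
  shows "integrable M \<psi>"
proof (rule Bochner_Integration.integrable_bound)
  show "integrable M (\<lambda>h. C * (gamma (fst h) ^ k + norm (snd h) ^ k))"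
    using M(2) by (simp only: moments_H_def integrable_mult_right)
  show "\<psi> \<in> borel_measurable M" using \<psi> prob_HD(2)[OF M(1)] by (simp cong: measurable_cong_sets)
  show "AE h in M. norm (\<psi> h) \<le> norm (C * (gamma (fst h) ^ k + norm (snd h) ^ k))"
    using AE_Hset[OF M(1)] by (rule AE_mp) (use bnd in \<open>auto intro!: AE_I2 order_trans[OF _ abs_ge_self]\<close>)
qed

text \<open>The dominating function F has convergent integrals by the second half of
  \<open>W_conv\<close>. Applying the one-sided bound to the nonnegative functions F + \<psi> and F
  - \<psi> then bounds the integrals of \<psi> from both sides.\<close>

lemma W_conv_integral:
  fixes M :: "'n::finite aff measure"
  assumes M: "prob_H M" "moments_H M" and Ms: "\<And>n. prob_H (Ms n)" "\<And>n. moments_H (Ms n)" and W: "W_conv Ms M"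
    and \<psi>: "continuous_on UNIV \<psi>"
    and bnd: "\<And>h. h \<in> Hset \<Longrightarrow> \<bar>\<psi> h\<bar> \<le> C * (gamma (fst h) ^ k + norm (snd h) ^ k)"
  shows "(\<lambda>n. \<integral>h. \<psi> h \<partial>Ms n) \<longlonglongrightarrow> (\<integral>h. \<psi> h \<partial>M)"
proof -
  let ?F = "\<lambda>h :: 'n aff. C * (gamma (fst h) ^ k + norm (snd h) ^ k)"
  have bm: "\<psi> \<in> borel_measurable borel" by (rule borel_measurable_continuous_onI[OF \<psi>])
  note i1 = integrable_moment[OF M bm bnd] and i2 = integrable_moment[OF Ms bm bnd]
  have f1: "integrable M ?F" and f2: "integrable (Ms n) ?F" for n
    using M(2) Ms(2) by (simp_all only: moments_H_def integrable_mult_right)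
  have cF: "continuous_on Hset ?F"
    unfolding Hset_def
    by (intro continuous_intros continuous_on_compose2[OF continuous_on_gamma]) auto
  have c\<psi>: "continuous_on Hset \<psi>" using \<psi> continuous_on_subset by blast
  have limF: "(\<lambda>n. \<integral>h. ?F h \<partial>Ms n) \<longlonglongrightarrow> (\<integral>h. ?F h \<partial>M)"
    unfolding integral_mult_right_zero using W by (intro tendsto_mult tendsto_const) (simp add: W_conv_def)
  have aadd1: "(\<integral>h. ?F h + \<psi> h \<partial>M) = (\<integral>h. ?F h \<partial>M) + (\<integral>h. \<psi> h \<partial>M)"
    by (rule Bochner_Integration.integral_add[OF f1 i1])
  have aadd2: "(\<integral>h. ?F h + \<psi> h \<partial>Ms n) = (\<integral>h. ?F h \<partial>Ms n) + (\<integral>h. \<psi> h \<partial>Ms n)" for n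
    by (rule Bochner_Integration.integral_add[OF f2 i2])
  have adiff1: "(\<integral>h. ?F h - \<psi> h \<partial>M) = (\<integral>h. ?F h \<partial>M) - (\<integral>h. \<psi> h \<partial>M)"
    by (rule Bochner_Integration.integral_diff[OF f1 i1])
  have adiff2: "(\<integral>h. ?F h - \<psi> h \<partial>Ms n) = (\<integral>h. ?F h \<partial>Ms n) - (\<integral>h. \<psi> h \<partial>Ms n)" for n
    by (rule Bochner_Integration.integral_diff[OF f2 i2])
  show ?thesis
  proof (rule LIMSEQ_I)
    fix r :: real assume r: "0 < r"
    have "\<forall>\<^sub>F n in sequentially. (\<integral>h. ?F h + \<psi> h \<partial>Ms n) > (\<integral>h. ?F h + \<psi> h \<partial>M) - r / 2"
    proof (rule W_conv_lower[OF M(1) Ms(1) W continuous_on_add[OF cF c\<psi>] _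
          Bochner_Integration.integrable_add[OF f1 i1] Bochner_Integration.integrable_add[OF f2 i2]])
      fix h :: "'n aff" assume "h \<in> Hset"
      from bnd[OF this] show "0 \<le> ?F h + \<psi> h" by linarith
    qed (use r in auto)
    moreover have "\<forall>\<^sub>F n in sequentially. (\<integral>h. ?F h - \<psi> h \<partial>Ms n) > (\<integral>h. ?F h - \<psi> h \<partial>M) - r / 2"
    proof (rule W_conv_lower[OF M(1) Ms(1) W continuous_on_diff[OF cF c\<psi>] _
          Bochner_Integration.integrable_diff[OF f1 i1] Bochner_Integration.integrable_diff[OF f2 i2]])
      fix h :: "'n aff" assume "h \<in> Hset"
      from bnd[OF this] show "0 \<le> ?F h - \<psi> h" by linarith
    qed (use r in auto)
    moreover have "\<forall>\<^sub>F n in sequentially. \<bar>(\<integral>h. ?F h \<partial>Ms n) - (\<integral>h. ?F h \<partial>M)\<bar> < r / 2"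
      using tendstoD[OF limF, of "r / 2"] r by (simp add: dist_real_def)
    ultimately have "\<forall>\<^sub>F n in sequentially. norm ((\<integral>h. \<psi> h \<partial>Ms n) - (\<integral>h. \<psi> h \<partial>M)) < r"
    proof eventually_elim
      case (elim n)
      then show ?case
        using aadd1 aadd2[of n] adiff1 adiff2[of n] unfolding real_norm_def by arith
    qed
    then show "\<exists>no. \<forall>n\<ge>no. norm ((\<integral>h. \<psi> h \<partial>Ms n) - (\<integral>h. \<psi> h \<partial>M)) < r"
      by (auto simp: eventually_sequentially)
  qed
qed

subsection \<open>Moments of the products\<close>

definition law :: "'n::finite aff measure \<Rightarrow> nat \<Rightarrow> 'n mat measure" where
  "law M n = distr (PiM {..<n} (\<lambda>_. M)) borel (Sprod n)"

lemma sets_law [simp, measurable_cong]: "sets (law M n) = sets borel"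
  and space_law [simp]: "space (law M n) = UNIV"
  by (simp_all add: law_def)

lemma measurable_fst_H: "prob_H M \<Longrightarrow> fst \<in> measurable M borel"
  using prob_HD(2)[of M]
  by (auto cong: measurable_cong_sets intro!: borel_measurable_continuous_onI continuous_intros)

lemma measurable_Sprod:
  assumes M: "prob_H M" and "n \<le> N"
  shows "Sprod n \<in> measurable (PiM {..<N} (\<lambda>_. M)) borel"
  using assms(2)
proof (induction n)
  case 0
  have "Sprod 0 = (\<lambda>_. mat 1 :: 'a mat)" by (rule ext) simp
  then show ?case by simp
next
  case (Suc n)
  have "(\<lambda>\<omega>. \<omega> n) \<in> measurable (PiM {..<N} (\<lambda>_. M)) M"
    using Suc.prems by (intro measurable_component_singleton) auto
  then have "(\<lambda>\<omega>. fst (\<omega> n)) \<in> measurable (PiM {..<N} (\<lambda>_. M)) borel"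
    by (rule measurable_compose[OF _ measurable_fst_H[OF M]])
  moreover have "Sprod (Suc n) = (\<lambda>\<omega>. fst (\<omega> n) ** (Sprod n \<omega> :: 'a mat))" by (rule ext) simp
  ultimately show ?case using Suc by (simp only: borel_measurable_matrix_mult Suc_leD)
qed

lemma Sprod_cong: "(\<And>i. i < n \<Longrightarrow> \<omega> i = \<omega>' i) \<Longrightarrow> Sprod n \<omega> = Sprod n \<omega>'"
  by (induction n) auto

lemma prob_space_law: "prob_H M \<Longrightarrow> prob_space (law M n)"
  unfolding law_def
  by (intro prob_space.prob_space_distr prob_space_PiM prob_HD(1) measurable_Sprod order_refl)

lemma nn_integral_law:
  assumes "prob_H M" "\<phi> \<in> borel_measurable borel"
  shows "(\<integral>\<^sup>+X. \<phi> X \<partial>law M n) = (\<integral>\<^sup>+\<omega>. \<phi> (Sprod n \<omega>) \<partial>PiM {..<n} (\<lambda>_. M))"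
  unfolding law_def using assms by (intro nn_integral_distr measurable_Sprod) auto

lemma moment_S_law: "prob_H M \<Longrightarrow> moment_S M s n = (\<integral>\<^sup>+X. ennreal (opnorm X powr s) \<partial>law M n)"
  unfolding moment_S_def by (subst nn_integral_law) auto

lemma law_0: "prob_H M \<Longrightarrow> \<phi> \<in> borel_measurable borel \<Longrightarrow> (\<integral>\<^sup>+X. \<phi> X \<partial>law M 0) = \<phi> (mat 1)"
proof -
  assume a: "prob_H M" "\<phi> \<in> borel_measurable borel"
  interpret prob_space "PiM {..<0::nat} (\<lambda>_. M)" by (intro prob_space_PiM prob_HD(1) a)
  show ?thesis unfolding nn_integral_law[OF a] by (simp add: emeasure_space_1 del: lessThan_0)
qed

lemma law_Suc:
  assumes M: "prob_H M" and \<phi>: "\<phi> \<in> borel_measurable borel"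
  shows "(\<integral>\<^sup>+X. \<phi> X \<partial>law M (Suc n)) = (\<integral>\<^sup>+X. (\<integral>\<^sup>+h. \<phi> (fst h ** X) \<partial>M) \<partial>law M n)"
proof -
  interpret prob_space M using prob_HD(1)[OF M] .
  interpret product_sigma_finite "\<lambda>_ :: nat. M" by standard
  note [measurable] = \<phi> measurable_fst_H[OF M] measurable_Sprod[OF M]
  have ins: "{..<Suc n} = insert n {..<n}" by auto
  have m: "(\<lambda>\<omega>. \<phi> (Sprod (Suc n) \<omega>)) \<in> borel_measurable (PiM (insert n {..<n}) (\<lambda>_. M))"
    unfolding ins[symmetric] by measurable
  have "(\<integral>\<^sup>+X. \<phi> X \<partial>law M (Suc n)) = (\<integral>\<^sup>+\<omega>. \<phi> (Sprod (Suc n) \<omega>) \<partial>PiM (insert n {..<n}) (\<lambda>_. M))"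
    unfolding nn_integral_law[OF M \<phi>] ins ..
  also have "\<dots> = (\<integral>\<^sup>+\<omega>. (\<integral>\<^sup>+h. \<phi> (Sprod (Suc n) (fun_upd \<omega> n h)) \<partial>M) \<partial>PiM {..<n} (\<lambda>_. M))"
    by (rule product_nn_integral_insert[OF _ _ m]) auto
  also have "\<dots> = (\<integral>\<^sup>+\<omega>. (\<integral>\<^sup>+h. \<phi> (fst h ** Sprod n \<omega>) \<partial>M) \<partial>PiM {..<n} (\<lambda>_. M))"
  proof -
    have "Sprod n (fun_upd \<omega> n h) = Sprod n \<omega>" for \<omega> and h :: "'a aff" by (rule Sprod_cong) auto
    then show ?thesis by simp
  qed
  also have "\<dots> = (\<integral>\<^sup>+X. (\<integral>\<^sup>+h. \<phi> (fst h ** X) \<partial>M) \<partial>law M n)"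
    by (rule nn_integral_law[OF M, symmetric]) measurable
  finally show ?thesis .
qed

text \<open>The law of S_(m+n) is the convolution in which the n earlier factors X stand on the
  right. All later manipulations of products use this formula in place of the sequence
  space.\<close>

lemma law_add:
  fixes M :: "'n::finite aff measure"
  assumes M: "prob_H M" and \<phi>: "\<phi> \<in> borel_measurable borel"
  shows "(\<integral>\<^sup>+X. \<phi> X \<partial>law M (m + n)) = (\<integral>\<^sup>+X. (\<integral>\<^sup>+Y. \<phi> (Y ** X) \<partial>law M m) \<partial>law M n)"
  using \<phi>
proof (induction m arbitrary: \<phi>)
  case (0 \<phi>)
  have "(\<integral>\<^sup>+Y. \<phi> (Y ** X) \<partial>law M 0) = \<phi> X" for X
    using 0 by (subst law_0[OF M]) auto
  then show ?case by simp
next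
  case (Suc m \<phi>)
  interpret prob_space M using prob_HD(1)[OF M] .
  note [measurable] = Suc.prems measurable_fst_H[OF M]
  have m1: "(\<lambda>X. \<integral>\<^sup>+h. \<phi> (fst h ** X) \<partial>M) \<in> borel_measurable borel" by measurable
  have m2: "(\<lambda>Z. \<phi> (Z ** X)) \<in> borel_measurable borel" for X :: "'n mat" by measurable
  have "(\<integral>\<^sup>+X. \<phi> X \<partial>law M (Suc m + n)) = (\<integral>\<^sup>+X. (\<integral>\<^sup>+h. \<phi> (fst h ** X) \<partial>M) \<partial>law M (m + n))"
    using law_Suc[OF M Suc.prems, of "m + n"] by simp
  also have "\<dots> = (\<integral>\<^sup>+X. (\<integral>\<^sup>+Y. (\<integral>\<^sup>+h. \<phi> (fst h ** (Y ** X)) \<partial>M) \<partial>law M m) \<partial>law M n)"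
    by (rule Suc.IH[OF m1])
  also have "\<dots> = (\<integral>\<^sup>+X. (\<integral>\<^sup>+Y. \<phi> (Y ** X) \<partial>law M (Suc m)) \<partial>law M n)"
    unfolding law_Suc[OF M m2] by (simp only: matrix_mul_assoc)
  finally show ?case .
qed

lemma law_1:
  assumes M: "prob_H M" and \<phi>: "\<phi> \<in> borel_measurable borel"
  shows "(\<integral>\<^sup>+X. \<phi> X \<partial>law M (Suc 0)) = (\<integral>\<^sup>+h. \<phi> (fst h) \<partial>M)"
proof -
  interpret prob_space M using prob_HD(1)[OF M] .
  note [measurable] = \<phi> measurable_fst_H[OF M]
  have "(\<lambda>X. \<integral>\<^sup>+h. \<phi> (fst h ** X) \<partial>M) \<in> borel_measurable borel" by measurable
  then show ?thesis unfolding law_Suc[OF M \<phi>] by (subst law_0[OF M]) auto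
qed

lemma AE_law_Gset:
  fixes M :: "'n::finite aff measure"
  assumes M: "prob_H M"
  shows "AE X in law M n. X \<in> Gset"
proof (induction n)
  case 0
  have "emeasure (law M 0) (- Gset) = (\<integral>\<^sup>+X. indicator (- Gset) X \<partial>law M 0)"
    by (rule nn_integral_indicator[symmetric]) (simp add: open_Gset borel_open)
  also have "\<dots> = indicator (- Gset) (mat 1 :: 'n mat)"
    by (rule law_0[OF M]) (simp add: open_Gset borel_open)
  finally have "emeasure (law M 0) (- Gset) = 0" by (simp add: Gset_iff_det)
  then show ?case by (intro AE_I[of _ _ "- Gset"]) (auto simp: open_Gset borel_open)
next
  case (Suc n)
  have "emeasure (law M (Suc n)) (- Gset) = (\<integral>\<^sup>+X. indicator (- Gset) X \<partial>law M (Suc n))"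
    by (rule nn_integral_indicator[symmetric]) (simp add: open_Gset borel_open)
  also have "\<dots> = (\<integral>\<^sup>+X. (\<integral>\<^sup>+h. indicator (- Gset) (fst h ** X) \<partial>M) \<partial>law M n)"
    by (rule law_Suc[OF M]) (simp add: open_Gset borel_open)
  also have "\<dots> = (\<integral>\<^sup>+X. 0 \<partial>law M n)"
  proof (rule nn_integral_cong_AE)
    show "AE X in law M n. (\<integral>\<^sup>+h. indicator (- Gset) (fst h ** X) \<partial>M) = 0"
      using Suc
    proof (rule AE_mp, intro AE_I2 impI)
      fix X :: "'n mat" assume X: "X \<in> Gset"
      have "(\<integral>\<^sup>+h. indicator (- Gset) (fst h ** X) \<partial>M) = (\<integral>\<^sup>+h. 0 \<partial>M)"
      proof (rule nn_integral_cong_AE)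
        show "AE h in M. indicator (- Gset) (fst h ** X) = (0 :: ennreal)"
          using AE_Gset[OF M] by eventually_elim (simp add: Gset_mult X)
      qed
      then show "(\<integral>\<^sup>+h. indicator (- Gset) (fst h ** X) \<partial>M) = (0 :: ennreal)" by simp
    qed
  qed
  finally have "emeasure (law M (Suc n)) (- Gset) = 0" by simp
  then show ?case by (intro AE_I[of _ _ "- Gset"]) (auto simp: open_Gset borel_open)
qed

text \<open>An infinite moment would become 0 here; under \<open>moments_H\<close> and s \<ge> 0
  there is none (\<open>moment_S_finite\<close>).\<close>

definition mom :: "'n::finite aff measure \<Rightarrow> real \<Rightarrow> nat \<Rightarrow> real" where
  "mom M s n = enn2real (moment_S M s n)"

text \<open>Outside \<open>Gset\<close> the value of \<open>matrix_inv\<close> is unspecified, so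
  measurability is read off from \<open>moments_H\<close> with exponent 1 and not from
  continuity.\<close>

lemma measurable_gamma_H:
  assumes "prob_H M" "moments_H M"
  shows "(\<lambda>h. gamma (fst h)) \<in> borel_measurable M"
proof -
  have "(\<lambda>h. gamma (fst h) ^ 1 + norm (snd h) ^ 1) \<in> borel_measurable M"
    using assms(2) unfolding moments_H_def by blast
  moreover have "(\<lambda>h. norm (snd h) ^ 1) \<in> borel_measurable M"
    using prob_HD(2)[OF assms(1)]
    by (auto cong: measurable_cong_sets intro!: borel_measurable_continuous_onI continuous_intros)
  ultimately have "(\<lambda>h. (gamma (fst h) ^ 1 + norm (snd h) ^ 1) - norm (snd h) ^ 1) \<in> borel_measurable M"
    by (rule borel_measurable_diff)
  then show ?thesis by simp
qed

lemma powr_le_moment: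
  assumes "g \<in> Gset" "0 \<le> s" "s \<le> real k"
  shows "opnorm g powr s \<le> gamma g ^ k"
proof -
  have "opnorm g powr s \<le> gamma g powr s" using assms opnorm_le_gamma by (intro powr_mono2) auto
  also have "\<dots> \<le> gamma g powr k" using assms gamma_ge_1 by (intro powr_mono) auto
  also have "\<dots> = gamma g ^ k" using gamma_ge_1[OF assms(1)] by (intro powr_realpow) simp
  finally show ?thesis .
qed

lemma moment_S_add:
  assumes M: "prob_H M" and s: "0 \<le> s"
  shows "moment_S M s (m + n) \<le> moment_S M s m * moment_S M s n"
proof -
  have "moment_S M s (m + n) = (\<integral>\<^sup>+X. (\<integral>\<^sup>+Y. ennreal (opnorm (Y ** X) powr s) \<partial>law M m) \<partial>law M n)"
    unfolding moment_S_law[OF M] by (rule law_add[OF M]) simp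
  also have "\<dots> \<le> (\<integral>\<^sup>+X. (\<integral>\<^sup>+Y. ennreal (opnorm Y powr s) * ennreal (opnorm X powr s) \<partial>law M m) \<partial>law M n)"
    using s by (intro nn_integral_mono)
      (auto simp: ennreal_mult[symmetric] powr_mult[symmetric] intro!: ennreal_leI powr_mono2 opnorm_mult)
  also have "\<dots> = moment_S M s m * moment_S M s n"
    unfolding moment_S_law[OF M] by (simp add: nn_integral_multc nn_integral_cmult)
  finally show ?thesis .
qed

lemma moment_S_0: "prob_H M \<Longrightarrow> moment_S M s 0 = 1"
  unfolding moment_S_law by (subst law_0) auto

lemma moment_S_1: "prob_H M \<Longrightarrow> moment_S M s (Suc 0) = (\<integral>\<^sup>+h. ennreal (opnorm (fst h) powr s) \<partial>M)"
  unfolding moment_S_law by (rule law_1) auto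

lemma moment_S_finite:
  assumes M: "prob_H M" "moments_H M" and s: "0 \<le> s"
  shows "moment_S M s n < \<infinity>"
proof (induction n)
  case 0
  then show ?case by (simp add: moment_S_0[OF M(1)])
next
  case (Suc n)
  obtain k where k: "s \<le> real k" using real_arch_simple by blast
  have "moment_S M s (Suc 0) \<le> (\<integral>\<^sup>+h. ennreal (gamma (fst h) ^ k + norm (snd h) ^ k) \<partial>M)"
    unfolding moment_S_1[OF M(1)]
  proof (rule nn_integral_mono_AE)
    show "AE h in M. ennreal (opnorm (fst h) powr s) \<le> ennreal (gamma (fst h) ^ k + norm (snd h) ^ k)"
      using AE_Gset[OF M(1)]
    proof (rule AE_mp, intro AE_I2 impI)
      fix h :: "'a aff" assume "fst h \<in> Gset"
      from powr_le_moment[OF this s k] show "ennreal (opnorm (fst h) powr s) \<le> ennreal (gamma (fst h) ^ k + norm (snd h) ^ k)"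
        by (intro ennreal_leI) (simp add: add_increasing2)
    qed
  qed
  also have "\<dots> < \<infinity>"
    using M(2) by (simp add: moments_H_def integrable_iff_bounded)
  finally have "moment_S M s (Suc 0) < \<infinity>" .
  moreover have "moment_S M s (Suc n) \<le> moment_S M s (Suc 0) * moment_S M s n"
    using moment_S_add[OF M(1) s, of "Suc 0" n] by simp
  ultimately show ?case using Suc by (auto simp: ennreal_mult_less_top elim!: order_le_less_trans)
qed

lemma moment_S_eq_mom:
  "prob_H M \<Longrightarrow> moments_H M \<Longrightarrow> 0 \<le> s \<Longrightarrow> moment_S M s n = ennreal (mom M s n)"
  unfolding mom_def using moment_S_finite by (metis ennreal_enn2real infinity_ennreal_def)

lemma mom_nonneg [simp]: "0 \<le> mom M s n" by (simp add: mom_def)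

lemma mom_0: "prob_H M \<Longrightarrow> mom M s 0 = 1" by (simp add: mom_def moment_S_0)

lemma mom_add:
  assumes M: "prob_H M" "moments_H M" and s: "0 \<le> s"
  shows "mom M s (m + n) \<le> mom M s m * mom M s n"
  using moment_S_add[OF M(1) s, of m n]
  unfolding moment_S_eq_mom[OF M s] by (simp add: ennreal_mult[symmetric])

lemma law_integrable:
  assumes M: "prob_H M" "moments_H M" and s: "0 \<le> s"
  shows "integrable (law M n) (\<lambda>X. opnorm X powr s)" "(\<integral>X. opnorm X powr s \<partial>law M n) = mom M s n"
proof -
  show "integrable (law M n) (\<lambda>X. opnorm X powr s)"
    using moment_S_finite[OF M s, of n] unfolding moment_S_law[OF M(1)]
    by (intro integrableI_nonneg) auto
  show "(\<integral>X. opnorm X powr s \<partial>law M n) = mom M s n"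
    unfolding mom_def moment_S_law[OF M(1)] by (intro integral_eq_nn_integral) auto
qed

text \<open>One more factor shrinks |X|^s at most by gamma^(-s), whose mean q is positive because
  gamma is finite. The geometric bound is the linear lower bound on logarithms that
  \<open>fekete\<close> requires.\<close>

lemma mom_lower:
  fixes M :: "'n::finite aff measure"
  assumes M: "prob_H M" "moments_H M" and s: "0 \<le> s"
  shows "\<exists>q>0. \<forall>n. q ^ n \<le> mom M s n"
proof -
  interpret prob_space M using prob_HD(1)[OF M(1)] .
  note [measurable] = measurable_gamma_H[OF M] measurable_fst_H[OF M(1)]
  define Q where "Q = (\<integral>\<^sup>+h. ennreal (gamma (fst h) powr (- s)) \<partial>M)"
  have "Q \<noteq> 0"
  proof
    assume "Q = 0"
    then have 1: "AE h in M. ennreal (gamma (fst h) powr (- s)) = 0"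
      unfolding Q_def by (subst (asm) nn_integral_0_iff_AE) auto
    from 1 AE_Gset[OF M(1)] have "AE h in M. False"
    proof eventually_elim
      case (elim h)
      then show False using gamma_ge_1[of "fst h"] by (simp add: powr_def)
    qed
    then show False by simp
  qed
  have "Q \<le> (\<integral>\<^sup>+h. 1 \<partial>M)" unfolding Q_def
  proof (rule nn_integral_mono_AE)
    show "AE h in M. ennreal (gamma (fst h) powr (- s)) \<le> 1"
      using AE_Gset[OF M(1)]
    proof (rule AE_mp, intro AE_I2 impI)
      fix h :: "'n aff" assume "fst h \<in> Gset"
      then have "gamma (fst h) powr (- s) \<le> gamma (fst h) powr 0"
        using s gamma_ge_1 by (intro powr_mono) auto
      then show "ennreal (gamma (fst h) powr (- s)) \<le> 1"
        using gamma_ge_1[OF \<open>fst h \<in> Gset\<close>] by simp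
    qed
  qed
  then have "Q \<le> 1" by (simp add: emeasure_space_1)
  define q where "q = enn2real Q"
  have Q: "Q = ennreal q" unfolding q_def using \<open>Q \<le> 1\<close> by (auto simp: ennreal_enn2real_if top_unique)
  have q: "q > 0" using \<open>Q \<noteq> 0\<close> unfolding Q by (simp add: not_le[symmetric] ennreal_eq_0_iff)
  have step: "q * mom M s n \<le> mom M s (Suc n)" for n
  proof -
    have "ennreal (q * mom M s n) = Q * moment_S M s n"
      using q by (simp add: Q moment_S_eq_mom[OF M s] ennreal_mult)
    also have "\<dots> = (\<integral>\<^sup>+X. (\<integral>\<^sup>+h. ennreal (gamma (fst h) powr (- s)) * ennreal (opnorm X powr s) \<partial>M) \<partial>law M n)"
      unfolding Q_def moment_S_law[OF M(1)] by (simp add: nn_integral_multc nn_integral_cmult)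
    also have "\<dots> \<le> (\<integral>\<^sup>+X. (\<integral>\<^sup>+h. ennreal (opnorm (fst h ** X) powr s) \<partial>M) \<partial>law M n)"
    proof (rule nn_integral_mono, rule nn_integral_mono_AE)
      fix X :: "'n mat"
      show "AE h in M. ennreal (gamma (fst h) powr (- s)) * ennreal (opnorm X powr s) \<le> ennreal (opnorm (fst h ** X) powr s)"
        using AE_Gset[OF M(1)]
      proof (rule AE_mp, intro AE_I2 impI)
        fix h :: "'n aff" assume h: "fst h \<in> Gset"
        have g1: "gamma (fst h) > 0" using gamma_ge_1[OF h] by simp
        have "opnorm X \<le> gamma (fst h) * opnorm (fst h ** X)"
          using opnorm_mult_ge[OF h, of X]
          by (rule order_trans) (auto intro!: mult_right_mono simp: gamma_def)
        then have "opnorm X powr s \<le> (gamma (fst h) * opnorm (fst h ** X)) powr s"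
          using s by (intro powr_mono2) auto
        also have "\<dots> = gamma (fst h) powr s * opnorm (fst h ** X) powr s" by (simp add: powr_mult)
        finally have "gamma (fst h) powr (- s) * opnorm X powr s \<le> opnorm (fst h ** X) powr s"
          using g1 by (simp add: powr_minus field_simps)
        then show "ennreal (gamma (fst h) powr (- s)) * ennreal (opnorm X powr s) \<le> ennreal (opnorm (fst h ** X) powr s)"
          by (simp add: ennreal_mult[symmetric] ennreal_leI)
      qed
    qed
    also have "\<dots> = moment_S M s (Suc n)"
      unfolding moment_S_law[OF M(1)] by (rule law_Suc[OF M(1), symmetric]) simp
    finally show ?thesis unfolding moment_S_eq_mom[OF M s] by simp
  qed
  have "q ^ n \<le> mom M s n" for n
  proof (induction n)
    case 0
    then show ?case by (simp add: mom_0[OF M(1)])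
  next
    case (Suc n)
    have "q ^ Suc n \<le> q * mom M s n" using Suc q by simp
    then show ?case using step[of n] by linarith
  qed
  then show ?thesis using q by blast
qed

lemma mom_pos: "prob_H M \<Longrightarrow> moments_H M \<Longrightarrow> 0 \<le> s \<Longrightarrow> 0 < mom M s n"
  using mom_lower by (metis zero_less_power order_less_le_trans)

text \<open>Hoelder's inequality, obtained by normalising |X|^s and |X|^t by their means and
  integrating Young's inequality; this includes the degenerate weights u = 0 and v = 0.\<close>

lemma mom_log_convex:
  assumes M: "prob_H M" "moments_H M" and s: "0 \<le> s" "0 \<le> t" and u: "0 \<le> u" "0 \<le> v" "u + v = 1"
  shows "mom M (u * s + v * t) n \<le> mom M s n powr u * mom M t n powr v"
proof -
  let ?A = "mom M s n" and ?B = "mom M t n" and ?w = "u * s + v * t"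
  have A: "?A > 0" "?B > 0" using mom_pos[OF M] s by auto
  have w: "0 \<le> ?w" using s u by simp
  have "mom M ?w n = (\<integral>X. opnorm X powr ?w \<partial>law M n)" using law_integrable(2)[OF M w] by simp
  also have "\<dots> \<le> (\<integral>X. ?A powr u * ?B powr v * (u * (opnorm X powr s / ?A) + v * (opnorm X powr t / ?B)) \<partial>law M n)"
  proof (rule integral_mono_AE)
    show "AE X in law M n. opnorm X powr ?w \<le> ?A powr u * ?B powr v * (u * (opnorm X powr s / ?A) + v * (opnorm X powr t / ?B))"
      using AE_law_Gset[OF M(1)]
    proof (rule AE_mp, intro AE_I2 impI)
      fix X :: "'a mat" assume "X \<in> Gset"
      then have X: "opnorm X > 0" by (rule opnorm_pos)
      have "opnorm X powr ?w = (opnorm X powr s) powr u * (opnorm X powr t) powr v"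
        by (simp add: powr_powr powr_add mult.commute)
      also have "\<dots> = ?A powr u * ?B powr v * ((opnorm X powr s / ?A) powr u * (opnorm X powr t / ?B) powr v)"
        using A X by (simp add: powr_divide)
      also have "\<dots> \<le> ?A powr u * ?B powr v * (u * (opnorm X powr s / ?A) + v * (opnorm X powr t / ?B))"
        using A X u by (intro mult_left_mono Youngs_inequality_0) auto
      finally show "opnorm X powr ?w \<le> ?A powr u * ?B powr v * (u * (opnorm X powr s / ?A) + v * (opnorm X powr t / ?B))" .
    qed
  qed (auto intro!: integrable_mult_right Bochner_Integration.integrable_add integrable_divide law_integrable(1)[OF M] s w)
  also have "\<dots> = ?A powr u * ?B powr v * (u * (?A / ?A) + v * (?B / ?B))"
    using law_integrable[OF M s(1), of n] law_integrable[OF M s(2), of n] by simp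
  also have "\<dots> = ?A powr u * ?B powr v" using A u by simp
  finally show ?thesis .
qed

section \<open>Fekete's lemma and the logarithm of k\<close>

lemma fekete:
  fixes u :: "nat \<Rightarrow> real"
  assumes sub: "\<And>m n. u (m + n) \<le> u m + u n" and low: "\<And>n. u n \<ge> c * real n"
  shows "\<exists>L. (\<lambda>n. u n / n) \<longlonglongrightarrow> L \<and> (\<forall>n>0. L \<le> u n / n)"
proof -
  define L where "L = (INF n\<in>{0<..}. u n / n)"
  have bdd: "bdd_below ((\<lambda>n. u n / n) ` {0<..})"
    by (rule bdd_belowI[of _ c]) (use low in \<open>auto simp: field_simps\<close>)
  have L: "L \<le> u n / n" if "n > 0" for n
    unfolding L_def using that by (intro cINF_lower bdd) auto
  have mul: "u (q * m + r) \<le> real q * u m + u r" for q m r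
  proof (induction q)
    case (Suc q)
    have "u (Suc q * m + r) = u (m + (q * m + r))" by (simp add: algebra_simps)
    also have "\<dots> \<le> u m + u (q * m + r)" by (rule sub)
    finally show ?case using Suc by (simp add: algebra_simps)
  qed simp
  have "(\<lambda>n. u n / n) \<longlonglongrightarrow> L"
  proof (rule LIMSEQ_I)
    fix r :: real assume r: "0 < r"
    have "\<exists>x\<in>(\<lambda>n. u n / n) ` {0<..}. x < L + r / 2"
      using r unfolding L_def by (intro cInf_lessD) auto
    then obtain m where m: "m > 0" "u m / m < L + r / 2" by auto
    define C where "C = \<bar>u m\<bar> + (\<Sum>i<m. \<bar>u i\<bar>)"
    obtain N :: nat where N: "2 * C / r < real N" using reals_Archimedean2 by blast
    have "norm (u n / n - L) < r" if n: "n \<ge> N" "n > 0" for n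
    proof -
      define q i where "q = n div m" and "i = n mod m"
      have ni: "n = q * m + i" "i < m" using m by (auto simp: q_def i_def)
      have rn: "real n = real q * real m + real i" using ni(1) by (metis of_nat_add of_nat_mult)
      have qu: "real q * u m = real n * (u m / m) - real i * (u m / m)"
        using m(1) by (simp add: rn field_simps)
      have "\<bar>real i * (u m / m)\<bar> = (real i / m) * \<bar>u m\<bar>" by (simp add: abs_mult)
      also have "\<dots> \<le> 1 * \<bar>u m\<bar>" using ni(2) m(1) by (intro mult_right_mono) auto
      finally have 1: "\<bar>real i * (u m / m)\<bar> \<le> \<bar>u m\<bar>" by simp
      have 2: "\<bar>u i\<bar> \<le> (\<Sum>i<m. \<bar>u i\<bar>)" using ni(2) by (intro member_le_sum) auto
      have "u n \<le> real q * u m + u i" using mul[of q m i] ni(1) by simp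
      also have "\<dots> \<le> real n * (u m / m) + C" unfolding qu C_def using 1 2 by linarith
      finally have "u n / n \<le> u m / m + C / n" using n(2) by (simp add: field_simps)
      moreover have "C / n < r / 2"
      proof -
        have "2 * C / r < real n" using N n(1) by linarith
        then show ?thesis using r n(2) by (simp add: field_simps)
      qed
      ultimately have "u n / n < L + r" using m(2) by linarith
      then show ?thesis using L[OF n(2)] r unfolding real_norm_def by linarith
    qed
    then show "\<exists>no. \<forall>n\<ge>no. norm (u n / n - L) < r" by (intro exI[of _ "Suc N"]) auto
  qed
  then show ?thesis using L by blast
qed

definition log_k :: "'n::finite aff measure \<Rightarrow> real \<Rightarrow> real" where
  "log_k M s = lim (\<lambda>n. ln (mom M s n) / n)"

lemma log_k:
  assumes M: "prob_H M" "moments_H M" and s: "0 \<le> s"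
  shows "(\<lambda>n. ln (mom M s n) / n) \<longlonglongrightarrow> log_k M s" "n > 0 \<Longrightarrow> log_k M s \<le> ln (mom M s n) / n"
proof -
  obtain q where q: "q > 0" "\<And>n. q ^ n \<le> mom M s n" using mom_lower[OF M s] by blast
  note p = mom_pos[OF M s]
  have "ln (mom M s (m + n)) \<le> ln (mom M s m) + ln (mom M s n)" for m n
  proof -
    have "ln (mom M s (m + n)) \<le> ln (mom M s m * mom M s n)"
      using mom_add[OF M s, of m n] p by (intro ln_mono) auto
    also have "\<dots> = ln (mom M s m) + ln (mom M s n)" using p by (intro ln_mult_pos)
    finally show ?thesis .
  qed
  moreover have "ln (mom M s n) \<ge> ln q * real n" for n
  proof -
    have "ln q * real n = ln (q ^ n)" using q(1) by (simp add: ln_realpow)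
    then show ?thesis using q p[of n] by simp
  qed
  ultimately obtain L where L: "(\<lambda>n. ln (mom M s n) / n) \<longlonglongrightarrow> L" "\<forall>n>0. L \<le> ln (mom M s n) / n"
    using fekete[of "\<lambda>n. ln (mom M s n)" "ln q"] by blast
  moreover have "log_k M s = L" unfolding log_k_def using L(1) by (rule limI)
  ultimately show "(\<lambda>n. ln (mom M s n) / n) \<longlonglongrightarrow> log_k M s" "n > 0 \<Longrightarrow> log_k M s \<le> ln (mom M s n) / n" by auto
qed

lemma k_eq_1_iff:
  assumes M: "prob_H M" "moments_H M" and s: "0 \<le> s"
  shows "k_eq_1 M s \<longleftrightarrow> log_k M s = 0"
proof -
  have e: "\<forall>\<^sub>F n in sequentially. exp (ln (mom M s n) / n) = root n (enn2real (moment_S M s n))"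
    using eventually_gt_at_top[of 0]
  proof eventually_elim
    case (elim n)
    then have "root n (mom M s n) = mom M s n powr (1 / n)"
      using mom_pos[OF M s, of n] by (simp add: root_powr_inverse)
    then show ?case using mom_pos[OF M s, of n] by (simp add: powr_def mom_def)
  qed
  have "(\<lambda>n. exp (ln (mom M s n) / n)) \<longlonglongrightarrow> exp (log_k M s)"
    by (intro tendsto_intros log_k[OF M s])
  then have l: "(\<lambda>n. root n (enn2real (moment_S M s n))) \<longlonglongrightarrow> exp (log_k M s)"
    using e by (rule Lim_transform_eventually)
  show ?thesis unfolding k_eq_1_def
  proof
    assume "(\<lambda>n. root n (enn2real (moment_S M s n))) \<longlonglongrightarrow> 1"
    then have "exp (log_k M s) = 1" using l LIMSEQ_unique by blast
    then show "log_k M s = 0" by simp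
  qed (use l in simp)
qed

lemma log_k_convex:
  assumes M: "prob_H M" "moments_H M"
  shows "convex_on {0<..} (log_k M)"
proof (rule convex_onI)
  fix v x y :: real assume v: "0 < v" "v < 1" and x: "x \<in> {0<..}" "y \<in> {0<..}"
  let ?z = "(1 - v) * x + v * y"
  have z: "0 \<le> ?z" using v x by simp
  have le: "ln (mom M ?z n) / n \<le> (1 - v) * (ln (mom M x n) / n) + v * (ln (mom M y n) / n)" for n
  proof -
    have p: "mom M x n > 0" "mom M y n > 0" "mom M ?z n > 0" using mom_pos[OF M] x z by auto
    have "mom M ?z n \<le> mom M x n powr (1 - v) * mom M y n powr v"
      using v x by (intro mom_log_convex[OF M]) auto
    then have "ln (mom M ?z n) \<le> ln (mom M x n powr (1 - v) * mom M y n powr v)"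
      using p by (intro ln_mono) auto
    also have "\<dots> = (1 - v) * ln (mom M x n) + v * ln (mom M y n)"
      using p by (simp add: ln_mult ln_powr)
    finally have "ln (mom M ?z n) / n \<le> ((1 - v) * ln (mom M x n) + v * ln (mom M y n)) / n"
      by (intro divide_right_mono) auto
    then show ?thesis by (simp add: add_divide_distrib)
  qed
  have "(\<lambda>n. (1 - v) * (ln (mom M x n) / n) + v * (ln (mom M y n) / n)) \<longlonglongrightarrow> (1 - v) * log_k M x + v * log_k M y"
    using x by (intro tendsto_intros log_k(1)[OF M]) auto
  from LIMSEQ_le[OF log_k(1)[OF M z] this]
  have "log_k M ?z \<le> (1 - v) * log_k M x + v * log_k M y" using le by blast
  then show "log_k M ((1 - v) *\<^sub>R x + v *\<^sub>R y) \<le> (1 - v) * log_k M x + v * log_k M y" by simp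
qed (simp add: convex_real_interval)

text \<open>A convex function on an open interval is continuous, so the intermediate value theorem
  applies to \<open>log_k\<close>.\<close>

lemma log_k_zero_exists:
  assumes M: "prob_H M" "moments_H M" and s: "0 < s" "s < t" and k: "log_k M s < 0" "0 < log_k M t"
  shows "\<exists>\<alpha>>0. k_eq_1 M \<alpha>"
proof -
  have "continuous_on {0<..} (log_k M)" using log_k_convex[OF M] by (intro convex_on_continuous) auto
  then have "continuous_on {s..t} (log_k M)" by (rule continuous_on_subset) (use s in auto)
  then obtain \<alpha> where "s \<le> \<alpha>" "\<alpha> \<le> t" "log_k M \<alpha> = 0"
    using IVT'[of "log_k M" s 0 t] k s by auto
  then show ?thesis using k_eq_1_iff[OF M, of \<alpha>] s by (intro exI[of _ \<alpha>]) auto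
qed

text \<open>The sequence c a_m(s) is supermultiplicative, so its m-th roots bound k(s) from below,
  as the roots of a_m(s) do from above in \<open>log_k\<close>. A single moment now certifies k(s) >
  1.\<close>

lemma log_k_ge:
  assumes M: "prob_H M" "moments_H M" and s: "0 \<le> s" and c: "0 < c"
    and sup: "\<And>i j. c * mom M s i * mom M s j \<le> mom M s (i + j)" and m: "m > 0"
  shows "ln (c * mom M s m) / m \<le> log_k M s"
proof -
  note p = mom_pos[OF M s]
  \<comment> \<open>Stated for \<open>Suc j\<close> because exponent 0 would amount to 1 \<le>
    c.\<close>
  have 1: "(c * mom M s m) ^ Suc j \<le> c * mom M s (Suc j * m)" for j
  proof (induction j)
    case (Suc j)
    have "(c * mom M s m) ^ Suc (Suc j) = (c * mom M s m) * (c * mom M s m) ^ Suc j" by simp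
    also have "\<dots> \<le> (c * mom M s m) * (c * mom M s (Suc j * m))"
      using Suc c by (intro mult_left_mono) auto
    also have "\<dots> = c * (c * mom M s m * mom M s (Suc j * m))" by simp
    also have "\<dots> \<le> c * mom M s (m + Suc j * m)" using c by (intro mult_left_mono sup) auto
    finally show ?case by simp
  qed simp
  have 2: "ln (c * mom M s m) / m - ln c / (real (Suc j) * m) \<le> ln (mom M s (Suc j * m)) / real (Suc j * m)" for j
  proof -
    have "real (Suc j) * ln (c * mom M s m) = ln ((c * mom M s m) ^ Suc j)"
      using c p[of m] by (subst ln_realpow) auto
    also have "\<dots> \<le> ln (c * mom M s (Suc j * m))"
      using 1[of j] c p by (intro ln_mono) auto
    also have "\<dots> = ln c + ln (mom M s (Suc j * m))" using c p by (intro ln_mult_pos)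
    finally have "real (Suc j) * ln (c * mom M s m) - ln c \<le> ln (mom M s (Suc j * m))" by simp
    then have "(real (Suc j) * ln (c * mom M s m) - ln c) / (real (Suc j) * m) \<le> ln (mom M s (Suc j * m)) / (real (Suc j) * m)"
      by (intro divide_right_mono) auto
    then show ?thesis using m by (simp add: diff_divide_distrib del: of_nat_Suc mult_Suc) 
  qed
  have "strict_mono (\<lambda>j. Suc j * m)" using m by (intro strict_monoI) (auto intro: mult_strict_right_mono)
  from LIMSEQ_subseq_LIMSEQ[OF log_k(1)[OF M s] this]
  have l1: "(\<lambda>j. ln (mom M s (Suc j * m)) / real (Suc j * m)) \<longlonglongrightarrow> log_k M s" by (simp only: o_def)
  have "(\<lambda>j. ln c / m * (1 / real (Suc j))) \<longlonglongrightarrow> ln c / m * 0"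
    by (intro tendsto_mult tendsto_const LIMSEQ_Suc[OF lim_1_over_n])
  then have "(\<lambda>j. ln (c * mom M s m) / m - ln c / m * (1 / real (Suc j))) \<longlonglongrightarrow> ln (c * mom M s m) / m - 0"
    by (intro tendsto_diff tendsto_const) simp
  then have l2: "(\<lambda>j. ln (c * mom M s m) / m - ln c / (real (Suc j) * m)) \<longlonglongrightarrow> ln (c * mom M s m) / m"
    by (simp add: mult.commute del: of_nat_Suc)
  show ?thesis by (rule LIMSEQ_le[OF l2 l1]) (use 2 in blast)
qed

subsection \<open>Continuity of the moments\<close>

text \<open>For s \<le> 1 this is subadditivity of the power, for s > 1 the mean value theorem with
  the intermediate point bounded by a + b. The factor s + 1 dominates both constants, 1 and
  s.\<close>

lemma powr_diff_le:
  fixes a b s :: real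
  assumes "0 \<le> a" "0 \<le> b" "0 < s"
  shows "\<bar>a powr s - b powr s\<bar> \<le> (s + 1) * ((a + b) powr (s - min 1 s) * \<bar>a - b\<bar> powr min 1 s)"
proof -
  have *: "a powr s - b powr s \<le> (s + 1) * ((a + b) powr (s - min 1 s) * (a - b) powr min 1 s)"
    if ab: "0 \<le> b" "b < a" for a b :: real
  proof (cases "s \<le> 1")
    case True
    have 1: "t \<le> t powr s" if "0 \<le> t" "t \<le> 1" for t :: real
    proof (cases "t = 0")
      case False
      then have "t powr 1 \<le> t powr s" using that True by (intro powr_mono') auto
      then show ?thesis using that by simp
    qed simp
    have a: "a > 0" using ab by simp
    have "1 = b / a + (a - b) / a" using a by (simp add: field_simps)
    also have "\<dots> \<le> (b / a) powr s + ((a - b) / a) powr s"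
      using ab a by (intro add_mono 1) auto
    also have "\<dots> = (b powr s + (a - b) powr s) / a powr s"
      using ab a by (simp add: powr_divide add_divide_distrib)
    finally have "a powr s \<le> b powr s + (a - b) powr s" using a by (simp add: field_simps)
    moreover have "1 * (a - b) powr s \<le> (s + 1) * (a - b) powr s"
      using assms(3) by (intro mult_right_mono) auto
    ultimately have "a powr s - b powr s \<le> (s + 1) * (a - b) powr s" by simp
    then show ?thesis using True ab a by (simp add: min_absorb2)
  next
    case False
    have cont: "continuous_on {b..a} (\<lambda>x. x powr s)"
      using assms(3) ab by (intro continuous_on_powr' continuous_intros) auto
    have "\<exists>l z. b < z \<and> z < a \<and> ((\<lambda>x. x powr s) has_real_derivative l) (at z) \<and> a powr s - b powr s = (a - b) * l"
    proof (rule MVT[OF ab(2) cont])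
      fix x assume "b < x" "x < a"
      then have "x > 0" using ab by simp
      then show "(\<lambda>x. x powr s) differentiable (at x)"
        using has_real_derivative_powr[of x s] real_differentiable_def by blast
    qed
    then obtain l z where z: "b < z" "z < a" "((\<lambda>x. x powr s) has_real_derivative l) (at z)"
      "a powr s - b powr s = (a - b) * l" by blast
    have "z > 0" using z ab by simp
    then have "l = s * z powr (s - 1)" using DERIV_unique[OF z(3) has_real_derivative_powr] by blast
    also have "\<dots> \<le> (s + 1) * (a + b) powr (s - 1)"
      using z ab False by (intro mult_mono powr_mono2) auto
    finally have "(a - b) * l \<le> (a - b) * ((s + 1) * (a + b) powr (s - 1))"
      using ab by (intro mult_left_mono) auto
    then show ?thesis using z(4) False ab by (simp add: min_absorb1 mult_ac)
  qed
  show ?thesis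
  proof (cases a b rule: linorder_cases)
    case less
    then show ?thesis using *[of a b] assms powr_mono2[of s a b] by (simp add: add.commute abs_if)
  next
    case greater
    then show ?thesis using *[of b a] assms powr_mono2[of s b a] by (simp add: abs_if)
  qed (use assms in simp)
qed

text \<open>The modulus of continuity of |X|^s, of exponent min(1, s). It does not involve the law,
  so that bounds on the moments make the functions \<open>mom_at\<close> of all laws
  equicontinuous.\<close>

definition hoelder_modulus :: "real \<Rightarrow> 'n::finite mat \<Rightarrow> 'n mat \<Rightarrow> real" where
  "hoelder_modulus s X Y = (opnorm X + opnorm Y) powr (s - min 1 s) * opnorm (X - Y) powr min 1 s"

lemma hoelder_modulus_nonneg [simp]: "0 \<le> hoelder_modulus s X Y" by (simp add: hoelder_modulus_def)

lemma opnorm_powr_diff: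
  assumes "0 < s"
  shows "\<bar>opnorm (Y ** X) powr s - opnorm (Y ** X') powr s\<bar> \<le> (s + 1) * (opnorm Y powr s * hoelder_modulus s X X')"
proof -
  let ?a = "opnorm (Y ** X)" and ?b = "opnorm (Y ** X')" and ?t = "min 1 s"
  have 1: "?a + ?b \<le> opnorm Y * (opnorm X + opnorm X')"
    using opnorm_mult[of Y X] opnorm_mult[of Y X'] by (simp add: distrib_left)
  have "Y ** X - Y ** X' = Y ** (X - X')"
    by (simp add: matrix_matrix_mult_def vec_eq_iff sum_subtractf right_diff_distrib)
  then have 2: "\<bar>?a - ?b\<bar> \<le> opnorm Y * opnorm (X - X')"
    using opnorm_diff_le[of "Y ** X" "Y ** X'"] opnorm_mult[of Y "X - X'"] by simp
  have "\<bar>?a powr s - ?b powr s\<bar> \<le> (s + 1) * ((?a + ?b) powr (s - ?t) * \<bar>?a - ?b\<bar> powr ?t)"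
    using assms by (intro powr_diff_le) auto
  also have "\<dots> \<le> (s + 1) * ((opnorm Y * (opnorm X + opnorm X')) powr (s - ?t) * (opnorm Y * opnorm (X - X')) powr ?t)"
    using assms 1 2 by (intro mult_left_mono mult_mono powr_mono2) auto
  also have "\<dots> = (s + 1) * (opnorm Y powr s * hoelder_modulus s X X')"
  proof -
    have "opnorm Y powr (s - ?t) * opnorm Y powr ?t = opnorm Y powr s"
      by (simp add: powr_add[symmetric])
    then show ?thesis by (simp add: powr_mult hoelder_modulus_def mult_ac)
  qed
  finally show ?thesis .
qed

lemma continuous_if_hoelder_modulus:
  fixes f :: "'n::finite mat \<Rightarrow> real"
  assumes "0 < s" "\<And>X Y. \<bar>f X - f Y\<bar> \<le> C * hoelder_modulus s X Y"
  shows "continuous_on UNIV f"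
proof -
  have "(f \<longlongrightarrow> f X) (at X)" for X :: "'n mat"
  proof -
    have o: "(opnorm \<longlongrightarrow> opnorm X) (at X)"
      using continuous_opnorm[where 'n = 'n] by (simp add: continuous_on_def)
    have z: "((\<lambda>Y. opnorm (X - Y)) \<longlongrightarrow> 0) (at X)"
    proof -
      have "continuous_on UNIV (\<lambda>Y. opnorm (X - Y))" by (intro continuous_intros)
      then have "((\<lambda>Y. opnorm (X - Y)) \<longlongrightarrow> opnorm (X - X)) (at X)"
        unfolding continuous_on_def by blast
      then show ?thesis by simp
    qed
    obtain B where B: "B > 0" "opnorm X + opnorm X < B"
      by (rule that[of "opnorm X + opnorm X + 1"]) (auto simp: add_nonneg_pos)
    have ev: "\<forall>\<^sub>F Y in at X. opnorm X + opnorm Y < B"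
      using order_tendstoD(2)[OF tendsto_add[OF tendsto_const[of "opnorm X"] o] B(2)] by simp
    have "((\<lambda>Y. \<bar>C\<bar> * (B powr (s - min 1 s) * opnorm (X - Y) powr min 1 s)) \<longlongrightarrow>
         \<bar>C\<bar> * (B powr (s - min 1 s) * 0 powr min 1 s)) (at X)"
      using assms(1) by (intro tendsto_intros z tendsto_powr' ) auto
    then have "((\<lambda>Y. \<bar>C\<bar> * (B powr (s - min 1 s) * opnorm (X - Y) powr min 1 s)) \<longlongrightarrow> 0) (at X)" by simp
    moreover have "\<forall>\<^sub>F Y in at X. norm (f Y - f X) \<le> \<bar>C\<bar> * (B powr (s - min 1 s) * opnorm (X - Y) powr min 1 s)"
      using ev
    proof eventually_elim
      case (elim Y)
      have "\<bar>f X - f Y\<bar> \<le> \<bar>C\<bar> * hoelder_modulus s X Y"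
        using assms(2)[of X Y] by (rule order_trans) (intro mult_right_mono, auto)
      also have "\<dots> \<le> \<bar>C\<bar> * (B powr (s - min 1 s) * opnorm (X - Y) powr min 1 s)"
        unfolding hoelder_modulus_def using elim by (intro mult_left_mono mult_right_mono powr_mono2) auto
      finally show ?case by (simp add: abs_minus_commute)
    qed
    ultimately have "((\<lambda>Y. f Y - f X) \<longlongrightarrow> 0) (at X)" by (rule Lim_null_comparison[rotated])
    then show ?thesis using LIM_zero_iff by blast
  qed
  then show ?thesis by (simp add: continuous_on_def)
qed

text \<open>E |S_m X|^s. The starting matrix allows the first factor to be split off and absorbed
  into X (\<open>mom_at_Suc\<close>), which makes induction on m possible.\<close>

definition mom_at :: "'n::finite aff measure \<Rightarrow> real \<Rightarrow> nat \<Rightarrow> 'n mat \<Rightarrow> real" where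
  "mom_at M s m X = (\<integral>Y. opnorm (Y ** X) powr s \<partial>law M m)"

lemma mom_at_integrable:
  fixes X :: "'n::finite mat"
  assumes M: "prob_H M" "moments_H M" and s: "0 < s"
  shows "integrable (law M m) (\<lambda>Y. opnorm (Y ** X) powr s)"
proof (rule Bochner_Integration.integrable_bound)
  show "integrable (law M m) (\<lambda>Y. opnorm Y powr s * opnorm X powr s)"
    using law_integrable(1)[OF M, of s m] s by simp
  show "AE Y in law M m. norm (opnorm (Y ** X) powr s) \<le> norm (opnorm Y powr s * opnorm X powr s)"
    using s by (auto simp: powr_mult[symmetric] intro!: AE_I2 powr_mono2 opnorm_mult)
qed measurable

lemma mom_at_bounds:
  assumes M: "prob_H M" "moments_H M" and s: "0 < s"
  shows "0 \<le> mom_at M s m X" "mom_at M s m X \<le> mom M s m * opnorm X powr s"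
proof -
  show "0 \<le> mom_at M s m X" unfolding mom_at_def by (intro integral_nonneg_AE) auto
  have "mom_at M s m X \<le> (\<integral>Y. opnorm Y powr s * opnorm X powr s \<partial>law M m)"
    unfolding mom_at_def using s law_integrable(1)[OF M, of s m]
    by (intro integral_mono mom_at_integrable[OF M s] integrable_mult_left)
      (auto simp: powr_mult[symmetric] intro!: powr_mono2 opnorm_mult)
  then show "mom_at M s m X \<le> mom M s m * opnorm X powr s"
    using law_integrable(2)[OF M, of s m] s by simp
qed

lemma mom_at_hoelder_modulus:
  assumes M: "prob_H M" "moments_H M" and s: "0 < s"
  shows "\<bar>mom_at M s m X - mom_at M s m Y\<bar> \<le> ((s + 1) * mom M s m) * hoelder_modulus s X Y"
proof -
  note i = mom_at_integrable[OF M s, of m]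
  have "\<bar>mom_at M s m X - mom_at M s m Y\<bar> = \<bar>\<integral>Z. opnorm (Z ** X) powr s - opnorm (Z ** Y) powr s \<partial>law M m\<bar>"
    unfolding mom_at_def using i by simp
  also have "\<dots> \<le> (\<integral>Z. \<bar>opnorm (Z ** X) powr s - opnorm (Z ** Y) powr s\<bar> \<partial>law M m)"
    by (rule integral_abs_bound)
  also have "\<dots> \<le> (\<integral>Z. (s + 1) * (opnorm Z powr s * hoelder_modulus s X Y) \<partial>law M m)"
    using s law_integrable(1)[OF M, of s m] by (intro integral_mono integrable_abs Bochner_Integration.integrable_diff i opnorm_powr_diff) auto
  also have "\<dots> = ((s + 1) * mom M s m) * hoelder_modulus s X Y"
    using law_integrable(2)[OF M, of s m] s by simp
  finally show ?thesis .
qed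

lemma mom_at_continuous:
  assumes M: "prob_H M" "moments_H M" and s: "0 < s"
  shows "continuous_on UNIV (mom_at M s m)"
  using s mom_at_hoelder_modulus[OF M s] by (rule continuous_if_hoelder_modulus)

lemma mom_at_0: "prob_H M \<Longrightarrow> mom_at M s 0 X = opnorm X powr s"
proof -
  assume M: "prob_H M"
  have "mom_at M s 0 X = enn2real (\<integral>\<^sup>+Y. ennreal (opnorm (Y ** X) powr s) \<partial>law M 0)"
    unfolding mom_at_def by (intro integral_eq_nn_integral) auto
  also have "\<dots> = opnorm X powr s" by (subst law_0[OF M]) auto
  finally show ?thesis .
qed

lemma mom_at_mom: "prob_H M \<Longrightarrow> moments_H M \<Longrightarrow> 0 < s \<Longrightarrow> mom_at M s m (mat 1) = mom M s m"
  unfolding mom_at_def using law_integrable(2)[of M s m] by simp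

lemma mom_at_Suc:
  fixes M :: "'n::finite aff measure" and X :: "'n mat"
  assumes M: "prob_H M" "moments_H M" and s: "0 < s"
  shows "mom_at M s (Suc m) X = (\<integral>h. mom_at M s m (fst h ** X) \<partial>M)"
proof -
  have e: "(\<integral>\<^sup>+Y. ennreal (opnorm (Y ** X) powr s) \<partial>law M m) = ennreal (mom_at M s m X)" for m and X :: "'n mat"
    unfolding mom_at_def by (intro nn_integral_eq_integral mom_at_integrable[OF M s]) auto
  have meas: "(\<lambda>h. mom_at M s m (fst h ** X)) \<in> borel_measurable M"
    using measurable_fst_H[OF M(1)] borel_measurable_continuous_onI[OF mom_at_continuous[OF M s, of m]]
    by measurable
  have "ennreal (mom_at M s (Suc m) X) = (\<integral>\<^sup>+Z. (\<integral>\<^sup>+Y. ennreal (opnorm (Y ** Z ** X) powr s) \<partial>law M m) \<partial>law M (Suc 0))"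
    unfolding e[symmetric] using law_add[OF M(1), of "\<lambda>Y. ennreal (opnorm (Y ** X) powr s)" m "Suc 0"] by simp
  also have "\<dots> = (\<integral>\<^sup>+Z. ennreal (mom_at M s m (Z ** X)) \<partial>law M (Suc 0))"
    unfolding e[symmetric] by (simp add: matrix_mul_assoc)
  also have "\<dots> = (\<integral>\<^sup>+h. ennreal (mom_at M s m (fst h ** X)) \<partial>M)"
  proof (rule law_1[OF M(1)])
    have "continuous_on UNIV (\<lambda>Z. mom_at M s m (Z ** X))"
      by (intro continuous_on_compose2[OF mom_at_continuous[OF M s]] continuous_intros) auto
    then show "(\<lambda>Z. ennreal (mom_at M s m (Z ** X))) \<in> borel_measurable borel"
      by (intro measurable_compose_rev[OF measurable_ennreal] borel_measurable_continuous_onI)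
  qed
  finally have "mom_at M s (Suc m) X = enn2real (\<integral>\<^sup>+h. ennreal (mom_at M s m (fst h ** X)) \<partial>M)"
    using mom_at_bounds(1)[OF M s] by (metis enn2real_ennreal)
  also have "\<dots> = (\<integral>h. mom_at M s m (fst h ** X) \<partial>M)"
    using mom_at_bounds(1)[OF M s] meas by (intro integral_eq_nn_integral[symmetric]) auto
  finally show ?thesis .
qed

lemma opnorm_act_bound:
  assumes h: "h \<in> Hset" and s: "0 < s" "s \<le> real k" and C: "0 \<le> C"
  shows "C * opnorm (fst h ** X) powr s \<le> (C * opnorm X powr s) * (gamma (fst h) ^ k + norm (snd h) ^ k)"
proof -
  have "fst h \<in> Gset" using h by (auto simp: Hset_def)
  have "opnorm (fst h ** X) powr s \<le> (opnorm (fst h) * opnorm X) powr s"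
    using s by (intro powr_mono2 opnorm_mult) auto
  also have "\<dots> = opnorm X powr s * opnorm (fst h) powr s" by (simp add: powr_mult)
  also have "\<dots> \<le> opnorm X powr s * (gamma (fst h) ^ k + norm (snd h) ^ k)"
    using powr_le_moment[OF \<open>fst h \<in> Gset\<close>, of s k] s by (intro mult_left_mono) (auto intro: add_increasing2)
  finally show ?thesis using C by (simp add: mult_left_mono mult.assoc)
qed

text \<open>The s-th moment of one factor is dominated by the integral of gamma^k + |b|^k with an
  integer k \<ge> s, and these integrals converge along the sequence, hence are bounded.
  Submultiplicativity carries the bound to m factors.\<close>

lemma mom_uniform_bound:
  fixes M :: "'n::finite aff measure"
  assumes M: "prob_H M" "moments_H M" and Ms: "\<And>n. prob_H (Ms n)" "\<And>n. moments_H (Ms n)" and W: "W_conv Ms M"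
    and s: "0 < s"
  shows "\<exists>A\<ge>0. mom M s m \<le> A \<and> (\<forall>n. mom (Ms n) s m \<le> A)"
proof -
  obtain k where k: "s \<le> real k" using real_arch_simple by blast
  have a1: "mom N s (Suc 0) \<le> (\<integral>h. gamma (fst h) ^ k + norm (snd h) ^ k \<partial>N)" if N: "prob_H N" "moments_H N" for N :: "'n aff measure"
  proof -
    have c: "continuous_on UNIV (\<lambda>h. mom_at N s 0 (fst h ** mat 1))"
      by (intro continuous_on_compose2[OF mom_at_continuous[OF N s]] continuous_intros) auto
    have b: "\<bar>mom_at N s 0 (fst h ** mat 1)\<bar> \<le> 1 * (gamma (fst h) ^ k + norm (snd h) ^ k)" if "h \<in> Hset" for h
      using opnorm_act_bound[OF that s k, of 1 "mat 1"] by (simp add: mom_at_0[OF N(1)])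
    have "mom N s (Suc 0) = (\<integral>h. mom_at N s 0 (fst h ** mat 1) \<partial>N)"
      using mom_at_Suc[OF N s, of 0 "mat 1"] mom_at_mom[OF N s] by simp
    also have "\<dots> \<le> (\<integral>h. gamma (fst h) ^ k + norm (snd h) ^ k \<partial>N)"
    proof (rule integral_mono_AE)
      show "integrable N (\<lambda>h. mom_at N s 0 (fst h ** mat 1))"
        using integrable_moment[OF N borel_measurable_continuous_onI[OF c] b] .
      show "integrable N (\<lambda>h. gamma (fst h) ^ k + norm (snd h) ^ k)" using N(2) by (simp add: moments_H_def)
      show "AE h in N. mom_at N s 0 (fst h ** mat 1) \<le> gamma (fst h) ^ k + norm (snd h) ^ k"
        using AE_Hset[OF N(1)]
      proof eventually_elim
        case (elim h)
        from b[OF elim] show ?case by simp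
      qed
    qed
    finally show ?thesis .
  qed
  have mom_pow: "mom N s m \<le> mom N s (Suc 0) ^ m" if N: "prob_H N" "moments_H N" for N :: "'n aff measure"
  proof (induction m)
    case (Suc m)
    have "mom N s (Suc m) \<le> mom N s (Suc 0) * mom N s m"
      using mom_add[OF N, of s "Suc 0" m] s by simp
    also have "\<dots> \<le> mom N s (Suc 0) * mom N s (Suc 0) ^ m" using Suc by (intro mult_left_mono) auto
    finally show ?case by simp
  qed (simp add: mom_0[OF N(1)])
  have "convergent (\<lambda>n. \<integral>h. gamma (fst h) ^ k + norm (snd h) ^ k \<partial>Ms n)"
    using W unfolding W_conv_def convergent_def by blast
  then have "Bseq (\<lambda>n. \<integral>h. gamma (fst h) ^ k + norm (snd h) ^ k \<partial>Ms n)" by (rule convergent_imp_Bseq)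
  then obtain B where "\<And>n. norm (\<integral>h. gamma (fst h) ^ k + norm (snd h) ^ k \<partial>Ms n) \<le> B"
    by (elim BseqE) (rule that, erule spec)
  then have B: "(\<integral>h. gamma (fst h) ^ k + norm (snd h) ^ k \<partial>Ms n) \<le> B" for n
    unfolding real_norm_def by (rule abs_le_D1)
  define A where "A = max (mom M s (Suc 0)) (max B 0)"
  have "mom N s m \<le> A ^ m" if N: "prob_H N" "moments_H N" and "mom N s (Suc 0) \<le> A" for N :: "'n aff measure"
    using mom_pow[OF N] that(3) power_mono[OF that(3), of m] by (simp add: order_trans)
  moreover have "mom (Ms n) s (Suc 0) \<le> A" for n
    using a1[OF Ms, of n] B[of n] by (simp add: A_def)
  ultimately show ?thesis using M Ms
    by (intro exI[of _ "A ^ m"]) (auto simp: A_def)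
qed

lemma SUP_abs_diff_le:
  fixes f g :: "nat \<Rightarrow> real"
  assumes "I \<noteq> {}" "bdd_above (f ` I)" "bdd_above (g ` I)" "\<And>i. i \<in> I \<Longrightarrow> \<bar>f i - g i\<bar> \<le> D"
  shows "\<bar>(SUP i\<in>I. f i) - (SUP i\<in>I. g i)\<bar> \<le> D"
proof -
  have "(SUP i\<in>I. f i) \<le> (SUP i\<in>I. g i) + D"
  proof (rule cSUP_least[OF assms(1)])
    fix i assume i: "i \<in> I"
    show "f i \<le> (SUP i\<in>I. g i) + D" using assms(4)[OF i] cSUP_upper[OF i assms(3)] by linarith
  qed
  moreover have "(SUP i\<in>I. g i) \<le> (SUP i\<in>I. f i) + D"
  proof (rule cSUP_least[OF assms(1)])
    fix i assume i: "i \<in> I"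
    show "g i \<le> (SUP i\<in>I. f i) + D" using assms(4)[OF i] cSUP_upper[OF i assms(2)] by linarith
  qed
  ultimately show ?thesis by linarith
qed

text \<open>In the induction step both the integrand and the measure depend on n. The difference of
  the integrands is dominated by a tail supremum \<open>e N\<close>, a fixed continuous function:
  dominated convergence makes its integral under \<open>M\<close> small, and weak convergence
  carries this over to \<open>Ms n\<close>.\<close>

lemma mom_at_tendsto:
  fixes M :: "'n::finite aff measure"
  assumes M: "prob_H M" "moments_H M" and Ms: "\<And>n. prob_H (Ms n)" "\<And>n. moments_H (Ms n)" and W: "W_conv Ms M"
    and s: "0 < s"
  shows "(\<lambda>n. mom_at (Ms n) s m X) \<longlonglongrightarrow> mom_at M s m X"
proof (induction m arbitrary: X)
  case 0
  show ?case by (simp add: mom_at_0[OF M(1)] mom_at_0[OF Ms(1)])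
next
  case (Suc m X)
  define f where "f n = mom_at (Ms n) s m" for n
  define f0 where "f0 = mom_at M s m"
  obtain k where k: "s \<le> real k" using real_arch_simple by blast
  obtain A where A: "A \<ge> 0" "mom M s m \<le> A" "\<And>n. mom (Ms n) s m \<le> A"
    using mom_uniform_bound[OF M Ms W s] by blast
  have bf: "0 \<le> f n X" "f n X \<le> A * opnorm X powr s" and bf0: "0 \<le> f0 X" "f0 X \<le> A * opnorm X powr s" for n X
    using mom_at_bounds[OF M s, of m X] mom_at_bounds[OF Ms s, of n m X] A(2) A(3)[of n]
      mult_right_mono[OF A(2), of "opnorm X powr s"] mult_right_mono[OF A(3)[of n], of "opnorm X powr s"]
    by (auto simp: f_def f0_def)
  have mf: "\<bar>f n X - f n Y\<bar> \<le> (s + 1) * A * hoelder_modulus s X Y" for n X Y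
    unfolding f_def
    by (rule order_trans[OF mom_at_hoelder_modulus[OF Ms s]]) (use A s in \<open>auto intro!: mult_right_mono mult_left_mono\<close>)
  have mf0: "\<bar>f0 X - f0 Y\<bar> \<le> (s + 1) * A * hoelder_modulus s X Y" for X Y
    unfolding f0_def
    by (rule order_trans[OF mom_at_hoelder_modulus[OF M s]]) (use A s in \<open>auto intro!: mult_right_mono mult_left_mono\<close>)
  \<comment> \<open>Equicontinuity makes the supremum over n \<ge> N continuous, with the same kind
    of modulus, so it is an admissible integrand for \<open>W_conv_integral\<close>.\<close>
  define e where "e N X = (SUP n\<in>{N..}. \<bar>f n X - f0 X\<bar>)" for N X
  have dle: "\<bar>f n X - f0 X\<bar> \<le> A * opnorm X powr s" for n X using bf[of n X] bf0[of X] by linarith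
  have bdd: "bdd_above ((\<lambda>n. \<bar>f n X - f0 X\<bar>) ` {N..})" for N X
    using dle by (intro bdd_aboveI2)
  have eu: "\<bar>f n X - f0 X\<bar> \<le> e N X" if "n \<ge> N" for n N X
    unfolding e_def using that by (intro cSUP_upper bdd) auto
  have e0: "0 \<le> e N X" for N X using eu[of N N X] by linarith
  have ele: "e N X \<le> A * opnorm X powr s" for N X
    unfolding e_def using dle by (intro cSUP_least) auto
  have "\<bar>e N X - e N Y\<bar> \<le> (2 * (s + 1) * A) * hoelder_modulus s X Y" for N X Y
    unfolding e_def
  proof (rule SUP_abs_diff_le[OF _ bdd bdd])
    fix n
    show "\<bar>\<bar>f n X - f0 X\<bar> - \<bar>f n Y - f0 Y\<bar>\<bar> \<le> (2 * (s + 1) * A) * hoelder_modulus s X Y"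
      using mf[of n X Y] mf0[of X Y] by (simp add: algebra_simps)
  qed simp
  then have ce: "continuous_on UNIV (e N)" for N using s by (intro continuous_if_hoelder_modulus)
  have cf0: "continuous_on UNIV f0" unfolding f0_def by (rule mom_at_continuous[OF M s])
  have elim: "(\<lambda>N. e N X) \<longlonglongrightarrow> 0" for X
  proof (rule LIMSEQ_I)
    fix r :: real assume r: "0 < r"
    have "(\<lambda>n. f n X) \<longlonglongrightarrow> f0 X" unfolding f_def f0_def by (rule Suc.IH)
    then obtain N where N: "\<And>n. n \<ge> N \<Longrightarrow> \<bar>f n X - f0 X\<bar> < r / 2"
      using LIMSEQ_D[of "\<lambda>n. f n X" "f0 X" "r / 2"] r by auto
    have "norm (e K X - 0) < r" if "K \<ge> N" for K
    proof -
      have "e K X \<le> r / 2" unfolding e_def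
        using that N by (intro cSUP_least) (auto intro: less_imp_le)
      then show ?thesis using e0[of K X] r by simp
    qed
    then show "\<exists>no. \<forall>K\<ge>no. norm (e K X - 0) < r" by blast
  qed
  let ?x = "\<lambda>h. fst h ** X"
  have cx: "continuous_on UNIV (\<lambda>h. \<psi> (?x h))" if "continuous_on UNIV \<psi>" for \<psi> :: "'n mat \<Rightarrow> real"
    by (intro continuous_on_compose2[OF that] continuous_intros) auto
  define D where "D = A * opnorm X powr s"
  have bnd: "\<bar>\<psi> (?x h)\<bar> \<le> D * (gamma (fst h) ^ k + norm (snd h) ^ k)"
    if "h \<in> Hset" "\<And>Y. \<bar>\<psi> Y\<bar> \<le> A * opnorm Y powr s" for h \<psi>
    unfolding D_def using order_trans[OF that(2) opnorm_act_bound[OF that(1) s k A(1)]] .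
  have b_e: "\<bar>e N Y\<bar> \<le> A * opnorm Y powr s" and b_f0: "\<bar>f0 Y\<bar> \<le> A * opnorm Y powr s"
    and b_f: "\<bar>f n Y\<bar> \<le> A * opnorm Y powr s" for N n Y
    using e0[of N Y] ele[of N Y] bf0[of Y] bf[of n Y] by auto
  have int: "integrable N' (\<lambda>h. \<psi> (?x h))"
    if "prob_H N'" "moments_H N'" "continuous_on UNIV \<psi>" "\<And>Y. \<bar>\<psi> Y\<bar> \<le> A * opnorm Y powr s" for N' \<psi>
    using integrable_moment[OF that(1,2) borel_measurable_continuous_onI[OF cx[OF that(3)]] bnd[OF _ that(4)]] .
  have conv: "(\<lambda>n. \<integral>h. \<psi> (?x h) \<partial>Ms n) \<longlonglongrightarrow> (\<integral>h. \<psi> (?x h) \<partial>M)"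
    if "continuous_on UNIV \<psi>" "\<And>Y. \<bar>\<psi> Y\<bar> \<le> A * opnorm Y powr s" for \<psi>
    using W_conv_integral[OF M Ms W cx[OF that(1)] bnd[OF _ that(2)]] .
  have cf: "continuous_on UNIV (f n)" for n unfolding f_def by (rule mom_at_continuous[OF Ms s])
  have dom: "(\<lambda>N. \<integral>h. e N (?x h) \<partial>M) \<longlonglongrightarrow> (\<integral>h. 0 \<partial>M)"
  proof (rule integral_dominated_convergence[where w = "\<lambda>h. A * opnorm (?x h) powr s"])
    show "integrable M (\<lambda>h. A * opnorm (?x h) powr s)"
    proof (rule int[OF M])
      show "continuous_on UNIV (\<lambda>Y :: 'n mat. A * opnorm Y powr s)"
        using s by (intro continuous_intros continuous_on_powr') auto
    qed (use A in auto)
    show "(\<lambda>h. e N (?x h)) \<in> borel_measurable M" for N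
      using int[OF M ce b_e] by (rule borel_measurable_integrable)
  qed (use elim b_e in auto)
  show ?case unfolding mom_at_Suc[OF M s] mom_at_Suc[OF Ms s] f_def[symmetric] f0_def[symmetric]
  proof (rule LIMSEQ_I)
    fix r :: real assume r: "0 < r"
    have "\<forall>\<^sub>F N in sequentially. (\<integral>h. e N (?x h) \<partial>M) < r / 2"
      using dom r by (intro order_tendstoD) auto
    then obtain N where N: "(\<integral>h. e N (?x h) \<partial>M) < r / 2" by (auto simp: eventually_sequentially)
    have "\<forall>\<^sub>F n in sequentially. (\<integral>h. e N (?x h) \<partial>Ms n) < r / 2"
      using order_tendstoD(2)[OF conv[OF ce b_e] N] .
    moreover have "\<forall>\<^sub>F n in sequentially. \<bar>(\<integral>h. f0 (?x h) \<partial>Ms n) - (\<integral>h. f0 (?x h) \<partial>M)\<bar> < r / 2"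
      using tendstoD[OF conv[OF cf0 b_f0], of "r / 2"] r by (simp add: dist_real_def)
    moreover have "\<forall>\<^sub>F n in sequentially. n \<ge> N" by (rule eventually_ge_at_top)
    ultimately have "\<forall>\<^sub>F n in sequentially. norm ((\<integral>h. f n (?x h) \<partial>Ms n) - (\<integral>h. f0 (?x h) \<partial>M)) < r"
    proof eventually_elim
      case (elim n)
      have "\<bar>(\<integral>h. f n (?x h) \<partial>Ms n) - (\<integral>h. f0 (?x h) \<partial>Ms n)\<bar> = \<bar>\<integral>h. f n (?x h) - f0 (?x h) \<partial>Ms n\<bar>"
        using int[OF Ms cf b_f] int[OF Ms cf0 b_f0] by simp
      also have "\<dots> \<le> (\<integral>h. \<bar>f n (?x h) - f0 (?x h)\<bar> \<partial>Ms n)" by (rule integral_abs_bound)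
      also have "\<dots> \<le> (\<integral>h. e N (?x h) \<partial>Ms n)"
        using elim(3) by (intro integral_mono integrable_abs Bochner_Integration.integrable_diff int[OF Ms cf b_f] int[OF Ms cf0 b_f0] int[OF Ms ce b_e] eu)
      finally show ?case using elim(1,2) unfolding real_norm_def by linarith
    qed
    then show "\<exists>no. \<forall>n\<ge>no. norm ((\<integral>h. f n (?x h) \<partial>Ms n) - (\<integral>h. f0 (?x h) \<partial>M)) < r"
      by (auto simp: eventually_sequentially)
  qed
qed

lemma mom_tendsto:
  fixes M :: "'n::finite aff measure"
  assumes M: "prob_H M" "moments_H M" and Ms: "\<And>n. prob_H (Ms n)" "\<And>n. moments_H (Ms n)" and W: "W_conv Ms M"
    and s: "0 < s"
  shows "(\<lambda>n. mom (Ms n) s m) \<longlonglongrightarrow> mom M s m"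
  using mom_at_tendsto[OF M Ms W s, of m "mat 1"] by (simp add: mom_at_mom[OF M s] mom_at_mom[OF Ms s])

subsection \<open>Lower bounds from irreducibility\<close>

text \<open>The constant sequence lets every bound that is uniform over nearby laws be applied to
  \<open>M\<close> alone.\<close>

lemma W_conv_const: "W_conv (\<lambda>_. M) M" by (simp add: W_conv_def)

lemma emeasure_law_mult:
  fixes M :: "'n::finite aff measure"
  assumes M: "prob_H M" and o: "open A" "open B" "open U" and AB: "\<And>a b. a \<in> A \<Longrightarrow> b \<in> B \<Longrightarrow> a ** b \<in> U"
  shows "emeasure (law M m) A * emeasure (law M n) B \<le> emeasure (law M (m + n)) U"
proof -
  have "emeasure (law M m) A * emeasure (law M n) B = (\<integral>\<^sup>+X. (\<integral>\<^sup>+Y. indicator A Y * indicator B X \<partial>law M m) \<partial>law M n)"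
  proof -
    have "(\<integral>\<^sup>+Y. indicator A Y * indicator B X \<partial>law M m) = emeasure (law M m) A * indicator B X" for X
    proof -
      have "(\<integral>\<^sup>+Y. indicator A Y * indicator B X \<partial>law M m) = (\<integral>\<^sup>+Y. indicator A Y \<partial>law M m) * indicator B X"
        using o by (intro nn_integral_multc borel_measurable_indicator) (simp add: borel_open)
      also have "(\<integral>\<^sup>+Y. indicator A Y \<partial>law M m) = emeasure (law M m) A"
        using o by (intro nn_integral_indicator) (simp add: borel_open)
      finally show ?thesis .
    qed
    then show ?thesis using o by (simp add: nn_integral_cmult_indicator borel_open)
  qed
  also have "\<dots> \<le> (\<integral>\<^sup>+X. (\<integral>\<^sup>+Y. indicator U (Y ** X) \<partial>law M m) \<partial>law M n)"
    using AB by (intro nn_integral_mono) (auto simp: indicator_def)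
  also have "\<dots> = (\<integral>\<^sup>+Z. indicator U Z \<partial>law M (m + n))"
    using o by (intro law_add[OF M, symmetric]) (simp add: borel_open)
  also have "\<dots> = emeasure (law M (m + n)) U"
    using o by (intro nn_integral_indicator) (simp add: borel_open)
  finally show ?thesis .
qed

text \<open>The quantitative form of \<open>semigrp_T_approx\<close>: one time r and one probability
  p serve all laws far enough in the sequence. Open-set induction adds times and multiplies
  probabilities.\<close>

lemma reachable_open:
  fixes M :: "'n::finite aff measure"
  assumes M: "prob_H M" and Ms: "\<And>n. prob_H (Ms n)" and W: "W_conv Ms M"
    and u: "u \<in> semigrp_T M" and U: "open U" "u \<in> U"
  shows "\<exists>r. \<exists>p>0. \<forall>\<^sub>F n in sequentially. ennreal p \<le> emeasure (law (Ms n) r) U"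
proof (rule semigrp_T_open_induct[where Q = "\<lambda>U. \<exists>r. \<exists>p>0. \<forall>\<^sub>F n in sequentially. ennreal p \<le> emeasure (law (Ms n) r) U", OF _ _ u U])
  fix g U assume g: "g \<in> supp_G M" and U: "open U" "g \<in> (U :: 'n mat set)"
  obtain h where h: "h \<in> supp_H M" "fst h \<in> U" using supp_G_approx[OF M g U] by blast
  have oU: "open (fst -` U :: 'n aff set)" using U(1) by (rule open_vimage_fst)
  obtain p K where p: "p > 0" "compact K" "K \<subseteq> fst -` U \<inter> Hset" "\<forall>\<^sub>F n in sequentially. measure (Ms n) K \<ge> p"
    using W_conv_open_mass[OF M Ms W h(1) oU] h(2) by blast
  have "\<forall>\<^sub>F n in sequentially. ennreal p \<le> emeasure (law (Ms n) (Suc 0)) U"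
    using p(4)
  proof eventually_elim
    case (elim n)
    interpret prob_space "Ms n" using prob_HD(1)[OF Ms] .
    have "ennreal p \<le> emeasure (Ms n) K" using elim by (simp add: emeasure_eq_measure ennreal_leI)
    also have "\<dots> \<le> emeasure (Ms n) (fst -` U)"
      using p(3) by (intro emeasure_mono open_in_sets[OF Ms oU]) auto
    also have "\<dots> = (\<integral>\<^sup>+h. indicator U (fst h) \<partial>Ms n)"
    proof -
      have "(\<integral>\<^sup>+h. indicator U (fst h) \<partial>Ms n) = (\<integral>\<^sup>+h. indicator (fst -` U) h \<partial>Ms n)"
        by (intro nn_integral_cong) (auto simp: indicator_def)
      then show ?thesis using nn_integral_indicator[OF open_in_sets[OF Ms oU]] by simp
    qed
    also have "\<dots> = (\<integral>\<^sup>+Z. indicator U Z \<partial>law (Ms n) (Suc 0))"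
      using U by (intro law_1[OF Ms, symmetric]) (simp add: borel_open)
    also have "\<dots> = emeasure (law (Ms n) (Suc 0)) U"
      using U by (intro nn_integral_indicator) (simp add: borel_open)
    finally show ?case .
  qed
  then show "\<exists>r. \<exists>p>0. \<forall>\<^sub>F n in sequentially. ennreal p \<le> emeasure (law (Ms n) r) U"
    using p(1) by blast
next
  fix A B U :: "'n mat set"
  assume o: "open A" "open B" "open U"
    and A: "\<exists>r. \<exists>p>0. \<forall>\<^sub>F n in sequentially. ennreal p \<le> emeasure (law (Ms n) r) A"
    and B: "\<exists>r. \<exists>p>0. \<forall>\<^sub>F n in sequentially. ennreal p \<le> emeasure (law (Ms n) r) B"
    and AB: "\<And>a b. a \<in> A \<Longrightarrow> b \<in> B \<Longrightarrow> a ** b \<in> U"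
  obtain r p where 1: "p > 0" "\<forall>\<^sub>F n in sequentially. ennreal p \<le> emeasure (law (Ms n) r) A" using A by blast
  obtain r' p' where 2: "p' > 0" "\<forall>\<^sub>F n in sequentially. ennreal p' \<le> emeasure (law (Ms n) r') B" using B by blast
  have "\<forall>\<^sub>F n in sequentially. ennreal (p * p') \<le> emeasure (law (Ms n) (r + r')) U"
    using 1(2) 2(2)
  proof eventually_elim
    case (elim n)
    have "ennreal (p * p') = ennreal p * ennreal p'" using 1 2 by (simp add: ennreal_mult)
    also have "\<dots> \<le> emeasure (law (Ms n) r) A * emeasure (law (Ms n) r') B"
      using elim by (intro mult_mono) auto
    also have "\<dots> \<le> emeasure (law (Ms n) (r + r')) U" by (rule emeasure_law_mult[OF Ms o AB])
    finally show ?case .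
  qed
  then show "\<exists>r. \<exists>p>0. \<forall>\<^sub>F n in sequentially. ennreal p \<le> emeasure (law (Ms n) r) U"
    using 1(1) 2(1) by (intro exI[of _ "r + r'"] exI[of _ "p * p'"]) auto
qed

lemma nn_integral_ge_on:
  assumes "U \<in> sets N" "\<And>x. x \<in> U \<Longrightarrow> c \<le> \<phi> x" "p \<le> emeasure N U"
  shows "c * p \<le> (\<integral>\<^sup>+x. \<phi> x \<partial>N)"
proof -
  have "c * p \<le> c * emeasure N U" using assms(3) by (intro mult_left_mono) auto
  also have "\<dots> = (\<integral>\<^sup>+x. c * indicator U x \<partial>N)" using assms(1) by (rule nn_integral_cmult_indicator[symmetric])
  also have "\<dots> \<le> (\<integral>\<^sup>+x. \<phi> x \<partial>N)"
    using assms(2) by (intro nn_integral_mono) (auto simp: indicator_def)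
  finally show ?thesis .
qed

text \<open>For unit vectors f and x irreducibility provides u in the semigroup with f . (u x)
  nonzero. This persists near (f, x) and u, and compactness of the product of two spheres leaves
  finitely many neighbourhoods. For a matrix a its largest row plays the part of f. The sum over r
  \<le> R is there because the time depends on the direction.\<close>

lemma nonvanishing_lower_bound:
  fixes M :: "'n::finite aff measure"
  assumes M: "prob_H M" and Ms: "\<And>n. prob_H (Ms n)" and W: "W_conv Ms M"
    and irr: "no_invariant_family (semigrp_T M)" and ne: "semigrp_T M \<noteq> {}" and s: "0 < s"
  shows "\<exists>c>0. \<exists>R. \<forall>\<^sub>F n in sequentially. \<forall>a x. ennreal (c * (opnorm a powr s * norm x powr s)) \<le>
           (\<Sum>r\<le>R. \<integral>\<^sup>+Y. ennreal (norm (a *v (Y *v x)) powr s) \<partial>law (Ms n) r)"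
proof -
  let ?S = "sphere (0 :: real^'n) 1 \<times> sphere (0 :: real^'n) 1"
  define good where "good q N U \<delta> r p \<longleftrightarrow> open N \<and> q \<in> N \<and> open U \<and> 0 < \<delta> \<and> 0 < p \<and>
      (\<forall>q'\<in>N. \<forall>Y\<in>U. \<delta> \<le> \<bar>fst q' \<bullet> (Y *v snd q')\<bar>) \<and>
      (\<forall>\<^sub>F n in sequentially. ennreal p \<le> emeasure (law (Ms n) r) U)"
    for q and N :: "((real^'n) \<times> (real^'n)) set" and U :: "'n mat set" and \<delta> r p
  have ex: "\<exists>N U \<delta> r p. good q N U \<delta> r p" if q: "q \<in> ?S" for q
  proof -
    obtain f x where q': "q = (f, x)" by (cases q)
    then have "norm f = 1" "norm x = 1" using q by auto
    then have fx: "q = (f, x)" "f \<noteq> 0" "x \<noteq> 0" using q' by auto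
    have sp: "span ((\<lambda>u. u *v x) ` semigrp_T M) = UNIV"
      by (rule span_orbit[OF semigrp_T_subset ne _ irr fx(3)]) (rule semigrp_T_mult)
    have "\<exists>u\<in>semigrp_T M. f \<bullet> (u *v x) \<noteq> 0"
    proof (rule ccontr)
      assume "\<not> ?thesis"
      then have "(\<lambda>u. u *v x) ` semigrp_T M \<subseteq> {y. f \<bullet> y = 0}" by auto
      then have "span ((\<lambda>u. u *v x) ` semigrp_T M) \<subseteq> {y. f \<bullet> y = 0}"
        by (rule span_minimal) (auto simp: subspace_def inner_add_right)
      then have "f \<bullet> f = 0" using sp by blast
      then show False using fx(2) by simp
    qed
    then obtain u where u: "u \<in> semigrp_T M" "f \<bullet> (u *v x) \<noteq> 0" by blast
    define \<delta> where "\<delta> = \<bar>f \<bullet> (u *v x)\<bar> / 2"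
    have \<delta>: "\<delta> > 0" using u(2) by (simp add: \<delta>_def)
    let ?h = "\<lambda>z :: ((real^'n) \<times> (real^'n)) \<times> 'n mat. \<bar>fst (fst z) \<bullet> (snd z *v snd (fst z))\<bar>"
    have "continuous_on UNIV ?h" by (intro continuous_intros)
    then have "open (?h -` {\<delta><..})" by (intro open_vimage) auto
    moreover have "(q, u) \<in> ?h -` {\<delta><..}" using u(2) by (simp add: fx \<delta>_def)
    ultimately obtain N U where NU: "open N" "open U" "(q, u) \<in> N \<times> U" "N \<times> U \<subseteq> ?h -` {\<delta><..}"
      by (rule open_prod_elim) (rule that, assumption+)
    obtain r p where rp: "p > 0" "\<forall>\<^sub>F n in sequentially. ennreal p \<le> emeasure (law (Ms n) r) U"
      using reachable_open[OF M Ms W u(1) NU(2)] NU(3) by blast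
    have "\<delta> \<le> \<bar>fst q' \<bullet> (Y *v snd q')\<bar>" if "q' \<in> N" "Y \<in> U" for q' Y
    proof -
      have "(q', Y) \<in> N \<times> U" using that by simp
      then have "(q', Y) \<in> ?h -` {\<delta><..}" using NU(4) by blast
      then show ?thesis by simp
    qed
    then have "good q N U \<delta> r p" using NU rp \<delta> unfolding good_def by blast
    then show ?thesis by blast
  qed
  then obtain N U \<delta> r p where G: "\<And>q. q \<in> ?S \<Longrightarrow> good q (N q) (U q) (\<delta> q) (r q) (p q)"
    by metis
  have P: "\<And>q. q \<in> ?S \<Longrightarrow> open (N q)" "\<And>q. q \<in> ?S \<Longrightarrow> q \<in> N q" "\<And>q. q \<in> ?S \<Longrightarrow> open (U q)"
    "\<And>q. q \<in> ?S \<Longrightarrow> 0 < (\<delta> q :: real)" "\<And>q. q \<in> ?S \<Longrightarrow> 0 < (p q :: real)"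
    "\<And>q q' Y. q \<in> ?S \<Longrightarrow> q' \<in> N q \<Longrightarrow> Y \<in> U q \<Longrightarrow> \<delta> q \<le> \<bar>fst q' \<bullet> (Y *v snd q')\<bar>"
    "\<And>q. q \<in> ?S \<Longrightarrow> \<forall>\<^sub>F n in sequentially. ennreal (p q) \<le> emeasure (law (Ms n) (r q)) (U q)"
    using G unfolding good_def by blast+
  have "compact ?S" by (intro compact_Times compact_sphere)
  have cov: "?S \<subseteq> (\<Union>q\<in>?S. N q)" using P(2) by blast
  obtain D where D: "D \<subseteq> ?S" "finite D" "?S \<subseteq> (\<Union>q\<in>D. N q)"
    by (rule compactE_image[OF \<open>compact ?S\<close> P(1) cov])
  have Sne: "?S \<noteq> {}" using vector_choose_size[of 1, where 'a = "real^'n"] by force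
  then have Dne: "D \<noteq> {}" using D(3) by auto
  \<comment> \<open>On the neighbourhood of q the norm is at least \<delta>/d times |a| |x| with
    probability p, where d = \<open>CARD('n)\<close> is lost in passing from |a| to its largest
    row.\<close>
  define c where "c = Min ((\<lambda>q. (\<delta> q / CARD('n)) powr s * p q) ` D)"
  define R where "R = Max (r ` D)"
  have cle: "c \<le> (\<delta> q / CARD('n)) powr s * p q" if "q \<in> D" for q
    unfolding c_def using that D(2) by (intro Min_le) auto
  have rle: "r q \<le> R" if "q \<in> D" for q unfolding R_def using that D(2) by (intro Max_ge) auto
  have c0: "c > 0"
  proof -
    have "0 < (\<delta> q / CARD('n)) powr s * p q" if "q \<in> D" for q
    proof -
      have "q \<in> ?S" using that D(1) by blast
      from P(4,5)[OF this] show ?thesis by simp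
    qed
    then show ?thesis unfolding c_def using D(2) Dne by (subst Min_gr_iff) auto
  qed
  have "\<forall>\<^sub>F n in sequentially. \<forall>q\<in>D. ennreal (p q) \<le> emeasure (law (Ms n) (r q)) (U q)"
    using P(7) D by (intro eventually_ball_finite) auto
  then have "\<forall>\<^sub>F n in sequentially. \<forall>a x. ennreal (c * (opnorm a powr s * norm x powr s)) \<le>
           (\<Sum>r\<le>R. \<integral>\<^sup>+Y. ennreal (norm (a *v (Y *v x)) powr s) \<partial>law (Ms n) r)"
  proof (rule eventually_mono, intro allI)
    fix n and a :: "'n mat" and x :: "real^'n"
    assume mass: "\<forall>q\<in>D. ennreal (p q) \<le> emeasure (law (Ms n) (r q)) (U q)"
    show "ennreal (c * (opnorm a powr s * norm x powr s)) \<le>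
           (\<Sum>r\<le>R. \<integral>\<^sup>+Y. ennreal (norm (a *v (Y *v x)) powr s) \<partial>law (Ms n) r)"
    proof (cases "a = 0 \<or> x = 0")
      case True
      then show ?thesis by auto
    next
      case False
      obtain i where i: "opnorm a \<le> CARD('n) * norm (a $ i)" using opnorm_le_row by blast
      have a0: "opnorm a > 0" using False opnorm_eq_0[of a] opnorm_nonneg[of a] by linarith
      have ai: "norm (a $ i) > 0"
      proof (rule ccontr)
        assume "\<not> norm (a $ i) > 0"
        then show False using i a0 by simp
      qed
      have x0: "norm x > 0" using False by simp
      have "(a $ i /\<^sub>R norm (a $ i), x /\<^sub>R norm x) \<in> ?S" using ai x0 by simp
      then obtain q where q: "q \<in> D" "(a $ i /\<^sub>R norm (a $ i), x /\<^sub>R norm x) \<in> N q" using D(3) by blast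
      have qS: "q \<in> ?S" using q(1) D(1) by blast
      have lb: "opnorm a / CARD('n) * norm x * \<delta> q \<le> norm (a *v (Y *v x))" if "Y \<in> U q" for Y
      proof -
        have "\<delta> q \<le> \<bar>(a $ i /\<^sub>R norm (a $ i)) \<bullet> (Y *v (x /\<^sub>R norm x))\<bar>"
          using P(6)[OF qS q(2) that] by simp
        also have "\<dots> = \<bar>a $ i \<bullet> (Y *v x)\<bar> / (norm (a $ i) * norm x)"
          using ai x0 by (simp add: matrix_vector_mult_scaleR abs_mult field_simps)
        finally have "norm (a $ i) * norm x * \<delta> q \<le> \<bar>a $ i \<bullet> (Y *v x)\<bar>"
          using ai x0 by (simp add: field_simps)
        also have "\<dots> = \<bar>(a *v (Y *v x)) $ i\<bar>" by (simp add: matrix_vector_mul_component)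
        also have "\<dots> \<le> norm (a *v (Y *v x))" by (rule component_le_norm_cart)
        finally have 1: "norm (a $ i) * norm x * \<delta> q \<le> norm (a *v (Y *v x))" .
        have "opnorm a / CARD('n) \<le> norm (a $ i)" using i by (simp add: field_simps)
        then have "opnorm a / CARD('n) * (norm x * \<delta> q) \<le> norm (a $ i) * (norm x * \<delta> q)"
          using x0 P(4)[OF qS] by (intro mult_right_mono) auto
        then show ?thesis using 1 by (simp add: mult.assoc)
      qed
      let ?c = "(opnorm a / CARD('n) * norm x * \<delta> q) powr s"
      have "c * (opnorm a powr s * norm x powr s) \<le> ((\<delta> q / CARD('n)) powr s * p q) * (opnorm a powr s * norm x powr s)"
        by (intro mult_right_mono cle q(1)) auto
      also have "\<dots> = ?c * p q"
        using P(4)[OF qS] x0 a0 by (simp add: powr_mult powr_divide)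
      finally have "ennreal (c * (opnorm a powr s * norm x powr s)) \<le> ennreal ?c * ennreal (p q)"
        using P(5)[OF qS] by (simp add: ennreal_mult[symmetric] ennreal_leI)
      also have "\<dots> \<le> (\<integral>\<^sup>+Y. ennreal (norm (a *v (Y *v x)) powr s) \<partial>law (Ms n) (r q))"
      proof (rule nn_integral_ge_on)
        show "U q \<in> sets (law (Ms n) (r q))" using P(3)[OF qS] by simp
        fix Y assume "Y \<in> U q"
        from lb[OF this] show "ennreal ?c \<le> ennreal (norm (a *v (Y *v x)) powr s)"
          using s a0 x0 P(4)[OF qS] by (intro ennreal_leI powr_mono2) auto
      qed (use mass q(1) in blast)
      also have "\<dots> \<le> (\<Sum>r\<le>R. \<integral>\<^sup>+Y. ennreal (norm (a *v (Y *v x)) powr s) \<partial>law (Ms n) r)"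
        using rle[OF q(1)] by (intro member_le_sum) auto
      finally show ?thesis .
    qed
  qed
  then show ?thesis using c0 by blast
qed

text \<open>The lower bound is integrated over a distributed as S_i; the product a Y then has the
  law of i + r factors. So E |S_i x|^s is comparable to E |S_i|^s |x|^s after summation over
  boundedly many extra steps.\<close>

lemma vector_moment_lower:
  fixes N :: "'n::finite aff measure"
  assumes N: "prob_H N" and c: "0 < c"
    and lb: "\<And>a x. ennreal (c * (opnorm a powr s * norm x powr s)) \<le>
           (\<Sum>r\<le>R. \<integral>\<^sup>+Y. ennreal (norm (a *v (Y *v x)) powr s) \<partial>law N r)"
  shows "ennreal (c * norm x powr s) * moment_S N s i \<le> (\<Sum>r\<le>R. \<integral>\<^sup>+Z. ennreal (norm (Z *v x) powr s) \<partial>law N (i + r))"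
proof -
  interpret P: prob_space "law N n" for n by (rule prob_space_law[OF N])
  have sw: "(\<integral>\<^sup>+Z. ennreal (norm (Z *v x) powr s) \<partial>law N (i + r)) =
      (\<integral>\<^sup>+a. (\<integral>\<^sup>+Y. ennreal (norm (a *v (Y *v x)) powr s) \<partial>law N r) \<partial>law N i)" for r
  proof -
    interpret pair_sigma_finite "law N r" "law N i" ..
    have "(\<integral>\<^sup>+Z. ennreal (norm (Z *v x) powr s) \<partial>law N (i + r)) =
      (\<integral>\<^sup>+Y. (\<integral>\<^sup>+a. ennreal (norm (a *v (Y *v x)) powr s) \<partial>law N i) \<partial>law N r)"
      by (subst law_add[OF N]) (auto simp: matrix_vector_mul_assoc)
    also have "\<dots> = (\<integral>\<^sup>+a. (\<integral>\<^sup>+Y. ennreal (norm (a *v (Y *v x)) powr s) \<partial>law N r) \<partial>law N i)"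
      by (rule Fubini'[symmetric]) measurable
    finally show ?thesis .
  qed
  have meas: "(\<lambda>a. \<integral>\<^sup>+Y. ennreal (norm (a *v (Y *v x)) powr s) \<partial>law N r) \<in> borel_measurable (law N i)" for r
    by measurable
  have "ennreal (c * norm x powr s) * moment_S N s i = (\<integral>\<^sup>+a. ennreal (c * norm x powr s) * ennreal (opnorm a powr s) \<partial>law N i)"
    unfolding moment_S_law[OF N] by (rule nn_integral_cmult[symmetric]) simp
  also have "\<dots> \<le> (\<integral>\<^sup>+a. (\<Sum>r\<le>R. \<integral>\<^sup>+Y. ennreal (norm (a *v (Y *v x)) powr s) \<partial>law N r) \<partial>law N i)"
    using lb c by (intro nn_integral_mono) (auto simp: ennreal_mult[symmetric] mult_ac)
  also have "\<dots> = (\<Sum>r\<le>R. \<integral>\<^sup>+Z. ennreal (norm (Z *v x) powr s) \<partial>law N (i + r))"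
    unfolding sw using meas by (intro nn_integral_sum) auto
  finally show ?thesis .
qed

text \<open>\<open>vector_moment_lower\<close> is applied to the largest column of X, which costs
  the power of \<open>CARD('n)\<close>, and then integrated over X distributed as S_j. The r steps
  inserted between the two blocks are removed again by submultiplicativity.\<close>

lemma moment_lower:
  fixes N :: "'n::finite aff measure"
  assumes N: "prob_H N" "moments_H N" and c: "0 < c" and s: "0 < s"
    and lb: "\<And>a x. ennreal (c * (opnorm a powr s * norm x powr s)) \<le>
           (\<Sum>r\<le>R. \<integral>\<^sup>+Y. ennreal (norm (a *v (Y *v x)) powr s) \<partial>law N r)"
  shows "c / CARD('n) powr s * mom N s i * mom N s j \<le> (\<Sum>r\<le>R. mom N s r) * mom N s (i + j)"
proof -
  interpret P: prob_space "law N n" for n by (rule prob_space_law[OF N(1)])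
  let ?d = "real CARD('n) powr s"
  define K where "K = c / ?d"
  have K: "K \<ge> 0" using c by (simp add: K_def)
  have col: "ennreal (K * opnorm X powr s) * moment_S N s i \<le> (\<Sum>r\<le>R. \<integral>\<^sup>+Z. ennreal (opnorm (Z ** X) powr s) \<partial>law N (i + r))" for X :: "'n mat"
  proof -
    obtain k where k: "opnorm X \<le> CARD('n) * norm (X *v axis k 1)" using opnorm_le_column by blast
    have "opnorm X powr s \<le> (CARD('n) * norm (X *v axis k 1)) powr s" using k s by (intro powr_mono2) auto
    also have "\<dots> = ?d * norm (X *v axis k 1) powr s" by (simp add: powr_mult)
    finally have "c / ?d * opnorm X powr s \<le> c / ?d * (?d * norm (X *v axis k 1) powr s)"
      using c by (intro mult_left_mono) auto
    then have "K * opnorm X powr s \<le> c * norm (X *v axis k 1) powr s" by (simp add: K_def)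
    then have "ennreal (K * opnorm X powr s) * moment_S N s i \<le> ennreal (c * norm (X *v axis k 1) powr s) * moment_S N s i"
      by (intro mult_right_mono ennreal_leI) auto
    also have "\<dots> \<le> (\<Sum>r\<le>R. \<integral>\<^sup>+Z. ennreal (norm (Z *v (X *v axis k 1)) powr s) \<partial>law N (i + r))"
      by (rule vector_moment_lower[OF N(1) c lb])
    also have "\<dots> \<le> (\<Sum>r\<le>R. \<integral>\<^sup>+Z. ennreal (opnorm (Z ** X) powr s) \<partial>law N (i + r))"
    proof (intro sum_mono nn_integral_mono ennreal_leI powr_mono2)
      fix Z :: "'n mat"
      show "norm (Z *v (X *v axis k 1)) \<le> opnorm (Z ** X)"
        using opnorm_mv[of "Z ** X" "axis k 1"] by (simp add: matrix_vector_mul_assoc)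
    qed (use s in auto)
    finally show ?thesis .
  qed
  have "ennreal (K * mom N s i * mom N s j) = ennreal K * moment_S N s i * moment_S N s j"
    using K s by (simp add: moment_S_eq_mom[OF N] ennreal_mult)
  also have "\<dots> = (\<integral>\<^sup>+X. ennreal K * moment_S N s i * ennreal (opnorm X powr s) \<partial>law N j)"
    unfolding moment_S_law[OF N(1), of s j] by (rule nn_integral_cmult[symmetric]) simp
  also have "\<dots> \<le> (\<integral>\<^sup>+X. (\<Sum>r\<le>R. \<integral>\<^sup>+Z. ennreal (opnorm (Z ** X) powr s) \<partial>law N (i + r)) \<partial>law N j)"
    using col K by (intro nn_integral_mono) (auto simp: ennreal_mult mult_ac)
  also have "\<dots> = (\<Sum>r\<le>R. \<integral>\<^sup>+X. (\<integral>\<^sup>+Z. ennreal (opnorm (Z ** X) powr s) \<partial>law N (i + r)) \<partial>law N j)"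
    by (intro nn_integral_sum) measurable
  also have "\<dots> = (\<Sum>r\<le>R. moment_S N s (i + r + j))"
    unfolding moment_S_law[OF N(1)] by (subst law_add[OF N(1)]) auto
  also have "\<dots> \<le> (\<Sum>r\<le>R. ennreal (mom N s r * mom N s (i + j)))"
  proof (rule sum_mono)
    fix r
    \<comment> \<open>The moment depends only on the total number of factors, so the r middle steps
      may be counted as the last ones.\<close>
    have e: "i + r + j = r + (i + j)" by simp
    show "moment_S N s (i + r + j) \<le> ennreal (mom N s r * mom N s (i + j))"
      unfolding e using mom_add[OF N, of s r "i + j"] s by (simp add: moment_S_eq_mom[OF N] ennreal_leI)
  qed
  also have "\<dots> = ennreal ((\<Sum>r\<le>R. mom N s r) * mom N s (i + j))"
    by (simp add: sum_ennreal sum_distrib_right)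
  finally show ?thesis unfolding K_def[symmetric] by (subst (asm) ennreal_le_iff) (auto intro!: mult_nonneg_nonneg sum_nonneg)
qed

lemma mom_supermultiplicative:
  fixes M :: "'n::finite aff measure"
  assumes M: "prob_H M" "moments_H M" and Ms: "\<And>n. prob_H (Ms n)" "\<And>n. moments_H (Ms n)" and W: "W_conv Ms M"
    and irr: "no_invariant_family (semigrp_T M)" and ne: "semigrp_T M \<noteq> {}" and s: "0 < s"
  shows "\<exists>c>0. \<forall>\<^sub>F n in sequentially. \<forall>i j. c * mom (Ms n) s i * mom (Ms n) s j \<le> mom (Ms n) s (i + j)"
proof -
  obtain c R where c: "c > 0" and ev: "\<forall>\<^sub>F n in sequentially. \<forall>a x. ennreal (c * (opnorm a powr s * norm x powr s)) \<le>
           (\<Sum>r\<le>R. \<integral>\<^sup>+Y. ennreal (norm (a *v (Y *v x)) powr s) \<partial>law (Ms n) r)"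
    using nonvanishing_lower_bound[OF M(1) Ms(1) W irr ne s] by blast
  have "\<forall>r. \<exists>A\<ge>0. \<forall>n. mom (Ms n) s r \<le> A" using mom_uniform_bound[OF M Ms W s] by blast
  then obtain A where A: "\<And>r. A r \<ge> 0" "\<And>r n. mom (Ms n) s r \<le> A r" by metis
  define B where "B = (\<Sum>r\<le>R. A r) + 1"
  have B: "B > 0" unfolding B_def using A(1) by (intro add_nonneg_pos sum_nonneg) auto
  have "\<forall>\<^sub>F n in sequentially. \<forall>i j. c / CARD('n) powr s / B * mom (Ms n) s i * mom (Ms n) s j \<le> mom (Ms n) s (i + j)"
    using ev
  proof (rule eventually_mono, intro allI)
    fix n i j
    assume lb: "\<forall>a x. ennreal (c * (opnorm a powr s * norm x powr s)) \<le>
           (\<Sum>r\<le>R. \<integral>\<^sup>+Y. ennreal (norm (a *v (Y *v x)) powr s) \<partial>law (Ms n) r)"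
    have "c / CARD('n) powr s * mom (Ms n) s i * mom (Ms n) s j \<le> (\<Sum>r\<le>R. mom (Ms n) s r) * mom (Ms n) s (i + j)"
      using lb by (intro moment_lower[OF Ms c s]) blast
    also have "\<dots> \<le> B * mom (Ms n) s (i + j)"
      unfolding B_def using sum_mono[of "{..R}" "mom (Ms n) s" A] A(2) by (intro mult_right_mono) (auto intro: add_increasing2)
    finally show "c / CARD('n) powr s / B * mom (Ms n) s i * mom (Ms n) s j \<le> mom (Ms n) s (i + j)"
      using B by (simp add: field_simps)
  qed
  then show ?thesis using c B by (intro exI[of _ "c / CARD('n) powr s / B"]) auto
qed

subsection \<open>The critical exponent\<close>

text \<open>If \<open>L\<close> is superharmonic and comparable to \<open>norm x powr \<alpha>\<close>, then its square root is strictly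
  superharmonic near every direction that some element of the semigroup expands or contracts a lot,
  because \<open>E (X - 1)\<^sup>2 \<le> 2 - 2 E X\<close> when \<open>E X\<^sup>2 \<le> 1\<close>.\<close>
lemma sqrt_superharmonic_step:
  fixes M :: "'n::finite aff measure" and L :: "real^'n \<Rightarrow> real"
  assumes M: "prob_H M" and L: "L \<in> borel_measurable borel" "\<And>x. 0 \<le> L x"
    and sup: "(\<integral>\<^sup>+Y. ennreal (L (Y *v x)) \<partial>law M r) \<le> ennreal (L x)"
    and U: "U \<in> sets borel" "ennreal p \<le> emeasure (law M r) U" "0 \<le> p"
    and far: "\<And>Y. Y \<in> U \<Longrightarrow> 4 * L x \<le> L (Y *v x) \<or> 4 * L (Y *v x) \<le> L x"
  shows "(\<integral>\<^sup>+Y. ennreal (sqrt (L (Y *v x))) \<partial>law M r) \<le> ennreal ((1 - p / 8) * sqrt (L x))"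
proof -
  interpret prob_space "law M r" by (rule prob_space_law[OF M])
  note [measurable] = L(1) U(1)
  define f where "f x = sqrt (L x)" for x
  have f0: "0 \<le> f x" and ff: "f x * f x = L x" for x using L(2)[of x] by (simp_all add: f_def)
  have fm [measurable]: "f \<in> borel_measurable borel" unfolding f_def by measurable
  have iL: "integrable (law M r) (\<lambda>Y. L (Y *v x))"
  proof (rule integrableI_nonneg)
    show "(\<integral>\<^sup>+Y. ennreal (L (Y *v x)) \<partial>law M r) < \<infinity>" using sup by (rule order_le_less_trans) simp
  qed (use L(2) in auto)
  have EL: "(\<integral>Y. L (Y *v x) \<partial>law M r) \<le> L x"
  proof -
    have "ennreal (\<integral>Y. L (Y *v x) \<partial>law M r) = (\<integral>\<^sup>+Y. ennreal (L (Y *v x)) \<partial>law M r)"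
      using L(2) by (intro nn_integral_eq_integral[symmetric] iL) auto
    then have "ennreal (\<integral>Y. L (Y *v x) \<partial>law M r) \<le> ennreal (L x)" using sup by simp
    then show ?thesis using ennreal_le_iff[OF L(2)] by blast
  qed
  have fL: "f y \<le> 1 + L y" for y
  proof -
    have "0 \<le> (f y - 1) * (f y - 1)" by simp
    then have "2 * f y \<le> 1 + f y * f y" by (simp add: algebra_simps)
    then show ?thesis using ff[of y] f0[of y] by linarith
  qed
  have if': "integrable (law M r) (\<lambda>Y. f (Y *v x))"
  proof (rule Bochner_Integration.integrable_bound)
    show "integrable (law M r) (\<lambda>Y. 1 + L (Y *v x))" using iL by simp
    show "AE Y in law M r. norm (f (Y *v x)) \<le> norm (1 + L (Y *v x))"
      using fL f0 L(2) by (intro AE_I2) (simp add: abs_of_nonneg add_nonneg_nonneg)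
  qed measurable
  have mU: "p \<le> measure (law M r) U"
    using U(2,3) by (simp add: emeasure_eq_measure)
  \<comment> \<open>The right-hand side is a square. On \<open>U\<close> the values of
    \<open>L\<close> differ by a factor of at least 4, those of \<open>f\<close> by at least 2, so
    the square is at least L x / 4.\<close>
  have sq: "indicator U Y * (L x / 4) \<le> L (Y *v x) - 2 * f x * f (Y *v x) + L x" for Y
  proof -
    have e: "L (Y *v x) - 2 * f x * f (Y *v x) + L x = (f (Y *v x) - f x)\<^sup>2"
      by (simp add: ff[symmetric] power2_eq_square algebra_simps)
    show ?thesis
    proof (cases "Y \<in> U")
      case True
      have sq4: "sqrt (4 * t) = 2 * sqrt t" for t :: real by (simp add: real_sqrt_mult)
      have "f x / 2 \<le> \<bar>f (Y *v x) - f x\<bar>"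
        using far[OF True]
      proof
        assume "4 * L x \<le> L (Y *v x)"
        then have "sqrt (4 * L x) \<le> sqrt (L (Y *v x))" by simp
        then have "2 * f x \<le> f (Y *v x)" by (simp add: f_def sq4)
        then show ?thesis using f0[of x] by linarith
      next
        assume "4 * L (Y *v x) \<le> L x"
        then have "sqrt (4 * L (Y *v x)) \<le> sqrt (L x)" by simp
        then have "2 * f (Y *v x) \<le> f x" by (simp add: f_def sq4)
        then show ?thesis using f0[of x] by linarith
      qed
      then have "(f x / 2)\<^sup>2 \<le> \<bar>f (Y *v x) - f x\<bar>\<^sup>2" using f0[of x] by (intro power_mono) auto
      then show ?thesis unfolding e using True ff[of x] by (simp add: power2_eq_square)
    qed (simp add: e)
  qed
  have "(\<integral>Y. indicator U Y * (L x / 4) \<partial>law M r) \<le> (\<integral>Y. L (Y *v x) - 2 * f x * f (Y *v x) + L x \<partial>law M r)"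
  proof (rule integral_mono)
    show "integrable (law M r) (\<lambda>Y. indicator U Y * (L x / 4))"
      using U(1) by (intro integrable_mult_left integrable_real_indicator) (auto simp: emeasure_eq_measure)
  qed (use iL if' sq in auto)
  also have "\<dots> = (\<integral>Y. L (Y *v x) \<partial>law M r) - 2 * f x * (\<integral>Y. f (Y *v x) \<partial>law M r) + L x"
    using iL if' prob_space by simp
  finally have "measure (law M r) U * (L x / 4) \<le> 2 * L x - 2 * f x * (\<integral>Y. f (Y *v x) \<partial>law M r)"
    using EL U(1) by simp
  moreover have "p * (L x / 4) \<le> measure (law M r) U * (L x / 4)" using mU L(2)[of x] by (intro mult_right_mono) auto
  \<comment> \<open>Superharmonicity bounds the mean square by 2 L x - 2 f(x) E f. Comparing with p
    L x / 4 gives the factor 1 - p/8.\<close>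
  ultimately have "2 * f x * (\<integral>Y. f (Y *v x) \<partial>law M r) \<le> 2 * f x * ((1 - p / 8) * f x)"
    by (simp add: ff[symmetric] algebra_simps)
  have main: "(\<integral>Y. f (Y *v x) \<partial>law M r) \<le> (1 - p / 8) * f x"
  proof (cases "f x = 0")
    \<comment> \<open>No division by f(x) is possible here, but superharmonicity makes
      \<open>L\<close> vanish almost surely after r steps.\<close>
    case True
    then have "L x = 0" using ff[of x] by simp
    then have "(\<integral>\<^sup>+Y. ennreal (L (Y *v x)) \<partial>law M r) = 0" using sup by simp
    then have "AE Y in law M r. ennreal (L (Y *v x)) = 0"
      by (subst (asm) nn_integral_0_iff_AE) measurable
    then have "AE Y in law M r. f (Y *v x) = 0"
      by eventually_elim (use L(2) in \<open>simp add: f_def ennreal_eq_0_iff antisym\<close>)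
    then have "(\<integral>Y. f (Y *v x) \<partial>law M r) = 0" by (rule integral_eq_zero_AE)
    then show ?thesis using True by simp
  next
    case False
    then have "2 * f x > 0" using f0[of x] by simp
    then show ?thesis
      using \<open>2 * f x * (\<integral>Y. f (Y *v x) \<partial>law M r) \<le> 2 * f x * ((1 - p / 8) * f x)\<close> by (simp only: mult_le_cancel_left_pos)
  qed
  have "(\<integral>\<^sup>+Y. ennreal (f (Y *v x)) \<partial>law M r) = ennreal (\<integral>Y. f (Y *v x) \<partial>law M r)"
    using f0 by (intro nn_integral_eq_integral if') auto
  also have "\<dots> \<le> ennreal ((1 - p / 8) * f x)" using main by (rule ennreal_leI)
  finally show ?thesis by (simp add: f_def)
qed

text \<open>No convergence of the sums \<open>A n\<close> is known. The lower limit suffices because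
  Fatou's lemma points in the direction of superharmonicity, and m further steps only shift n. The
  bounds on all moments make the limit comparable to |x|^s.\<close>

lemma liminf_superharmonic:
  fixes M :: "'n::finite aff measure"
  assumes M: "prob_H M" "moments_H M" and s: "0 < s" and c: "0 < c"
    and lb: "\<And>a x. ennreal (c * (opnorm a powr s * norm x powr s)) \<le>
           (\<Sum>r\<le>R. \<integral>\<^sup>+Y. ennreal (norm (a *v (Y *v x)) powr s) \<partial>law M r)"
    and mom: "\<And>m. 1 \<le> mom M s m" "\<And>m. mom M s m \<le> C"
  shows "\<exists>L. L \<in> borel_measurable borel \<and> (\<forall>x. c * norm x powr s \<le> L x \<and> L x \<le> real (Suc R) * C * norm x powr s)
     \<and> (\<forall>m x. (\<integral>\<^sup>+Y. ennreal (L (Y *v x)) \<partial>law M m) \<le> ennreal (L x))"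
proof -
  interpret P: prob_space "law M n" for n by (rule prob_space_law[OF M(1)])
  define A where "A n x = (\<Sum>r\<le>R. \<integral>\<^sup>+Z. ennreal (norm (Z *v x) powr s) \<partial>law M (n + r))" for n and x :: "real^'n"
  define l where "l x = liminf (\<lambda>n. A n x)" for x
  have C0: "0 \<le> C" using mom[of 0] by linarith
  have Am [measurable]: "A n \<in> borel_measurable borel" for n unfolding A_def by measurable
  have lm [measurable]: "l \<in> borel_measurable borel" unfolding l_def by measurable
  have Alow: "ennreal (c * norm x powr s) \<le> A n x" for n x
  proof -
    have "ennreal (c * norm x powr s) * 1 \<le> ennreal (c * norm x powr s) * moment_S M s n"
      using mom(1)[of n] s by (intro mult_left_mono) (auto simp: moment_S_eq_mom[OF M])
    also have "\<dots> \<le> A n x" unfolding A_def by (rule vector_moment_lower[OF M(1) c lb])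
    finally show ?thesis by simp
  qed
  have Aup: "A n x \<le> ennreal (real (Suc R) * C * norm x powr s)" for n x
  proof -
    have "(\<integral>\<^sup>+Z. ennreal (norm (Z *v x) powr s) \<partial>law M k) \<le> ennreal (C * norm x powr s)" for k
    proof -
      have "(\<integral>\<^sup>+Z. ennreal (norm (Z *v x) powr s) \<partial>law M k) \<le> (\<integral>\<^sup>+Z. ennreal (opnorm Z powr s) * ennreal (norm x powr s) \<partial>law M k)"
        using s by (intro nn_integral_mono)
          (auto simp: ennreal_mult[symmetric] powr_mult[symmetric] intro!: ennreal_leI powr_mono2 opnorm_mv)
      also have "\<dots> = moment_S M s k * ennreal (norm x powr s)"
        unfolding moment_S_law[OF M(1)] by (rule nn_integral_multc) simp
      also have "\<dots> \<le> ennreal (C * norm x powr s)"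
        using mom(2)[of k] s by (simp add: moment_S_eq_mom[OF M] ennreal_mult[symmetric] ennreal_leI mult_right_mono)
      finally show ?thesis .
    qed
    then have "A n x \<le> (\<Sum>r\<le>R. ennreal (C * norm x powr s))" unfolding A_def by (intro sum_mono)
    also have "\<dots> = ennreal (real (Suc R) * C * norm x powr s)"
      using C0 by (subst sum_ennreal) (auto simp: mult.assoc)
    finally show ?thesis .
  qed
  have low: "ennreal (c * norm x powr s) \<le> l x" for x
    unfolding l_def using Alow by (intro Liminf_bounded) simp
  have up: "l x \<le> ennreal (real (Suc R) * C * norm x powr s)" for x
  proof -
    have "l x \<le> limsup (\<lambda>n. A n x)" unfolding l_def by (intro Liminf_le_Limsup) simp
    also have "\<dots> \<le> ennreal (real (Suc R) * C * norm x powr s)"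
      using Aup by (intro Limsup_bounded) simp
    finally show ?thesis .
  qed
  have shift: "(\<integral>\<^sup>+Y. A n (Y *v x) \<partial>law M m) = A (n + m) x" for n m x
  proof -
    have "(\<integral>\<^sup>+Y. A n (Y *v x) \<partial>law M m) =
      (\<Sum>r\<le>R. \<integral>\<^sup>+Y. (\<integral>\<^sup>+Z. ennreal (norm (Z *v (Y *v x)) powr s) \<partial>law M (n + r)) \<partial>law M m)"
      unfolding A_def by (intro nn_integral_sum) measurable
    also have "\<dots> = (\<Sum>r\<le>R. \<integral>\<^sup>+Z. ennreal (norm (Z *v x) powr s) \<partial>law M (n + r + m))"
      by (subst law_add[OF M(1)]) (auto simp: matrix_vector_mul_assoc)
    also have "\<dots> = A (n + m) x" unfolding A_def by (simp add: add_ac)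
    finally show ?thesis .
  qed
  have sup: "(\<integral>\<^sup>+Y. l (Y *v x) \<partial>law M m) \<le> l x" for m x
  proof -
    have "(\<integral>\<^sup>+Y. l (Y *v x) \<partial>law M m) \<le> liminf (\<lambda>n. \<integral>\<^sup>+Y. A n (Y *v x) \<partial>law M m)"
      unfolding l_def by (rule nn_integral_liminf) measurable
    also have "\<dots> = liminf (\<lambda>n. A (n + m) x)" by (simp only: shift)
    also have "\<dots> = l x" unfolding l_def by (rule liminf_shift_k)
    finally show ?thesis .
  qed
  define L where "L x = enn2real (l x)" for x
  have Ll: "ennreal (L x) = l x" for x
    unfolding L_def using up[of x] by (auto simp: ennreal_enn2real_if top_unique)
  have "L \<in> borel_measurable borel" unfolding L_def by measurable
  moreover have "c * norm x powr s \<le> L x" "L x \<le> real (Suc R) * C * norm x powr s" for x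
    using low[of x] up[of x] unfolding Ll[symmetric] using c C0
    by (auto simp: L_def ennreal_le_iff simp del: of_nat_Suc)
  ultimately show ?thesis using sup by (intro exI[of _ L]) (simp add: Ll)
qed

text \<open>At the critical exponent the two sides of \<open>log_k\<close> and
  \<open>log_k_ge\<close> pin the moments between 1 and 1/c1, which is what
  \<open>liminf_superharmonic\<close> needs. By compactness of the sphere the root of the
  superharmonic function contracts by a fixed factor over m0 steps from every starting vector;
  iterating gives geometric decay along multiples of m0.\<close>

lemma half_moment_small:
  fixes M :: "'n::finite aff measure"
  assumes M: "prob_H M" "moments_H M" and ip: "cond_ip (semigrp_T M)" and d: "CARD('n) > 1"
    and \<alpha>: "0 < \<alpha>" "log_k M \<alpha> = 0" and \<epsilon>: "0 < \<epsilon>"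
  shows "\<exists>m>0. mom M (\<alpha> / 2) m < \<epsilon>"
proof -
  let ?T = "semigrp_T M"
  obtain g where g: "g \<in> ?T" "proximal g" and irr: "no_invariant_family ?T"
    using ip by (auto simp: cond_ip_iff)
  have ne: "?T \<noteq> {}" using g by auto
  note Ws = W_conv_const[of M]
  have a0: "0 \<le> \<alpha>" using \<alpha> by simp
  note p = mom_pos[OF M a0]
  obtain c1 where c1: "c1 > 0" "\<And>i j. c1 * mom M \<alpha> i * mom M \<alpha> j \<le> mom M \<alpha> (i + j)"
    using mom_supermultiplicative[OF M M Ws irr ne \<alpha>(1)] by auto
  have am1: "1 \<le> mom M \<alpha> m" for m
  proof (cases "m = 0")
    case False
    have "0 \<le> ln (mom M \<alpha> m) / m" using log_k(2)[OF M a0, of m] \<alpha>(2) False by simp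
    then have "0 \<le> ln (mom M \<alpha> m)" using False by (simp add: zero_le_divide_iff)
    then show ?thesis using p[of m] by simp
  qed (simp add: mom_0[OF M(1)])
  have am2: "mom M \<alpha> m \<le> 1 / c1" for m
  proof (cases "m = 0")
    case True
    then show ?thesis using c1(2)[of 0 0] c1(1) by (simp add: mom_0[OF M(1)])
  next
    case False
    have "ln (c1 * mom M \<alpha> m) / m \<le> 0" using log_k_ge[OF M a0 c1, of m] \<alpha>(2) False by simp
    then have "ln (c1 * mom M \<alpha> m) \<le> 0" using False by (simp add: divide_le_0_iff)
    then have "c1 * mom M \<alpha> m \<le> 1" using c1(1) p[of m] by simp
    then show ?thesis using c1(1) by (simp add: field_simps)
  qed
  obtain c R where c: "c > 0" and lb: "\<And>a x. ennreal (c * (opnorm a powr \<alpha> * norm x powr \<alpha>)) \<le>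
           (\<Sum>r\<le>R. \<integral>\<^sup>+Y. ennreal (norm (a *v (Y *v x)) powr \<alpha>) \<partial>law M r)"
    using nonvanishing_lower_bound[OF M(1) M(1) Ws irr ne \<alpha>(1)] by auto
  define C where "C = real (Suc R) * (1 / c1)"
  obtain L where L: "L \<in> borel_measurable borel" "\<And>x. c * norm x powr \<alpha> \<le> L x" "\<And>x. L x \<le> C * norm x powr \<alpha>"
    "\<And>m x. (\<integral>\<^sup>+Y. ennreal (L (Y *v x)) \<partial>law M m) \<le> ennreal (L x)"
    using liminf_superharmonic[OF M \<alpha>(1) c lb am1 am2] unfolding C_def by blast
  have C: "C > 0" using c1(1) by (simp add: C_def)
  have L0: "0 \<le> L x" for x using L(2)[of x] c by (meson mult_nonneg_nonneg order_trans less_imp_le powr_ge_zero)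
  note [measurable] = L(1)
  define f where "f x = sqrt (L x)" for x
  have fm [measurable]: "f \<in> borel_measurable borel" unfolding f_def by measurable
  have f0: "0 \<le> f x" for x using L0 by (simp add: f_def)
  define G where "G m x = (\<integral>\<^sup>+Y. ennreal (f (Y *v x)) \<partial>law M m)" for m x
  \<comment> \<open>With \<open>U\<close> empty and p = 0 the strict step reduces to plain
    superharmonicity of the root.\<close>
  have G1: "G m x \<le> ennreal (f x)" for m x
    using sqrt_superharmonic_step[OF M(1) L(1) L0 L(4)[where m = m and x = x], of "{}" 0] by (simp add: G_def f_def)
  have Gadd: "G (m + k) x = (\<integral>\<^sup>+X. G m (X *v x) \<partial>law M k)" for m k x
    unfolding G_def by (subst law_add[OF M(1)]) (auto simp: matrix_vector_mul_assoc)
  \<comment> \<open>Chosen so that a ratio of norms beyond K forces a ratio of at least 4 between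
    values of \<open>L\<close>, whose comparison constants are c and C.\<close>
  define K where "K = (4 * C / c) powr (1 / \<alpha>)"
  have K: "K > 0" "K powr \<alpha> = 4 * C / c" using C c \<alpha>(1) by (simp_all add: K_def powr_powr)
  let ?S = "sphere (0 :: real^'n) 1"
  define good where "good q N U r pp \<longleftrightarrow> open N \<and> q \<in> N \<and> open U \<and> 0 < pp \<and> ennreal pp \<le> emeasure (law M r) U \<and>
      (\<forall>x\<in>N. \<forall>Y\<in>U. norm (Y *v x) > K \<or> norm (Y *v x) < 1 / K)"
    for q and N :: "(real^'n) set" and U :: "'n mat set" and r and pp :: real
  have "\<exists>N U r pp. good q N U r pp" if q: "q \<in> ?S" for q
  proof -
    have "q \<noteq> 0" using q by auto
    obtain u where u: "u \<in> ?T" "norm (u *v q) > K \<or> norm (u *v q) < 1 / K"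
      using orbit_escapes[OF semigrp_T_subset semigrp_T_mult irr g d \<open>q \<noteq> 0\<close> K(1)] by blast
    let ?h = "\<lambda>z :: (real^'n) \<times> 'n mat. norm (snd z *v fst z)"
    have "continuous_on UNIV ?h" by (intro continuous_intros)
    then have "open (?h -` ({K<..} \<union> {..<1 / K}))" by (intro open_vimage open_Un) auto
    moreover have "(q, u) \<in> ?h -` ({K<..} \<union> {..<1 / K})" using u(2) by auto
    ultimately obtain N U where NU: "open N" "open U" "(q, u) \<in> N \<times> U" "N \<times> U \<subseteq> ?h -` ({K<..} \<union> {..<1 / K})"
      by (rule open_prod_elim) (rule that, assumption+)
    obtain r pp where rp: "pp > 0" "ennreal pp \<le> emeasure (law M r) U"
      using reachable_open[OF M(1) M(1) Ws u(1) NU(2)] NU(3) by auto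
    have "norm (Y *v x) > K \<or> norm (Y *v x) < 1 / K" if "x \<in> N" "Y \<in> U" for x Y
    proof -
      have "(x, Y) \<in> N \<times> U" using that by simp
      then have "(x, Y) \<in> ?h -` ({K<..} \<union> {..<1 / K})" using NU(4) by blast
      then show ?thesis by simp
    qed
    then have "good q N U r pp" using NU rp unfolding good_def by blast
    then show ?thesis by blast
  qed
  then obtain N U r pp where gd: "\<And>q. q \<in> ?S \<Longrightarrow> good q (N q) (U q) (r q) (pp q)" by metis
  have oN: "\<And>q. q \<in> ?S \<Longrightarrow> open (N q)" and cov: "?S \<subseteq> (\<Union>q\<in>?S. N q)"
    using gd unfolding good_def by blast+
  obtain D where D: "D \<subseteq> ?S" "finite D" "?S \<subseteq> (\<Union>q\<in>D. N q)"
    by (rule compactE_image[OF compact_sphere oN cov])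
  have Sne: "?S \<noteq> {}" using vector_choose_size[of 1, where 'a = "real^'n"] by force
  then have Dne: "D \<noteq> {}" using D(3) by auto
  \<comment> \<open>Different directions contract at different times r q. All are at most
    \<open>m0\<close>, and the remaining steps do not increase the mean. The successor keeps
    \<open>m0\<close> positive.\<close>
  define m0 where "m0 = Suc (Max (r ` D))"
  define \<delta> where "\<delta> = Min (pp ` D) / 8"
  have pp: "pp q > 0" "pp q \<le> 1" if "q \<in> D" for q
  proof -
    interpret prob_space "law M (r q)" by (rule prob_space_law[OF M(1)])
    have 1: "good q (N q) (U q) (r q) (pp q)" using gd that D(1) by blast
    then show "pp q > 0" by (simp add: good_def)
    have "ennreal (pp q) \<le> 1" using 1 measure_le_1 by (auto simp: good_def emeasure_eq_measure intro: order_trans)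
    then show "pp q \<le> 1" by simp
  qed
  have \<delta>: "\<delta> > 0" "\<delta> \<le> 1"
  proof -
    have "Min (pp ` D) \<in> pp ` D" using D(2) Dne by (intro Min_in) auto
    then obtain q where q: "q \<in> D" "Min (pp ` D) = pp q" by blast
    show "\<delta> > 0" "\<delta> \<le> 1" using pp[OF q(1)] by (simp_all add: \<delta>_def q(2))
  qed
  have rm: "r q \<le> m0" if "q \<in> D" for q unfolding m0_def using that D(2) by (intro le_SucI Max_ge) auto
  have contr: "G m0 x \<le> ennreal ((1 - \<delta>) * f x)" for x
  proof (cases "x = 0")
    case True
    then have "f x = 0" using L(3)[of 0] L0[of 0] by (simp add: f_def)
    then show ?thesis using G1[of m0 x] by simp
  next
    case False
    then have nx: "norm x > 0" by simp
    then have "x /\<^sub>R norm x \<in> ?S" by simp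
    then obtain q where q: "q \<in> D" "x /\<^sub>R norm x \<in> N q" using D(3) by blast
    have gq: "good q (N q) (U q) (r q) (pp q)" using gd q(1) D(1) by blast
    have far: "4 * L x \<le> L (Y *v x) \<or> 4 * L (Y *v x) \<le> L x" if "Y \<in> U q" for Y
    proof -
      have "norm (Y *v (x /\<^sub>R norm x)) > K \<or> norm (Y *v (x /\<^sub>R norm x)) < 1 / K"
        using gq q(2) that unfolding good_def by blast
      moreover have "norm (Y *v (x /\<^sub>R norm x)) = norm (Y *v x) / norm x"
        using nx by (simp add: matrix_vector_mult_scaleR divide_inverse mult.commute)
      ultimately have "K * norm x < norm (Y *v x) \<or> K * norm (Y *v x) < norm x"
        using nx K(1) by (simp add: field_simps)
      then show ?thesis
      proof
        assume "K * norm x < norm (Y *v x)"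
        then have "(K * norm x) powr \<alpha> \<le> norm (Y *v x) powr \<alpha>" using K(1) \<alpha>(1) by (intro powr_mono2) auto
        then have "4 * C / c * norm x powr \<alpha> \<le> norm (Y *v x) powr \<alpha>" by (simp add: powr_mult K(2))
        then have "4 * (C * norm x powr \<alpha>) \<le> c * norm (Y *v x) powr \<alpha>" using c by (simp add: field_simps)
        then show ?thesis using L(2)[of "Y *v x"] L(3)[of x] by linarith
      next
        assume "K * norm (Y *v x) < norm x"
        then have "(K * norm (Y *v x)) powr \<alpha> \<le> norm x powr \<alpha>" using K(1) \<alpha>(1) by (intro powr_mono2) auto
        then have "4 * C / c * norm (Y *v x) powr \<alpha> \<le> norm x powr \<alpha>" by (simp add: powr_mult K(2))
        then have "4 * (C * norm (Y *v x) powr \<alpha>) \<le> c * norm x powr \<alpha>" using c by (simp add: field_simps)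
        then show ?thesis using L(2)[of x] L(3)[of "Y *v x"] by linarith
      qed
    qed
    have "G (r q) x \<le> ennreal ((1 - pp q / 8) * f x)"
      unfolding G_def f_def using gq pp(1)[OF q(1)] far
      by (intro sqrt_superharmonic_step[OF M(1) L(1) L0 L(4), where U = "U q"]) (auto simp: good_def)
    moreover have "(1 - pp q / 8) * f x \<le> (1 - \<delta>) * f x"
      unfolding \<delta>_def using q(1) D(2) f0 by (intro mult_right_mono) auto
    ultimately have "G (r q) x \<le> ennreal ((1 - \<delta>) * f x)" using ennreal_leI order_trans by blast
    moreover have "G m0 x \<le> G (r q) x"
    proof -
      have "G m0 x = G ((m0 - r q) + r q) x" using rm[OF q(1)] by simp
      also have "\<dots> \<le> (\<integral>\<^sup>+X. ennreal (f (X *v x)) \<partial>law M (r q))"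
        unfolding Gadd by (intro nn_integral_mono G1)
      finally show ?thesis by (simp add: G_def)
    qed
    ultimately show ?thesis by (rule order_trans[rotated])
  qed
  have iter: "G (j * m0) x \<le> ennreal ((1 - \<delta>) ^ j * f x)" for j x
  proof (induction j arbitrary: x)
    case 0
    then show ?case using G1[of 0 x] by simp
  next
    case (Suc j)
    have "G (Suc j * m0) x = (\<integral>\<^sup>+X. G (j * m0) (X *v x) \<partial>law M m0)"
      using Gadd[of "j * m0" m0 x] by (simp add: add.commute)
    also have "\<dots> \<le> (\<integral>\<^sup>+X. ennreal ((1 - \<delta>) ^ j) * ennreal (f (X *v x)) \<partial>law M m0)"
      using Suc \<delta> f0 by (intro nn_integral_mono) (simp add: ennreal_mult[symmetric])
    also have "\<dots> = ennreal ((1 - \<delta>) ^ j) * G m0 x"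
      unfolding G_def by (rule nn_integral_cmult) measurable
    also have "\<dots> \<le> ennreal ((1 - \<delta>) ^ j) * ennreal ((1 - \<delta>) * f x)" by (intro mult_left_mono contr) simp
    also have "\<dots> = ennreal ((1 - \<delta>) ^ Suc j * f x)" using \<delta> f0 by (simp add: ennreal_mult[symmetric] mult_ac)
    finally show ?case .
  qed
  \<comment> \<open>Back from vectors to matrices: the largest column dominates |Z|, and f(x) \<ge>
    sqrt c |x|^(\<alpha>/2).\<close>
  define B where "B = real CARD('n) powr (\<alpha> / 2) / sqrt c"
  have B0: "B \<ge> 0" using c by (simp add: B_def)
  have cols: "opnorm Z powr (\<alpha> / 2) \<le> (\<Sum>j\<in>UNIV. B * f (Z *v axis j 1))" for Z :: "'n mat"
  proof -
    obtain j where j: "opnorm Z \<le> CARD('n) * norm (Z *v axis j 1)" using opnorm_le_column by blast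
    have "opnorm Z powr (\<alpha> / 2) \<le> (CARD('n) * norm (Z *v axis j 1)) powr (\<alpha> / 2)"
      using j \<alpha> by (intro powr_mono2) auto
    also have "\<dots> = CARD('n) powr (\<alpha> / 2) * norm (Z *v axis j 1) powr (\<alpha> / 2)" by (simp add: powr_mult)
    also have "norm (Z *v axis j 1) powr (\<alpha> / 2) \<le> f (Z *v axis j 1) / sqrt c"
    proof -
      have "sqrt (t powr \<alpha>) = t powr (\<alpha> / 2)" if "0 \<le> t" for t :: real
        using that by (simp add: powr_half_sqrt[symmetric] powr_powr)
      moreover have "sqrt (c * norm (Z *v axis j 1) powr \<alpha>) \<le> f (Z *v axis j 1)"
        unfolding f_def using L(2) by simp
      ultimately show ?thesis using c by (simp add: real_sqrt_mult field_simps)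
    qed
    finally have "opnorm Z powr (\<alpha> / 2) \<le> B * f (Z *v axis j 1)" by (simp add: B_def mult_left_mono)
    also have "\<dots> \<le> (\<Sum>j\<in>UNIV. B * f (Z *v axis j 1))"
      using B0 f0 by (intro member_le_sum) auto
    finally show ?thesis .
  qed
  define E where "E = (\<Sum>j\<in>(UNIV :: 'n set). B * f (axis j 1))"
  have E0: "E \<ge> 0" unfolding E_def using B0 f0 by (intro sum_nonneg) auto
  have bound: "mom M (\<alpha> / 2) (j * m0) \<le> (1 - \<delta>) ^ j * E" for j
  proof -
    have "moment_S M (\<alpha> / 2) (j * m0) \<le> (\<integral>\<^sup>+Z. (\<Sum>k\<in>UNIV. ennreal B * ennreal (f (Z *v axis k 1))) \<partial>law M (j * m0))"
      unfolding moment_S_law[OF M(1)]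
    proof (intro nn_integral_mono)
      fix Z :: "'n mat"
      have "(\<Sum>k\<in>UNIV. ennreal B * ennreal (f (Z *v axis k 1))) = ennreal (\<Sum>k\<in>UNIV. B * f (Z *v axis k 1))"
        using B0 f0 by (simp add: ennreal_mult[symmetric] sum_ennreal)
      then show "ennreal (opnorm Z powr (\<alpha> / 2)) \<le> (\<Sum>k\<in>UNIV. ennreal B * ennreal (f (Z *v axis k 1)))"
        using cols[of Z] by (simp add: ennreal_leI)
    qed
    also have "\<dots> = (\<Sum>k\<in>UNIV. \<integral>\<^sup>+Z. ennreal B * ennreal (f (Z *v axis k 1)) \<partial>law M (j * m0))"
      by (intro nn_integral_sum) measurable
    also have "\<dots> = (\<Sum>k\<in>UNIV. ennreal B * G (j * m0) (axis k 1))"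
      unfolding G_def by (intro sum.cong refl nn_integral_cmult) measurable
    also have "\<dots> \<le> (\<Sum>k\<in>(UNIV :: 'n set). ennreal B * ennreal ((1 - \<delta>) ^ j * f (axis k 1)))"
      by (intro sum_mono mult_left_mono iter) auto
    also have "\<dots> = ennreal ((1 - \<delta>) ^ j * E)"
      using B0 f0 \<delta> by (simp add: E_def ennreal_mult[symmetric] sum_ennreal sum_distrib_left mult_ac)
    finally show ?thesis
      using \<alpha> E0 \<delta> by (simp add: moment_S_eq_mom[OF M] ennreal_le_iff)
  qed
  have "(\<lambda>j. (1 - \<delta>) ^ j * E) \<longlonglongrightarrow> 0 * E"
    using \<delta> by (intro tendsto_mult LIMSEQ_realpow_zero tendsto_const) auto
  then have "\<forall>\<^sub>F j in sequentially. (1 - \<delta>) ^ j * E < \<epsilon>" using \<epsilon> by (intro order_tendstoD) auto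
  then obtain J where J: "\<And>j. j \<ge> J \<Longrightarrow> (1 - \<delta>) ^ j * E < \<epsilon>" by (auto simp: eventually_sequentially)
  have "mom M (\<alpha> / 2) (Suc J * m0) < \<epsilon>" using bound[of "Suc J"] J[of "Suc J"] by linarith
  moreover have "Suc J * m0 > 0" by (simp add: m0_def)
  ultimately show ?thesis by blast
qed

text \<open>The exponents s and t lie symmetrically about \<alpha>, so Cauchy-Schwarz gives 1 \<le>
  a_m(\<alpha>)^2 \<le> a_m(s) a_m(t), and a small moment at s means a large one at t. The exponents
  found for nearby laws lie between s and t and may vary with n.\<close>

lemma critical_exponent_stable:
  fixes M :: "'n::finite aff measure"
  assumes M: "prob_H M" "moments_H M" and Ms: "\<And>n. prob_H (Ms n)" "\<And>n. moments_H (Ms n)" and W: "W_conv Ms M"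
    and ip: "cond_ip (semigrp_T M)" and d: "CARD('n) > 1" and \<alpha>: "0 < \<alpha>" "k_eq_1 M \<alpha>"
  shows "\<forall>\<^sub>F n in sequentially. \<exists>\<beta>>0. k_eq_1 (Ms n) \<beta>"
proof -
  have k0: "log_k M \<alpha> = 0" using k_eq_1_iff[OF M] \<alpha> by simp
  obtain g where g: "g \<in> semigrp_T M" and irr: "no_invariant_family (semigrp_T M)"
    using ip by (auto simp: cond_ip_iff)
  define s t where "s = \<alpha> / 2" and "t = 3 * \<alpha> / 2"
  have st: "0 < s" "s < t" "0 < t" using \<alpha> by (auto simp: s_def t_def)
  note small = half_moment_small[OF M ip d \<alpha>(1) k0, folded s_def]
  obtain m1 where m1: "m1 > 0" "mom M s m1 < 1" using small[of 1] by auto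
  have "semigrp_T M \<noteq> {}" using g by auto
  then obtain c where c: "c > 0" and sup: "\<forall>\<^sub>F n in sequentially. \<forall>i j. c * mom (Ms n) t i * mom (Ms n) t j \<le> mom (Ms n) t (i + j)"
    using mom_supermultiplicative[OF M Ms W irr _ st(3)] by blast
  \<comment> \<open>The constant \<open>c\<close> of supermultiplicativity at t is fixed before m2,
    so that smallness below \<open>c\<close> at s becomes c a_m2(t) > 1, an open condition on the
    law that \<open>log_k_ge\<close> can use.\<close>
  obtain m2 where m2: "m2 > 0" "mom M s m2 < c" using small[OF c] by auto
  have big: "1 / c < mom M t m2"
  proof -
    have p: "mom M s m2 > 0" "mom M t m2 > 0" "mom M \<alpha> m2 > 0" using mom_pos[OF M] st \<alpha> by auto
    have "0 \<le> ln (mom M \<alpha> m2) / m2" using log_k(2)[OF M _ m2(1), of \<alpha>] \<alpha> k0 by simp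
    then have "1 \<le> mom M \<alpha> m2" using m2(1) p(3) by (simp add: zero_le_divide_iff)
    also have "mom M \<alpha> m2 \<le> mom M s m2 powr (1/2) * mom M t m2 powr (1/2)"
      using mom_log_convex[OF M, of s t "1/2" "1/2" m2] st by (simp add: s_def t_def)
    also have "\<dots> = sqrt (mom M s m2 * mom M t m2)" using p by (simp add: powr_half_sqrt real_sqrt_mult)
    finally have "1 \<le> mom M s m2 * mom M t m2" by simp
    also have "\<dots> < c * mom M t m2" using m2(2) p(2) by (intro mult_strict_right_mono)
    finally show ?thesis using c by (simp add: field_simps)
  qed
  have e1: "\<forall>\<^sub>F n in sequentially. mom (Ms n) s m1 < 1"
    using order_tendstoD(2)[OF mom_tendsto[OF M Ms W st(1)] m1(2)] .
  have e2: "\<forall>\<^sub>F n in sequentially. 1 / c < mom (Ms n) t m2"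
    using order_tendstoD(1)[OF mom_tendsto[OF M Ms W st(3)] big] .
  show ?thesis using e1 e2 sup
  proof eventually_elim
    case (elim n)
    have "log_k (Ms n) s \<le> ln (mom (Ms n) s m1) / m1" using log_k(2)[OF Ms _ m1(1)] st by simp
    also have "\<dots> < 0" using elim(1) mom_pos[OF Ms, of s n m1] st m1(1) by (simp add: divide_neg_pos)
    finally have 1: "log_k (Ms n) s < 0" .
    have "0 < ln (c * mom (Ms n) t m2) / m2" using elim(2) c m2(1) by (simp add: field_simps)
    also have "\<dots> \<le> log_k (Ms n) t" using elim(3) st m2(1) by (intro log_k_ge[OF Ms _ c]) auto
    finally have 2: "0 < log_k (Ms n) t" .
    show ?case by (rule log_k_zero_exists[OF Ms st(1,2) 1 2])
  qed
qed

subsection \<open>Openness\<close>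

text \<open>Almost nearest points, up to 1/(n+1), give one sequence for all neighbourhoods at once.
  The sets may be empty for finitely many n, whence the eventual membership.\<close>

lemma approximating_sequence:
  fixes A :: "nat \<Rightarrow> 'a::metric_space set"
  assumes "\<And>U. open U \<Longrightarrow> u \<in> U \<Longrightarrow> \<forall>\<^sub>F n in sequentially. \<exists>u'\<in>A n. u' \<in> U"
  shows "\<exists>v. v \<longlonglongrightarrow> u \<and> (\<forall>\<^sub>F n in sequentially. v n \<in> A n)"
proof -
  have near: "\<forall>\<^sub>F n in sequentially. \<exists>u'\<in>A n. dist u' u < e" if "e > 0" for e
    using assms[of "ball u e"] that by (simp add: dist_commute)
  have ne: "\<forall>\<^sub>F n in sequentially. A n \<noteq> {}"
    using near[of 1] by (rule eventually_mono) auto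
  have "\<exists>v. A n \<noteq> {} \<longrightarrow> v \<in> A n \<and> dist u v < infdist u (A n) + inverse (real (Suc n))" for n
  proof (cases "A n = {}")
    case False
    have "\<exists>a\<in>A n. dist u a < infdist u (A n) + inverse (real (Suc n))"
      using False cInf_lessD[of "dist u ` A n" "infdist u (A n) + inverse (real (Suc n))"]
      by (auto simp: infdist_notempty)
    then show ?thesis by blast
  qed simp
  then obtain v where v: "\<And>n. A n \<noteq> {} \<Longrightarrow> v n \<in> A n \<and> dist u (v n) < infdist u (A n) + inverse (real (Suc n))"
    by metis
  have "v \<longlonglongrightarrow> u"
  proof (rule tendstoI)
    fix e :: real assume "e > 0"
    have "\<forall>\<^sub>F n in sequentially. inverse (real (Suc n)) < e / 2"
      using order_tendstoD(2)[OF LIMSEQ_inverse_real_of_nat, of "e / 2"] \<open>e > 0\<close> by simp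
    moreover have "\<forall>\<^sub>F n in sequentially. \<exists>u'\<in>A n. dist u' u < e / 2" using near[of "e / 2"] \<open>e > 0\<close> by simp
    ultimately show "\<forall>\<^sub>F n in sequentially. dist (v n) u < e"
    proof eventually_elim
      case (elim n)
      then obtain u' where u': "u' \<in> A n" "dist u' u < e / 2" by blast
      then have "infdist u (A n) < e / 2" using infdist_le[OF u'(1), of u] by (simp add: dist_commute)
      moreover have "A n \<noteq> {}" using u'(1) by auto
      then have "dist u (v n) < infdist u (A n) + inverse (real (Suc n))" using v by blast
      ultimately show ?case using elim(1) unfolding dist_commute[of "v n"] by linarith
    qed
  qed
  moreover have "\<forall>\<^sub>F n in sequentially. v n \<in> A n" using ne by (rule eventually_mono) (use v in blast)
  ultimately show ?thesis by blast
qed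

section \<open>Stability of proximality\<close>

lemma continuous_on_mat_minus_cmat:
  "continuous_on UNIV (\<lambda>p. mat (snd p) - cmat (fst p :: 'n::finite mat))"
proof -
  have h: "continuous_on UNIV (\<lambda>p :: 'n mat \<times> complex. (if i = j then snd p else 0) - complex_of_real (fst p $ i $ j))" for i j
    by (cases "i = j") (auto intro!: continuous_intros)
  have "continuous_on UNIV (\<lambda>p :: 'n mat \<times> complex. \<chi> i j. (if i = j then snd p else 0) - complex_of_real (fst p $ i $ j))"
    by (intro continuous_on_vec_lambda h)
  moreover have "mat (snd p) - cmat (fst p) = (\<chi> i j. (if i = j then snd p else 0) - complex_of_real (fst p $ i $ j))"
    for p :: "'n mat \<times> complex" by (simp add: vec_eq_iff mat_def cmat_def)
  ultimately show ?thesis by simp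
qed

lemma continuous_on_poly_cpoly:
  "continuous_on UNIV (\<lambda>p. poly (cpoly (fst p :: 'n::finite mat)) (snd p))"
  unfolding poly_cpoly by (intro continuous_on_det continuous_on_mat_minus_cmat)

lemma continuous_on_poly_pderiv_cpoly:
  "continuous_on UNIV (\<lambda>p. poly (pderiv (cpoly (fst p :: 'n::finite mat))) (snd p))"
  unfolding poly_pderiv_cpoly
proof (intro continuous_on_sum continuous_on_det)
  fix k :: 'n
  have h: "continuous_on UNIV (\<lambda>p :: 'n mat \<times> complex. if i = k then (if i = j then 1 else 0) else (mat (snd p) - cmat (fst p)) $ i $ j)" for i j
  proof (cases "i = k")
    case False
    then show ?thesis
      by (simp only: if_False) (intro continuous_on_component continuous_on_mat_minus_cmat)
  qed simp
  show "continuous_on UNIV (\<lambda>p :: 'n mat \<times> complex. \<chi> i j. if i = k then (if i = j then 1 else 0) else (mat (snd p) - cmat (fst p)) $ i $ j)"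
    by (intro continuous_on_vec_lambda h)
qed

lemma cpoly_root_bound:
  assumes "poly (cpoly (g :: 'n::finite mat)) z = 0"
  shows "cmod z \<le> (\<Sum>i\<in>UNIV. \<Sum>j\<in>UNIV. \<bar>g $ i $ j\<bar>)"
proof -
  obtain y where y: "y \<noteq> 0" "cmat g *v y = z *s y" using assms cpoly_root_iff by blast
  have "cmod z * norm y = norm (cmat g *v y)" by (simp add: y(2) norm_smult)
  also have "\<dots> \<le> (\<Sum>i\<in>UNIV. cmod ((cmat g *v y) $ i))" unfolding norm_vec_def by (rule L2_set_le_sum) simp
  also have "\<dots> \<le> (\<Sum>i\<in>UNIV. (\<Sum>j\<in>UNIV. \<bar>g $ i $ j\<bar>) * norm y)"
  proof (rule sum_mono)
    fix i
    have "cmod ((cmat g *v y) $ i) \<le> (\<Sum>j\<in>UNIV. cmod (complex_of_real (g $ i $ j) * y $ j))"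
      by (simp add: matrix_vector_mult_def cmat_def norm_sum del: norm_mult)
    also have "\<dots> \<le> (\<Sum>j\<in>UNIV. \<bar>g $ i $ j\<bar> * norm y)"
      by (intro sum_mono) (auto simp: norm_mult intro!: mult_left_mono Finite_Cartesian_Product.norm_nth_le)
    finally show "cmod ((cmat g *v y) $ i) \<le> (\<Sum>j\<in>UNIV. \<bar>g $ i $ j\<bar>) * norm y" by (simp add: sum_distrib_right)
  qed
  finally have "cmod z * norm y \<le> (\<Sum>i\<in>UNIV. \<Sum>j\<in>UNIV. \<bar>g $ i $ j\<bar>) * norm y" by (simp add: sum_distrib_right)
  then show ?thesis using y(1) by simp
qed

text \<open>The characteristic polynomial as a real function, to which sign changes and the
  intermediate value theorem apply.\<close>

definition char_det :: "'n::finite mat \<Rightarrow> real \<Rightarrow> real" where "char_det g x = det (mat x - g)"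

lemma char_det: "poly (cpoly g) (complex_of_real x) = complex_of_real (char_det g x)"
  unfolding poly_cpoly mat_minus_cmat det_cmat char_det_def ..

lemma char_det_DERIV:
  "((char_det g) has_real_derivative Re (poly (pderiv (cpoly g)) (complex_of_real x))) (at x)"
proof -
  have "((\<lambda>x. poly (cpoly g) (complex_of_real x)) has_vector_derivative poly (pderiv (cpoly g)) (complex_of_real x)) (at x)"
    by (rule has_vector_derivative_real_field[OF poly_DERIV])
  from bounded_linear.has_vector_derivative[OF bounded_linear_Re this]
  have "((\<lambda>x. Re (poly (cpoly g) (complex_of_real x))) has_vector_derivative Re (poly (pderiv (cpoly g)) (complex_of_real x))) (at x)" .
  then show ?thesis unfolding char_det by (simp add: has_real_derivative_iff_has_vector_derivative)
qed

lemma pderiv_cpoly_real: "poly (pderiv (cpoly g)) (complex_of_real x) \<in> \<real>"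
proof -
  have "(\<chi> i j. if i = k then (if i = j then 1 else 0) else (mat (complex_of_real x) - cmat g) $ i $ j)
     = cmat (\<chi> i j. if i = k then (if i = j then 1 else 0) else (mat x - g) $ i $ j)" for k
    by (simp add: vec_eq_iff cmat_def mat_def)
  then show ?thesis unfolding poly_pderiv_cpoly by (simp add: det_cmat)
qed

text \<open>Three facts replace the continuity of roots with multiplicity: near r the derivative
  stays close to a nonzero number, which makes a root there unique and simple; a sign change keeps
  it real; and a compactness argument holds the roots away from r below |r| - \<eta> in
  modulus.\<close>

lemma proximal_open:
  fixes g :: "'n::finite mat"
  assumes g: "proximal g" and lim: "gs \<longlonglongrightarrow> g"
  shows "\<forall>\<^sub>F n in sequentially. proximal (gs n)"
proof -
  obtain r where r: "poly (cpoly g) (complex_of_real r) = 0" "order (complex_of_real r) (cpoly g) = 1"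
     "\<And>z. poly (cpoly g) z = 0 \<Longrightarrow> z \<noteq> complex_of_real r \<Longrightarrow> cmod z < \<bar>r\<bar>"
    using g unfolding proximal_def by blast
  let ?r = "complex_of_real r"
  define a where "a = poly (pderiv (cpoly g)) ?r"
  have p0: "cpoly g \<noteq> 0" using r(3) by (rule cpoly_nonzero_if_dominant)
  have a0: "a \<noteq> 0" unfolding a_def using order_eq_1_iff[OF p0 r(1)] r(2) by blast
  have "open ((\<lambda>p :: 'n mat \<times> complex. poly (pderiv (cpoly (fst p))) (snd p)) -` ball a (cmod a / 2))"
    by (intro open_vimage open_ball continuous_on_poly_pderiv_cpoly)
  moreover have "(g, ?r) \<in> (\<lambda>p :: 'n mat \<times> complex. poly (pderiv (cpoly (fst p))) (snd p)) -` ball a (cmod a / 2)"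
    using a0 by (simp add: a_def)
  ultimately obtain A B where AB: "open A" "open B" "(g, ?r) \<in> A \<times> B"
    "A \<times> B \<subseteq> (\<lambda>p :: 'n mat \<times> complex. poly (pderiv (cpoly (fst p))) (snd p)) -` ball a (cmod a / 2)"
    by (rule open_prod_elim) (rule that, assumption+)
  obtain \<delta> where \<delta>: "\<delta> > 0" "ball ?r \<delta> \<subseteq> B" using AB(2,3) open_contains_ball by blast
  have near: "cmod (poly (pderiv (cpoly h)) z - a) < cmod a / 2" if "h \<in> A" "z \<in> ball ?r \<delta>" for h z
  proof -
    have "(h, z) \<in> A \<times> B" using that \<delta>(2) by auto
    then have "(h, z) \<in> (\<lambda>p :: 'n mat \<times> complex. poly (pderiv (cpoly (fst p))) (snd p)) -` ball a (cmod a / 2)"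
      using AB(4) by blast
    then show ?thesis by (simp add: dist_norm norm_minus_commute)
  qed
  \<comment> \<open>Subtracting a z leaves a function of derivative at most |a|/2 on the ball, so
    two roots z and w would satisfy |a| |z - w| \<le> |a| |z - w| / 2.\<close>
  have uniq: "z = w" if h: "h \<in> A" and z: "z \<in> ball ?r \<delta>" "w \<in> ball ?r \<delta>" "poly (cpoly h) z = 0" "poly (cpoly h) w = 0" for h z w
  proof -
    have "cmod ((poly (cpoly h) z - a * z) - (poly (cpoly h) w - a * w)) \<le> cmod a / 2 * cmod (z - w)"
    proof (rule field_differentiable_bound[where S = "ball ?r \<delta>" and f' = "\<lambda>z. poly (pderiv (cpoly h)) z - a"])
      fix z assume "z \<in> ball ?r \<delta>"
      show "((\<lambda>z. poly (cpoly h) z - a * z) has_field_derivative poly (pderiv (cpoly h)) z - a) (at z within ball ?r \<delta>)"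
        by (rule has_field_derivative_at_within) (auto intro!: derivative_eq_intros poly_DERIV)
      show "cmod (poly (pderiv (cpoly h)) z - a) \<le> cmod a / 2"
        using near[OF h \<open>z \<in> ball ?r \<delta>\<close>] by simp
    qed (use z in auto)
    moreover have "(poly (cpoly h) z - a * z) - (poly (cpoly h) w - a * w) = - (a * (z - w))"
      using z by (simp add: algebra_simps)
    ultimately have "cmod a * cmod (z - w) \<le> cmod a * (cmod (z - w) / 2)" by (simp add: norm_mult)
    moreover have "0 < cmod a" using a0 by simp
    ultimately have "cmod (z - w) \<le> cmod (z - w) / 2" by (simp only: mult_le_cancel_left_pos)
    then show ?thesis by simp
  qed
  \<comment> \<open>Otherwise bounded roots outside the ball accumulate at a root of the limit
    polynomial that differs from r and has modulus at least |r|.\<close>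
  have away: "\<exists>\<eta>>0. \<forall>\<^sub>F n in sequentially. \<forall>z. poly (cpoly (gs n)) z = 0 \<and> z \<notin> ball ?r \<delta> \<longrightarrow> cmod z \<le> \<bar>r\<bar> - \<eta>"
  proof (rule ccontr)
    assume "\<not> ?thesis"
    then have fr: "\<exists>\<^sub>F n in sequentially. \<exists>z. poly (cpoly (gs n)) z = 0 \<and> z \<notin> ball ?r \<delta> \<and> \<bar>r\<bar> - \<eta> < cmod z" if "\<eta> > 0" for \<eta>
      using that by (auto simp: not_eventually not_le)
    have "\<exists>n\<ge>k. \<exists>z. poly (cpoly (gs n)) z = 0 \<and> z \<notin> ball ?r \<delta> \<and> \<bar>r\<bar> - inverse (real (Suc k)) < cmod z" for k
      using fr[of "inverse (real (Suc k))"] unfolding frequently_sequentially by auto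
    then obtain N z where Nz: "\<And>k. N k \<ge> k" "\<And>k. poly (cpoly (gs (N k))) (z k) = 0" "\<And>k. z k \<notin> ball ?r \<delta>"
      "\<And>k. \<bar>r\<bar> - inverse (real (Suc k)) < cmod (z k)" by metis
    have "filterlim N sequentially sequentially"
      by (rule filterlim_at_top_mono[OF filterlim_ident]) (use Nz(1) in auto)
    then have gN: "(\<lambda>k. gs (N k)) \<longlonglongrightarrow> g" by (rule filterlim_compose[OF lim])
    have "(\<lambda>k. \<Sum>i\<in>UNIV. \<Sum>j\<in>UNIV. \<bar>gs (N k) $ i $ j\<bar>) \<longlonglongrightarrow> (\<Sum>i\<in>UNIV. \<Sum>j\<in>UNIV. \<bar>g $ i $ j\<bar>)"
      by (intro tendsto_intros gN)
    then have "Bseq (\<lambda>k. \<Sum>i\<in>UNIV. \<Sum>j\<in>UNIV. \<bar>gs (N k) $ i $ j\<bar>)"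
      by (intro convergent_imp_Bseq convergentI)
    then obtain C where C: "\<forall>k. norm (\<Sum>i\<in>UNIV. \<Sum>j\<in>UNIV. \<bar>gs (N k) $ i $ j\<bar>) \<le> C" by (elim BseqE)
    have "norm (z k) \<le> C" for k
    proof -
      have "cmod (z k) \<le> (\<Sum>i\<in>UNIV. \<Sum>j\<in>UNIV. \<bar>gs (N k) $ i $ j\<bar>)" by (rule cpoly_root_bound[OF Nz(2)])
      also have "\<dots> \<le> C" using C by (metis abs_le_D1 real_norm_def)
      finally show ?thesis .
    qed
    then have "bounded (range z)" by (auto simp: bounded_iff)
    then obtain w \<rho> where w: "strict_mono \<rho>" "(z \<circ> \<rho>) \<longlonglongrightarrow> w"
      using bounded_imp_convergent_subsequence by blast
    have g\<rho>: "(\<lambda>k. gs (N (\<rho> k))) \<longlonglongrightarrow> g"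
      using LIMSEQ_subseq_LIMSEQ[OF gN w(1)] by (simp add: o_def)
    have z\<rho>: "(\<lambda>k. z (\<rho> k)) \<longlonglongrightarrow> w" using w(2) by (simp add: o_def)
    have "(\<lambda>k. poly (cpoly (fst (gs (N (\<rho> k)), z (\<rho> k)))) (snd (gs (N (\<rho> k)), z (\<rho> k)))) \<longlonglongrightarrow> poly (cpoly (fst (g, w))) (snd (g, w))"
      by (rule continuous_on_tendsto_compose[OF continuous_on_poly_cpoly tendsto_Pair[OF g\<rho> z\<rho>]]) auto
    then have "(\<lambda>k. 0) \<longlonglongrightarrow> poly (cpoly g) w" using Nz(2) by simp
    then have root: "poly (cpoly g) w = 0" by (simp add: LIMSEQ_const_iff)
    have "closed (- ball ?r \<delta>)" by (simp add: closed_Compl)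
    then have "w \<in> - ball ?r \<delta>"
      by (rule closed_sequentially[OF _ _ z\<rho>]) (use Nz(3) in auto)
    then have "w \<noteq> ?r" using \<delta>(1) by auto
    have "(\<lambda>k. \<bar>r\<bar> - inverse (real (Suc (\<rho> k)))) \<longlonglongrightarrow> \<bar>r\<bar> - 0"
      using LIMSEQ_subseq_LIMSEQ[OF LIMSEQ_inverse_real_of_nat w(1)] by (intro tendsto_intros) (simp add: o_def)
    then have "\<bar>r\<bar> - 0 \<le> cmod w"
      by (rule LIMSEQ_le[OF _ tendsto_norm[OF z\<rho>]]) (use Nz(4) in \<open>auto intro!: exI[of _ 0] less_imp_le\<close>)
    then show False using r(3)[OF root \<open>w \<noteq> ?r\<close>] by simp
  qed
  then obtain \<eta> where \<eta>: "\<eta> > 0" "\<forall>\<^sub>F n in sequentially. \<forall>z. poly (cpoly (gs n)) z = 0 \<and> z \<notin> ball ?r \<delta> \<longrightarrow> cmod z \<le> \<bar>r\<bar> - \<eta>"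
    by blast
  \<comment> \<open>Below \<delta> so that the real root lies in the ball of uniqueness, below
    \<eta> so that its modulus exceeds |r| - \<eta>.\<close>
  define e where "e = min (\<delta> / 2) (\<eta> / 2)"
  have e: "e > 0" "e < \<delta>" "e < \<eta>" using \<delta>(1) \<eta>(1) by (auto simp: e_def)
  have "\<forall>\<^sub>F n in sequentially. \<exists>x. \<bar>x - r\<bar> \<le> e \<and> char_det (gs n) x = 0"
  proof -
    have r0: "char_det g r = 0" using r(1) unfolding char_det by simp
    have D0: "Re a \<noteq> 0"
      using a0 pderiv_cpoly_real[of g r] unfolding a_def by (metis complex_is_Real_iff complex_eq_0 complex_surj complex_eqI zero_complex.sel)
    have sgn: "\<exists>x y. r - e \<le> x \<and> x \<le> y \<and> y \<le> r + e \<and> char_det g x * char_det g y < 0"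
    proof -
      note D = char_det_DERIV[of g r, folded a_def]
      have "\<exists>x y. r - e \<le> x \<and> x \<le> y \<and> y \<le> r + e \<and> ((char_det g x < 0 \<and> 0 < char_det g y) \<or> (0 < char_det g x \<and> char_det g y < 0))"
      proof (cases "Re a > 0")
        case True
        obtain d1 where d1: "d1 > 0" "\<forall>h>0. h < d1 \<longrightarrow> char_det g r < char_det g (r + h)" using DERIV_pos_inc_right[OF D True] by blast
        obtain d2 where d2: "d2 > 0" "\<forall>h>0. h < d2 \<longrightarrow> char_det g (r - h) < char_det g r" using DERIV_pos_inc_left[OF D True] by blast
        define h where "h = min e (min (d1 / 2) (d2 / 2))"
        have "h > 0" "h < d1" "h < d2" "h \<le> e" using e d1 d2 by (auto simp: h_def)
        then show ?thesis using d1(2) d2(2) r0 by (intro exI[of _ "r - h"] exI[of _ "r + h"]) auto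
      next
        case False
        then have neg: "Re a < 0" using D0 by simp
        obtain d1 where d1: "d1 > 0" "\<forall>h>0. h < d1 \<longrightarrow> char_det g (r + h) < char_det g r" using DERIV_neg_dec_right[OF D neg] by blast
        obtain d2 where d2: "d2 > 0" "\<forall>h>0. h < d2 \<longrightarrow> char_det g r < char_det g (r - h)" using DERIV_neg_dec_left[OF D neg] by blast
        define h where "h = min e (min (d1 / 2) (d2 / 2))"
        have "h > 0" "h < d1" "h < d2" "h \<le> e" using e d1 d2 by (auto simp: h_def)
        then show ?thesis using d1(2) d2(2) r0 by (intro exI[of _ "r - h"] exI[of _ "r + h"]) auto
      qed
      then show ?thesis by (blast intro: mult_neg_pos mult_pos_neg)
    qed
    then obtain x y where xy: "r - e \<le> x" "x \<le> y" "y \<le> r + e" "char_det g x * char_det g y < 0" by blast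
    have "(\<lambda>n. char_det (gs n) x * char_det (gs n) y) \<longlonglongrightarrow> char_det g x * char_det g y"
      unfolding char_det_def by (intro tendsto_intros lim)
    from order_tendstoD(2)[OF this xy(4)] show ?thesis
    proof eventually_elim
      case (elim n)
      have cont: "continuous_on {x..y} (char_det (gs n))"
        by (intro continuous_at_imp_continuous_on ballI DERIV_isCont[OF char_det_DERIV])
      have "(char_det (gs n) x < 0 \<and> 0 < char_det (gs n) y) \<or> (0 < char_det (gs n) x \<and> char_det (gs n) y < 0)"
        using elim by (auto simp: mult_less_0_iff)
      then obtain t where "x \<le> t" "t \<le> y" "char_det (gs n) t = 0"
        using IVT'[of "char_det (gs n)" x 0 y] IVT2'[of "char_det (gs n)" y 0 x] xy(2) cont by fastforce
      then show ?case using xy by (intro exI[of _ t]) auto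
    qed
  qed
  moreover have "\<forall>\<^sub>F n in sequentially. gs n \<in> A" using topological_tendstoD[OF lim AB(1)] AB(3) by auto
  ultimately show ?thesis using \<eta>(2)
  proof eventually_elim
    case (elim n)
    then obtain x where x: "\<bar>x - r\<bar> \<le> e" "char_det (gs n) x = 0" by blast
    let ?x = "complex_of_real x"
    have root: "poly (cpoly (gs n)) ?x = 0" unfolding char_det x(2) by simp
    have "cmod (?r - ?x) = \<bar>r - x\<bar>" by (simp only: of_real_diff[symmetric] norm_of_real)
    then have xb: "?x \<in> ball ?r \<delta>" using x(1) e by (simp add: dist_norm)
    have "poly (pderiv (cpoly (gs n))) ?x \<noteq> 0"
      using near[OF elim(2) xb] a0 by auto
    moreover from this have "cpoly (gs n) \<noteq> 0" by auto
    ultimately have o: "order ?x (cpoly (gs n)) = 1" using order_eq_1_iff[OF _ root] by blast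
    have "cmod z < \<bar>x\<bar>" if z: "poly (cpoly (gs n)) z = 0" "z \<noteq> ?x" for z
    proof -
      have "z \<notin> ball ?r \<delta>" using uniq[OF elim(2) _ xb z(1) root] z(2) by blast
      then have "cmod z \<le> \<bar>r\<bar> - \<eta>" using elim(3) z(1) by blast
      then show ?thesis using x(1) e by linarith
    qed
    then show ?case unfolding proximal_def using root o by blast
  qed
qed

text \<open>From each offending family only one member W is kept, through a unit vector w of W and a
  unit normal m, together with the eigenvectors v and f of the proximal element. The resulting
  condition holds for all u in the nearby semigroup and is closed, so it passes to the
  limit.\<close>

lemma no_invariant_family_open:
  fixes M :: "'n::finite aff measure"
  assumes M: "prob_H M" and Ms: "\<And>n. prob_H (Ms n)" and W: "W_conv Ms M" and ip: "cond_ip (semigrp_T M)"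
  shows "\<forall>\<^sub>F n in sequentially. cond_ip (semigrp_T (Ms n))"
proof -
  let ?T = "\<lambda>n. semigrp_T (Ms n)"
  obtain g where g: "g \<in> semigrp_T M" "proximal g" and irr: "no_invariant_family (semigrp_T M)"
    using ip by (auto simp: cond_ip_iff)
  have appr: "\<exists>v. v \<longlonglongrightarrow> u \<and> (\<forall>\<^sub>F n in sequentially. v n \<in> ?T n)" if "u \<in> semigrp_T M" for u
    by (rule approximating_sequence) (rule semigrp_T_approx[OF M Ms W that])
  obtain gs where gs: "gs \<longlonglongrightarrow> g" "\<forall>\<^sub>F n in sequentially. gs n \<in> ?T n" using appr[OF g(1)] by blast
  have prox: "\<forall>\<^sub>F n in sequentially. gs n \<in> ?T n \<and> proximal (gs n)"
    using gs(2) proximal_open[OF g(2) gs(1)] by (rule eventually_conj)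
  have "\<forall>\<^sub>F n in sequentially. no_invariant_family (?T n)"
  proof (rule ccontr)
    assume "\<not> ?thesis"
    moreover have "\<forall>\<^sub>F n in sequentially. no_invariant_family (?T n)"
      if "\<forall>\<^sub>F n in sequentially. \<not> (\<not> no_invariant_family (?T n) \<and> gs n \<in> ?T n \<and> proximal (gs n))"
      using that prox by eventually_elim auto
    ultimately have "\<not> (\<forall>\<^sub>F n in sequentially. \<not> (\<not> no_invariant_family (?T n) \<and> gs n \<in> ?T n \<and> proximal (gs n)))"
      by blast
    from not_eventually_sequentiallyD[OF this]
    obtain \<sigma> :: "nat \<Rightarrow> nat" where \<sigma>: "strict_mono \<sigma>" and bad: "\<And>n. \<not> no_invariant_family (?T (\<sigma> n))"
      and good: "\<And>n. gs (\<sigma> n) \<in> ?T (\<sigma> n)" "\<And>n. proximal (gs (\<sigma> n))"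
      by blast
    let ?S = "sphere (0 :: real^'n) 1"
    \<comment> \<open>The quadruple t is (v, f, w, m). The alternative of two vanishing inner
      products is coded as one vanishing product, which survives limits.\<close>
    have "\<exists>t. t \<in> ?S \<times> ?S \<times> ?S \<times> ?S \<and> (\<forall>u\<in>?T (\<sigma> n).
        (fst (snd t) \<bullet> (u *v fst (snd (snd t)))) * (snd (snd (snd t)) \<bullet> (matrix_inv u *v fst t)) = 0)" for n
    proof -
      have gG: "gs (\<sigma> n) \<in> Gset" using good(1) semigrp_T_subset by blast
      obtain r v f where pr: "r \<noteq> 0" "v \<noteq> 0" "gs (\<sigma> n) *v v = r *\<^sub>R v" "f \<noteq> 0" "transpose (gs (\<sigma> n)) *v f = r *\<^sub>R f"
        "\<And>y. gs (\<sigma> n) *v y = r *\<^sub>R y \<Longrightarrow> \<exists>c. y = c *\<^sub>R v"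
        "\<And>z. poly (cpoly (gs (\<sigma> n))) z = 0 \<Longrightarrow> z \<noteq> complex_of_real r \<Longrightarrow> cmod z < \<bar>r\<bar>"
        by (rule proximalE[OF good(2) gG]) blast
      obtain F where F: "finite F" "F \<noteq> {}" "\<And>W. W \<in> F \<Longrightarrow> subspace W" "\<And>W. W \<in> F \<Longrightarrow> W \<noteq> {0}" "\<And>W. W \<in> F \<Longrightarrow> W \<noteq> UNIV"
        "\<And>u W. u \<in> ?T (\<sigma> n) \<Longrightarrow> W \<in> F \<Longrightarrow> (*v) u ` W \<in> F"
        using bad[of n] unfolding no_invariant_family_def by auto
      obtain W where W: "W \<in> F" using F(2) by blast
      obtain w where w: "w \<in> W" "w \<noteq> 0" using F(3,4)[OF W] subspace_0 by blast
      have "span W \<noteq> UNIV" using F(3,5)[OF W] span_eq_iff by metis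
      then have "dim W < DIM(real^'n)"
        using dim_subset_UNIV[of W] dim_eq_full[of W] by linarith
      then obtain m where m: "m \<noteq> 0" "\<And>y. y \<in> span W \<Longrightarrow> orthogonal m y"
        using orthogonal_to_subspace_exists by blast
      \<comment> \<open>\<open>proximal_invariant_family\<close> is applied to the image of W under
        u, again a member of the family: either it contains v, so that the preimage of v is
        orthogonal to m, or f vanishes on u w.\<close>
      have zero: "f \<bullet> (u *v w) = 0 \<or> m \<bullet> (matrix_inv u *v v) = 0" if u: "u \<in> ?T (\<sigma> n)" for u
      proof -
        have uG: "u \<in> Gset" using u semigrp_T_subset by blast
        have "v \<in> (*v) u ` W \<or> (\<forall>y\<in>(*v) u ` W. f \<bullet> y = 0)"
          by (rule proximal_invariant_family[OF gG pr(1,2,3,5,6,7) F(1,3) F(6)[OF good(1)] F(6)[OF u W]])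
        then show ?thesis
        proof
          assume "v \<in> (*v) u ` W"
          then obtain y where "y \<in> W" "v = u *v y" by auto
          then show ?thesis using m(2)[of y] by (simp add: matrix_inv_mv(2)[OF uG] orthogonal_def span_base)
        qed (use w(1) in auto)
      qed
      let ?t = "(v /\<^sub>R norm v, f /\<^sub>R norm f, w /\<^sub>R norm w, m /\<^sub>R norm m)"
      show ?thesis
        using pr(2,4) w(2) m(1) zero
        by (intro exI[of _ ?t]) (auto simp: matrix_vector_mult_scaleR)
    qed
    then obtain t where t: "\<And>n. t n \<in> ?S \<times> ?S \<times> ?S \<times> ?S" "\<And>n u. u \<in> ?T (\<sigma> n) \<Longrightarrow>
        (fst (snd (t n)) \<bullet> (u *v fst (snd (snd (t n))))) * (snd (snd (snd (t n))) \<bullet> (matrix_inv u *v fst (t n))) = 0"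
      by metis
    have "compact (?S \<times> ?S \<times> ?S \<times> ?S)" by (intro compact_Times compact_sphere)
    then have "seq_compact (?S \<times> ?S \<times> ?S \<times> ?S)" by (rule compact_imp_seq_compact)
    moreover have "\<forall>n. t n \<in> ?S \<times> ?S \<times> ?S \<times> ?S" using t(1) by blast
    ultimately obtain l \<rho> where l: "l \<in> ?S \<times> ?S \<times> ?S \<times> ?S" "strict_mono \<rho>" "(t \<circ> \<rho>) \<longlonglongrightarrow> l"
      by (rule seq_compactE)
    obtain v f w m where vfwm: "l = (v, f, w, m)" by (cases l)
    then have nz: "norm v = 1" "norm f = 1" "norm w = 1" "norm m = 1" using l(1) by auto
    have tl: "(\<lambda>k. t (\<rho> k)) \<longlonglongrightarrow> (v, f, w, m)" using l(3) vfwm by (simp add: o_def)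
    have c: "(\<lambda>k. fst (t (\<rho> k))) \<longlonglongrightarrow> v" "(\<lambda>k. fst (snd (t (\<rho> k)))) \<longlonglongrightarrow> f"
      "(\<lambda>k. fst (snd (snd (t (\<rho> k))))) \<longlonglongrightarrow> w" "(\<lambda>k. snd (snd (snd (t (\<rho> k))))) \<longlonglongrightarrow> m"
      using tendsto_fst[OF tl] tendsto_fst[OF tendsto_snd[OF tl]] tendsto_fst[OF tendsto_snd[OF tendsto_snd[OF tl]]]
        tendsto_snd[OF tendsto_snd[OF tendsto_snd[OF tl]]] by simp_all
    have all0: "(f \<bullet> (u *v w)) * (m \<bullet> (matrix_inv u *v v)) = 0" if u: "u \<in> semigrp_T M" for u
    proof -
      have uG: "u \<in> Gset" using u semigrp_T_subset by blast
      obtain us where us: "us \<longlonglongrightarrow> u" "\<forall>\<^sub>F n in sequentially. us n \<in> ?T n" using appr[OF u] by blast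
      have sm: "strict_mono (\<sigma> \<circ> \<rho>)" using \<sigma> l(2) by (rule strict_mono_o)
      have ul: "(\<lambda>k. us (\<sigma> (\<rho> k))) \<longlonglongrightarrow> u" using LIMSEQ_subseq_LIMSEQ[OF us(1) sm] by (simp add: o_def)
      have ue: "\<forall>\<^sub>F k in sequentially. us (\<sigma> (\<rho> k)) \<in> ?T (\<sigma> (\<rho> k))"
        using eventually_subseq[OF sm us(2)] by simp
      have "(\<lambda>k. (fst (snd (t (\<rho> k))) \<bullet> (us (\<sigma> (\<rho> k)) *v fst (snd (snd (t (\<rho> k)))))) *
          (snd (snd (snd (t (\<rho> k)))) \<bullet> (matrix_inv (us (\<sigma> (\<rho> k))) *v fst (t (\<rho> k))))) \<longlonglongrightarrow> (f \<bullet> (u *v w)) * (m \<bullet> (matrix_inv u *v v))"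
        by (intro tendsto_intros c ul tendsto_matrix_inv uG)
      moreover have "\<forall>\<^sub>F k in sequentially. (fst (snd (t (\<rho> k))) \<bullet> (us (\<sigma> (\<rho> k)) *v fst (snd (snd (t (\<rho> k)))))) *
          (snd (snd (snd (t (\<rho> k)))) \<bullet> (matrix_inv (us (\<sigma> (\<rho> k))) *v fst (t (\<rho> k)))) = 0"
        using ue by (rule eventually_mono) (rule t(2))
      then have "(\<lambda>k. (fst (snd (t (\<rho> k))) \<bullet> (us (\<sigma> (\<rho> k)) *v fst (snd (snd (t (\<rho> k)))))) *
          (snd (snd (snd (t (\<rho> k)))) \<bullet> (matrix_inv (us (\<sigma> (\<rho> k))) *v fst (t (\<rho> k))))) \<longlonglongrightarrow> 0"
        by (rule tendsto_eventually)
      ultimately show ?thesis by (rule LIMSEQ_unique)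
    qed
    have ne: "semigrp_T M \<noteq> {}" using g(1) by auto
    have "\<exists>u\<in>semigrp_T M. f \<bullet> (u *v w) \<noteq> 0 \<and> m \<bullet> (matrix_inv u *v v) \<noteq> 0"
      by (rule strong_irreducible_pair[OF semigrp_T_subset ne _ irr]) (use nz semigrp_T_mult in auto)
    then show False using all0 by auto
  qed
  then show ?thesis using prox by eventually_elim (auto simp: cond_ip_iff)
qed

text \<open>Fixed points are written in homogeneous coordinates (x/s, 1/s), which stay bounded. A
  limit (y, t) satisfies g y + t b = y on the support of \<open>M\<close>: for t nonzero y/t is a
  fixed point, and for t = 0 the line through y is invariant, against irreducibility in dimension
  greater than 1.\<close>

lemma no_fixed_point_open:
  fixes M :: "'n::finite aff measure"
  assumes M: "prob_H M" and Ms: "\<And>n. prob_H (Ms n)" and W: "W_conv Ms M"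
    and irr: "no_invariant_family (semigrp_T M)" and d: "CARD('n) > 1"
    and nofix: "\<not> (\<exists>x. \<forall>h\<in>supp_H M. fst h *v x + snd h = x)"
  shows "\<forall>\<^sub>F n in sequentially. \<not> (\<exists>x. \<forall>h\<in>supp_H (Ms n). fst h *v x + snd h = x)"
proof (rule ccontr)
  assume "\<not> ?thesis"
  from not_eventually_sequentiallyD[OF this]
  obtain \<sigma> :: "nat \<Rightarrow> nat" where \<sigma>: "strict_mono \<sigma>" "\<And>n. \<exists>x. \<forall>h\<in>supp_H (Ms (\<sigma> n)). fst h *v x + snd h = x"
    by blast
  then obtain x where x: "\<And>n h. h \<in> supp_H (Ms (\<sigma> n)) \<Longrightarrow> fst h *v x n + snd h = x n" by metis
  \<comment> \<open>With this choice |x|/s + 1/s = 1, so y and t cannot both vanish in the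
    limit.\<close>
  define s where "s n = norm (x n) + 1" for n
  have s: "s n > 0" for n by (simp add: s_def add_nonneg_pos)
  define z where "z n = (x n /\<^sub>R s n, 1 / s n)" for n
  have "norm (z n) \<le> 2" for n
  proof -
    have "norm (z n) \<le> norm (x n /\<^sub>R s n) + norm (1 / s n)" unfolding z_def by (rule norm_Pair_le)
    also have "\<dots> \<le> 1 + 1"
      using s[of n] by (intro add_mono) (auto simp: s_def field_simps)
    finally show ?thesis by simp
  qed
  then have "bounded (range z)" by (auto simp: bounded_iff)
  from bounded_imp_convergent_subsequence[OF this]
  obtain l \<rho> where l: "strict_mono \<rho>" "(z \<circ> \<rho>) \<longlonglongrightarrow> l" by blast
  define y t where "y = fst l" and "t = snd l"
  have yl: "(\<lambda>k. x (\<rho> k) /\<^sub>R s (\<rho> k)) \<longlonglongrightarrow> y" and tl: "(\<lambda>k. 1 / s (\<rho> k)) \<longlonglongrightarrow> t"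
    using tendsto_fst[OF l(2)] tendsto_snd[OF l(2)] by (simp_all add: y_def t_def z_def o_def)
  have lim: "fst h *v y + t *\<^sub>R snd h = y" if h: "h \<in> supp_H M" for h
  proof -
    obtain hs where hs: "hs \<longlonglongrightarrow> h" "\<forall>\<^sub>F n in sequentially. hs n \<in> supp_H (Ms n)"
      using approximating_sequence[of h "\<lambda>n. supp_H (Ms n)"] W_conv_supp_H[OF M Ms W h] by blast
    have sm: "strict_mono (\<sigma> \<circ> \<rho>)" using \<sigma>(1) l(1) by (rule strict_mono_o)
    have hl: "(\<lambda>k. hs (\<sigma> (\<rho> k))) \<longlonglongrightarrow> h" using LIMSEQ_subseq_LIMSEQ[OF hs(1) sm] by (simp add: o_def)
    have he: "\<forall>\<^sub>F k in sequentially. hs (\<sigma> (\<rho> k)) \<in> supp_H (Ms (\<sigma> (\<rho> k)))"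
      using eventually_subseq[OF sm hs(2)] by simp
    have "(\<lambda>k. fst (hs (\<sigma> (\<rho> k))) *v (x (\<rho> k) /\<^sub>R s (\<rho> k)) + (1 / s (\<rho> k)) *\<^sub>R snd (hs (\<sigma> (\<rho> k)))) \<longlonglongrightarrow> fst h *v y + t *\<^sub>R snd h"
      by (intro tendsto_intros yl tl hl)
    moreover have "\<forall>\<^sub>F k in sequentially. fst (hs (\<sigma> (\<rho> k))) *v (x (\<rho> k) /\<^sub>R s (\<rho> k)) +
        (1 / s (\<rho> k)) *\<^sub>R snd (hs (\<sigma> (\<rho> k))) = x (\<rho> k) /\<^sub>R s (\<rho> k)"
      using he
    proof eventually_elim
      case (elim k)
      from x[OF elim] have "(fst (hs (\<sigma> (\<rho> k))) *v x (\<rho> k) + snd (hs (\<sigma> (\<rho> k)))) /\<^sub>R s (\<rho> k) = x (\<rho> k) /\<^sub>R s (\<rho> k)" by simp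
      then show ?case by (simp add: matrix_vector_mult_scaleR scaleR_add_right inverse_eq_divide)
    qed
    ultimately have "(\<lambda>k. x (\<rho> k) /\<^sub>R s (\<rho> k)) \<longlonglongrightarrow> fst h *v y + t *\<^sub>R snd h"
      by (rule Lim_transform_eventually)
    then show ?thesis using yl by (rule LIMSEQ_unique)
  qed
  show False
  proof (cases "t = 0")
    case False
    have "fst h *v (y /\<^sub>R t) + snd h = y /\<^sub>R t" if "h \<in> supp_H M" for h
    proof -
      have "(fst h *v y + t *\<^sub>R snd h) /\<^sub>R t = y /\<^sub>R t" using lim[OF that] by simp
      then show ?thesis using False by (simp add: scaleR_add_right matrix_vector_mult_scaleR)
    qed
    then show False using nofix by blast
  next
    case True
    have "norm (x (\<rho> k) /\<^sub>R s (\<rho> k)) + 1 / s (\<rho> k) = 1" for k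
      using s[of "\<rho> k"] by (simp add: s_def field_simps)
    moreover have "(\<lambda>k. norm (x (\<rho> k) /\<^sub>R s (\<rho> k)) + 1 / s (\<rho> k)) \<longlonglongrightarrow> norm y + t"
      by (intro tendsto_intros yl tl)
    ultimately have "norm y = 1" using True by (simp add: LIMSEQ_const_iff)
    then have y0: "y \<noteq> 0" by auto
    have "semigrp_T M \<subseteq> {g. g *v y = y}"
    proof (rule semigrp_T_least)
      have cl: "closed {g :: 'n mat. g *v y = y}"
        by (intro closed_Collect_eq continuous_intros)
      then show "closed {g :: 'n mat. g *v y = y}" .
      show "supp_G M \<subseteq> {g. g *v y = y}"
      proof (rule ccontr)
        assume "\<not> ?thesis"
        then obtain g where g: "g \<in> supp_G M" "g \<in> - {g. g *v y = y}" by auto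
        obtain h where "h \<in> supp_H M" "fst h \<in> - {g. g *v y = y}"
          using supp_G_approx[OF M g(1) _ g(2)] cl by (auto simp: open_Compl)
        then show False using lim[of h] True by auto
      qed
      fix a b :: "'n mat" assume "a \<in> {g. g *v y = y}" "b \<in> {g. g *v y = y}"
      then show "a ** b \<in> {g. g *v y = y}" by (simp add: matrix_vector_mul_assoc[symmetric])
    qed
      then have gy: "g *v y = y" if "g \<in> semigrp_T M" for g using that by auto
    have inv: "(*v) g ` span {y} = span {y}" if "g \<in> semigrp_T M" for g
      using linear_span_image[of "(*v) g" "{y}"] by (simp add: gy[OF that])
    have "dim (span {y}) \<le> 1" unfolding dim_span using dim_le_card'[of "{y}"] by simp
    moreover have "dim (UNIV :: (real^'n) set) > 1" using d by simp
    ultimately have "span {y} \<noteq> UNIV" by (metis not_less)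
    moreover have "span {y} \<noteq> {0}" using y0 span_base[of y "{y}"] by auto
    ultimately show False
      using inv by (intro no_invariant_familyD[OF irr, of "{span {y}}"]) auto
  qed
qed

text \<open>All moments are finite, so the integrability conditions hold at whatever critical
  exponent is found, with \<epsilon> = 1.\<close>

lemma moment_conditions:
  fixes M :: "'n::finite aff measure"
  assumes M: "prob_H M" "moments_H M" and \<beta>: "0 < \<beta>"
  shows "(\<integral>\<^sup>+h. ennreal (ln (gamma (fst h))) \<partial>M) < \<infinity>"
    "(\<integral>\<^sup>+h. ennreal (opnorm (fst h) powr \<beta> * gamma (fst h) powr 1 + norm (snd h) powr (\<beta> + 1)) \<partial>M) < \<infinity>"
proof -
  interpret prob_space M by (rule prob_HD(1)[OF M(1)])
  obtain k where k: "\<beta> + 1 \<le> real k" using real_arch_simple by blast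
  \<comment> \<open>The summand 1 covers translations of norm below 1, for which the power \<beta> +
    1 may exceed the larger integer power k.\<close>
  define \<Psi> where "\<Psi> k h = gamma (fst h) ^ k + norm (snd h) ^ k + 1" for k and h :: "'n aff"
  have fin: "(\<integral>\<^sup>+h. ennreal (\<Psi> k h) \<partial>M) < \<infinity>" for k
  proof -
    have "integrable M (\<lambda>h. gamma (fst h) ^ k + norm (snd h) ^ k)" using M(2) by (simp add: moments_H_def)
    then have "integrable M (\<Psi> k)" unfolding \<Psi>_def by simp
    then have "(\<integral>\<^sup>+h. ennreal (norm (\<Psi> k h)) \<partial>M) < \<infinity>" by (simp add: integrable_iff_bounded)
    moreover have "norm (\<Psi> k h) = \<Psi> k h" for h by (simp add: \<Psi>_def add_nonneg_nonneg)
    ultimately show ?thesis by simp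
  qed
  have "(\<integral>\<^sup>+h. ennreal (ln (gamma (fst h))) \<partial>M) \<le> (\<integral>\<^sup>+h. ennreal (\<Psi> 1 h) \<partial>M)"
  proof (rule nn_integral_mono_AE)
    show "AE h in M. ennreal (ln (gamma (fst h))) \<le> ennreal (\<Psi> 1 h)"
      using AE_Gset[OF M(1)]
    proof eventually_elim
      case (elim h)
      have "ln (gamma (fst h)) \<le> gamma (fst h)"
        using ln_le_minus_one[of "gamma (fst h)"] gamma_ge_1[OF elim] by linarith
      then show ?case unfolding \<Psi>_def by (intro ennreal_leI) (simp add: add_increasing2)
    qed
  qed
  then show "(\<integral>\<^sup>+h. ennreal (ln (gamma (fst h))) \<partial>M) < \<infinity>" using fin by (rule order_le_less_trans)
  have "(\<integral>\<^sup>+h. ennreal (opnorm (fst h) powr \<beta> * gamma (fst h) powr 1 + norm (snd h) powr (\<beta> + 1)) \<partial>M) \<le> (\<integral>\<^sup>+h. ennreal (\<Psi> k h) \<partial>M)"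
  proof (rule nn_integral_mono_AE)
    show "AE h in M. ennreal (opnorm (fst h) powr \<beta> * gamma (fst h) powr 1 + norm (snd h) powr (\<beta> + 1)) \<le> ennreal (\<Psi> k h)"
      using AE_Gset[OF M(1)]
    proof eventually_elim
      case (elim h)
      note g1 = gamma_ge_1[OF elim]
      have "opnorm (fst h) powr \<beta> * gamma (fst h) powr 1 \<le> gamma (fst h) powr \<beta> * gamma (fst h) powr 1"
        using \<beta> opnorm_le_gamma by (intro mult_right_mono powr_mono2) auto
      also have "\<dots> = gamma (fst h) powr (\<beta> + 1)" by (simp only: powr_add)
      also have "\<dots> \<le> gamma (fst h) powr k" using k g1 by (intro powr_mono) auto
      also have "\<dots> = gamma (fst h) ^ k" using g1 by (intro powr_realpow) simp
      finally have 1: "opnorm (fst h) powr \<beta> * gamma (fst h) powr 1 \<le> gamma (fst h) ^ k" .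
      have 2: "norm (snd h) powr (\<beta> + 1) \<le> norm (snd h) ^ k + 1"
      proof (cases "norm (snd h) \<le> 1")
        case True
        then have "norm (snd h) powr (\<beta> + 1) \<le> 1 powr (\<beta> + 1)" using \<beta> by (intro powr_mono2) auto
        then show ?thesis by (simp add: add_increasing)
      next
        case False
        then have "norm (snd h) powr (\<beta> + 1) \<le> norm (snd h) powr k" using k by (intro powr_mono) auto
        also have "\<dots> = norm (snd h) ^ k" using False by (intro powr_realpow) (use norm_ge_zero[of "snd h"] in linarith)
        finally show ?thesis by simp
      qed
      show ?case unfolding \<Psi>_def using 1 2 by (intro ennreal_leI) linarith
    qed
  qed
  then show "(\<integral>\<^sup>+h. ennreal (opnorm (fst h) powr \<beta> * gamma (fst h) powr 1 + norm (snd h) powr (\<beta> + 1)) \<partial>M) < \<infinity>"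
    using fin by (rule order_le_less_trans)
qed

theorem theorem6p1:
  fixes M :: "'n::finite aff measure" and Ms :: "nat \<Rightarrow> 'n aff measure"
  assumes "CARD('n) > 1"
    and "prob_H M" and "moments_H M"
    and "\<forall>n. prob_H (Ms n) \<and> moments_H (Ms n)"
    and "cond_ce M"
    and "W_conv Ms M"
  shows "\<forall>\<^sub>F n in sequentially. cond_ce (Ms n)"
proof -
  note d = assms(1) and M = assms(2,3) and W = assms(6)
  have Ms: "prob_H (Ms n)" "moments_H (Ms n)" for n using assms(4) by auto
  have ip: "cond_ip (semigrp_T M)" and nofix: "\<not> (\<exists>x. \<forall>h\<in>supp_H M. fst h *v x + snd h = x)"
    using assms(5) d by (auto simp: cond_ce_def)
  have irr: "no_invariant_family (semigrp_T M)" using ip by (simp add: cond_ip_iff)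
  obtain \<alpha> where \<alpha>: "0 < \<alpha>" "k_eq_1 M \<alpha>" using assms(5) by (auto simp: cond_ce_def)
  have e1: "\<forall>\<^sub>F n in sequentially. \<exists>\<beta>>0. k_eq_1 (Ms n) \<beta>"
    by (rule critical_exponent_stable[OF M Ms W ip d \<alpha>])
  have e2: "\<forall>\<^sub>F n in sequentially. cond_ip (semigrp_T (Ms n))"
    by (rule no_invariant_family_open[OF M(1) Ms(1) W ip])
  have e3: "\<forall>\<^sub>F n in sequentially. \<not> (\<exists>x. \<forall>h\<in>supp_H (Ms n). fst h *v x + snd h = x)"
    by (rule no_fixed_point_open[OF M(1) Ms(1) W irr d nofix])
  show ?thesis using e1 e2 e3
  proof eventually_elim
    case (elim n)
    then obtain \<beta> where \<beta>: "0 < \<beta>" "k_eq_1 (Ms n) \<beta>" by blast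
    show ?case unfolding cond_ce_def
      using elim(2,3) \<beta> moment_conditions[OF Ms \<beta>(1), of n] zero_less_one by blast
  qed
qed

end
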